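(* Let $(M,\eta,\omega)$ be a closed conformal symplectic manifold and $H:M\to\mathbb{R}$ a Hamiltonian with flow $(\varphi_t)$ and winding $r_t$. Let $A\subset M$ be a weak attractor of $(\varphi_t)$ with basin of attraction $U$. Then for almost every point $x\in U\setminus A$, $r_t(x)\to-\infty$ as $t\to+\infty$. In particular, the Lee form $\eta$ is not exact in any neighbourhood of $A\cap\{H=0\}$.
   Context: A conformal symplectic manifold $(M,\eta,\omega)$ is a smooth manifold $M$ of even dimension with a closed 1-form $\eta$ (the Lee form) and a non-degenerate 2-form $\omega$ such that $\mathrm{d}_\eta\omega=0$, where $\mathrm{d}_\eta\alpha:=\mathrm{d}\alpha-\eta\wedge\alpha$. Given a smooth $H:M\to\mathbb{R}$ (the Hamiltonian), its Hamiltonian vector field $X$ is defined by $\iota_X\omega=\mathrm{d}_\eta H=\mathrm{d}H-H\eta$, and $(\varphi_t)$ denotes its flow. The winding is $r_t(x):=\int_0^t\eta(X(\varphi_s(x)))\,\mathrm{d}s$. An invariant compact subset $A\subset M$ is a weak attractor if there exists an open subset $U\supset A$, called a basin of attraction of $A$, such that $\bigcup_{x\in U}\omega(x)\subset A$, where $\omega(x)$ is the $\omega$-limit set of $x$ under $(\varphi_t)$ as $t\to+\infty$. "Almost every" refers to any volume form on $M$.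
   Formalization: The "in particular" clause is stated under the assumption that U is strictly larger than A; for U = A it fails in general, e.g. η = 0 and A = U = M. *)

theory Defs
  imports "HOL-Analysis.Analysis"
begin

section \<open>Smooth maps between open subsets of Euclidean spaces\<close>

primrec Ck_on :: "nat \<Rightarrow> 'a::euclidean_space set \<Rightarrow> ('a \<Rightarrow> 'b::real_normed_vector) \<Rightarrow> bool" where
  "Ck_on 0 S f \<longleftrightarrow> continuous_on S f"
| "Ck_on (Suc n) S f \<longleftrightarrow>
     (\<forall>x\<in>S. f differentiable (at x)) \<and>
     (\<forall>v. Ck_on n S (\<lambda>x. frechet_derivative f (at x) v))"

definition smooth_on :: "'a::euclidean_space set \<Rightarrow> ('a \<Rightarrow> 'b::real_normed_vector) \<Rightarrow> bool" where
  "smooth_on S f \<longleftrightarrow> (\<forall>n. Ck_on n S f)"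


section \<open>Smooth manifolds\<close>

text \<open>The points of the manifold are all elements of a type \<^typ>\<open>'m\<close>; a chart is a pair
  of its domain and its coordinate map, which is arbitrary outside the domain. Smooth atlases
  need not be maximal.\<close>

type_synonym ('m, 'e) chart = "'m set \<times> ('m \<Rightarrow> 'e)"

abbreviation cdom :: "('m, 'e) chart \<Rightarrow> 'm set" where
  "cdom k \<equiv> fst k"

abbreviation cmap :: "('m, 'e) chart \<Rightarrow> 'm \<Rightarrow> 'e" where
  "cmap k \<equiv> snd k"

definition cinv :: "('m, 'e) chart \<Rightarrow> 'e \<Rightarrow> 'm" where
  "cinv k = inv_into (cdom k) (cmap k)"

definition cimage :: "('m, 'e) chart \<Rightarrow> 'e set" where
  "cimage k = cmap k ` cdom k"

definition transition :: "('m, 'e) chart \<Rightarrow> ('m, 'e) chart \<Rightarrow> 'e \<Rightarrow> 'e" where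
  "transition k l = cmap l \<circ> cinv k"

definition overlap :: "('m, 'e) chart \<Rightarrow> ('m, 'e) chart \<Rightarrow> 'e set" where
  "overlap k l = cmap k ` (cdom k \<inter> cdom l)"

definition smooth_atlas ::
  "('m::{t2_space, second_countable_topology}, 'e::euclidean_space) chart set \<Rightarrow> bool" where
  "smooth_atlas \<A> \<longleftrightarrow>
     (\<Union>k\<in>\<A>. cdom k) = UNIV \<and>
     (\<forall>k\<in>\<A>. open (cdom k) \<and> open (cimage k) \<and>
              homeomorphism (cdom k) (cimage k) (cmap k) (cinv k)) \<and>
     (\<forall>k\<in>\<A>. \<forall>l\<in>\<A>. smooth_on (overlap k l) (transition k l))"

definition smooth_function_on ::
  "('m::topological_space, 'e::euclidean_space) chart set \<Rightarrow> 'm set \<Rightarrow> ('m \<Rightarrow> real) \<Rightarrow> bool" where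
  "smooth_function_on \<A> V f \<longleftrightarrow>
     (\<forall>k\<in>\<A>. smooth_on (cmap k ` (cdom k \<inter> V)) (f \<circ> cinv k))"

text \<open>Being null in all charts is the same as being null for any volume form (or smooth
  positive density), since in coordinates these have a positive density with respect to
  Lebesgue measure.\<close>

definition null_set :: "('m, 'e::euclidean_space) chart set \<Rightarrow> 'm set \<Rightarrow> bool" where
  "null_set \<A> N \<longleftrightarrow> (\<forall>k\<in>\<A>. negligible (cmap k ` (cdom k \<inter> N)))"


section \<open>Vector fields and differential forms\<close>

text \<open>Tensor fields are given by their coordinate expressions in the charts of the atlas,
  subject to the transformation law under transition maps. The expression in a chart \<open>k\<close> is
  only meaningful on \<open>cimage k\<close>.\<close>

type_synonym ('m, 'e) vfield = "('m, 'e) chart \<Rightarrow> 'e \<Rightarrow> 'e"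
type_synonym ('m, 'e) form1 = "('m, 'e) chart \<Rightarrow> 'e \<Rightarrow> 'e \<Rightarrow> real"
type_synonym ('m, 'e) form2 = "('m, 'e) chart \<Rightarrow> 'e \<Rightarrow> 'e \<Rightarrow> 'e \<Rightarrow> real"

definition vector_field ::
  "('m, 'e::euclidean_space) chart set \<Rightarrow> ('m, 'e) vfield \<Rightarrow> bool" where
  "vector_field \<A> X \<longleftrightarrow>
     (\<forall>k\<in>\<A>. smooth_on (cimage k) (X k)) \<and>
     (\<forall>k\<in>\<A>. \<forall>l\<in>\<A>. \<forall>y\<in>overlap k l.
        X l (transition k l y) = frechet_derivative (transition k l) (at y) (X k y))"

definition one_form ::
  "('m, 'e::euclidean_space) chart set \<Rightarrow> ('m, 'e) form1 \<Rightarrow> bool" where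
  "one_form \<A> \<alpha> \<longleftrightarrow>
     (\<forall>k\<in>\<A>. (\<forall>y\<in>cimage k. linear (\<alpha> k y)) \<and>
              (\<forall>v. smooth_on (cimage k) (\<lambda>y. \<alpha> k y v))) \<and>
     (\<forall>k\<in>\<A>. \<forall>l\<in>\<A>. \<forall>y\<in>overlap k l. \<forall>v.
        \<alpha> k y v = \<alpha> l (transition k l y) (frechet_derivative (transition k l) (at y) v))"

definition two_form ::
  "('m, 'e::euclidean_space) chart set \<Rightarrow> ('m, 'e) form2 \<Rightarrow> bool" where
  "two_form \<A> \<omega> \<longleftrightarrow>
     (\<forall>k\<in>\<A>. (\<forall>y\<in>cimage k. bilinear (\<omega> k y) \<and> (\<forall>u. \<omega> k y u u = 0)) \<and>
              (\<forall>u v. smooth_on (cimage k) (\<lambda>y. \<omega> k y u v))) \<and>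
     (\<forall>k\<in>\<A>. \<forall>l\<in>\<A>. \<forall>y\<in>overlap k l. \<forall>u v.
        \<omega> k y u v = \<omega> l (transition k l y) (frechet_derivative (transition k l) (at y) u)
                                          (frechet_derivative (transition k l) (at y) v))"

text \<open>Exterior derivatives of functions, 1-forms and 2-forms, and the wedge product of a
  1-form with a 2-form, in the normalisation without factorials:
  \<open>(\<alpha> \<and> \<beta>)(u, v) = \<alpha>(u) \<beta>(v) - \<alpha>(v) \<beta>(u)\<close>.\<close>

definition ext_deriv0 :: "('m \<Rightarrow> real) \<Rightarrow> ('m, 'e::euclidean_space) form1" where
  "ext_deriv0 f k y v = frechet_derivative (f \<circ> cinv k) (at y) v"

definition ext_deriv1 :: "('m, 'e::euclidean_space) form1 \<Rightarrow> ('m, 'e) form2" where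
  "ext_deriv1 \<alpha> k y u v =
     frechet_derivative (\<lambda>z. \<alpha> k z v) (at y) u - frechet_derivative (\<lambda>z. \<alpha> k z u) (at y) v"

definition ext_deriv2 ::
  "('m, 'e::euclidean_space) form2 \<Rightarrow> ('m, 'e) chart \<Rightarrow> 'e \<Rightarrow> 'e \<Rightarrow> 'e \<Rightarrow> 'e \<Rightarrow> real" where
  "ext_deriv2 \<omega> k y u v w =
     frechet_derivative (\<lambda>z. \<omega> k z v w) (at y) u
     - frechet_derivative (\<lambda>z. \<omega> k z u w) (at y) v
     + frechet_derivative (\<lambda>z. \<omega> k z u v) (at y) w"

definition wedge12 ::
  "('m, 'e) form1 \<Rightarrow> ('m, 'e) form2 \<Rightarrow> ('m, 'e) chart \<Rightarrow> 'e \<Rightarrow> 'e \<Rightarrow> 'e \<Rightarrow> 'e \<Rightarrow> real" where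
  "wedge12 \<alpha> \<omega> k y u v w =
     \<alpha> k y u * \<omega> k y v w - \<alpha> k y v * \<omega> k y u w + \<alpha> k y w * \<omega> k y u v"

definition twisted_deriv0 ::
  "('m, 'e::euclidean_space) form1 \<Rightarrow> ('m \<Rightarrow> real) \<Rightarrow> ('m, 'e) form1" where
  "twisted_deriv0 \<eta> f k y v = ext_deriv0 f k y v - f (cinv k y) * \<eta> k y v"

definition twisted_deriv2 ::
  "('m, 'e::euclidean_space) form1 \<Rightarrow> ('m, 'e) form2
     \<Rightarrow> ('m, 'e) chart \<Rightarrow> 'e \<Rightarrow> 'e \<Rightarrow> 'e \<Rightarrow> 'e \<Rightarrow> real" where
  "twisted_deriv2 \<eta> \<omega> k y u v w = ext_deriv2 \<omega> k y u v w - wedge12 \<eta> \<omega> k y u v w"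

definition exact_on ::
  "('m::topological_space, 'e::euclidean_space) chart set \<Rightarrow> ('m, 'e) form1 \<Rightarrow> 'm set \<Rightarrow> bool" where
  "exact_on \<A> \<alpha> V \<longleftrightarrow>
     (\<exists>f. smooth_function_on \<A> V f \<and>
          (\<forall>k\<in>\<A>. \<forall>y\<in>cmap k ` (cdom k \<inter> V). \<forall>v. \<alpha> k y v = ext_deriv0 f k y v))"

text \<open>The function \<open>p \<mapsto> \<alpha>\<^sub>p(X\<^sub>p)\<close>; by the transformation laws its value does not depend on the
  chosen chart around \<open>p\<close>.\<close>

definition pairing ::
  "('m, 'e::euclidean_space) chart set \<Rightarrow> ('m, 'e) form1 \<Rightarrow> ('m, 'e) vfield \<Rightarrow> 'm \<Rightarrow> real" where
  "pairing \<A> \<alpha> X p =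
     (let k = (SOME k. k \<in> \<A> \<and> p \<in> cdom k) in \<alpha> k (cmap k p) (X k (cmap k p)))"


section \<open>Conformal symplectic manifolds and Hamiltonian flows\<close>

definition conformal_symplectic ::
  "('m::{t2_space, second_countable_topology}, 'e::euclidean_space) chart set
     \<Rightarrow> ('m, 'e) form1 \<Rightarrow> ('m, 'e) form2 \<Rightarrow> bool" where
  "conformal_symplectic \<A> \<eta> \<omega> \<longleftrightarrow>
     smooth_atlas \<A> \<and> even DIM('e) \<and> one_form \<A> \<eta> \<and> two_form \<A> \<omega> \<and>
     (\<forall>k\<in>\<A>. \<forall>y\<in>cimage k. \<forall>u v. ext_deriv1 \<eta> k y u v = 0) \<and>
     (\<forall>k\<in>\<A>. \<forall>y\<in>cimage k. \<forall>u. (\<forall>v. \<omega> k y u v = 0) \<longrightarrow> u = 0) \<and>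
     (\<forall>k\<in>\<A>. \<forall>y\<in>cimage k. \<forall>u v w. twisted_deriv2 \<eta> \<omega> k y u v w = 0)"

definition hamiltonian_vector_field ::
  "('m, 'e::euclidean_space) chart set \<Rightarrow> ('m, 'e) form1 \<Rightarrow> ('m, 'e) form2
     \<Rightarrow> ('m \<Rightarrow> real) \<Rightarrow> ('m, 'e) vfield \<Rightarrow> bool" where
  "hamiltonian_vector_field \<A> \<eta> \<omega> H X \<longleftrightarrow>
     vector_field \<A> X \<and>
     (\<forall>k\<in>\<A>. \<forall>y\<in>cimage k. \<forall>v. \<omega> k y (X k y) v = twisted_deriv0 \<eta> H k y v)"

text \<open>The curve \<open>t \<mapsto> \<phi> t x\<close> is the integral curve of \<open>X\<close> starting at \<open>x\<close>. Its continuity has to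
  be demanded, as coordinate maps are arbitrary outside the domain of the chart.\<close>

definition flow_of ::
  "('m::topological_space, 'e::euclidean_space) chart set \<Rightarrow> ('m, 'e) vfield
     \<Rightarrow> (real \<Rightarrow> 'm \<Rightarrow> 'm) \<Rightarrow> bool" where
  "flow_of \<A> X \<phi> \<longleftrightarrow>
     (\<forall>x. \<phi> 0 x = x \<and> continuous_on UNIV (\<lambda>t. \<phi> t x) \<and>
          (\<forall>t. \<forall>k\<in>\<A>. \<phi> t x \<in> cdom k \<longrightarrow>
             ((\<lambda>s. cmap k (\<phi> s x)) has_vector_derivative X k (cmap k (\<phi> t x))) (at t)))"

definition winding ::
  "('m, 'e::euclidean_space) chart set \<Rightarrow> ('m, 'e) form1 \<Rightarrow> ('m, 'e) vfield
     \<Rightarrow> (real \<Rightarrow> 'm \<Rightarrow> 'm) \<Rightarrow> real \<Rightarrow> 'm \<Rightarrow> real" where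
  "winding \<A> \<eta> X \<phi> t x =
     (if 0 \<le> t then integral {0..t} (\<lambda>s. pairing \<A> \<eta> X (\<phi> s x))
      else - integral {t..0} (\<lambda>s. pairing \<A> \<eta> X (\<phi> s x)))"


section \<open>Weak attractors\<close>

definition omega_limit :: "(real \<Rightarrow> 'm \<Rightarrow> 'm) \<Rightarrow> 'm \<Rightarrow> 'm::topological_space set" where
  "omega_limit \<phi> x = (\<Inter>T. closure ((\<lambda>t. \<phi> t x) ` {T..}))"

definition basin_of_attraction ::
  "(real \<Rightarrow> 'm \<Rightarrow> 'm) \<Rightarrow> 'm::topological_space set \<Rightarrow> 'm set \<Rightarrow> bool" where
  "basin_of_attraction \<phi> A U \<longleftrightarrow> open U \<and> A \<subseteq> U \<and> (\<Union>x\<in>U. omega_limit \<phi> x) \<subseteq> A"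

definition weak_attractor ::
  "(real \<Rightarrow> 'm \<Rightarrow> 'm) \<Rightarrow> 'm::topological_space set \<Rightarrow> bool" where
  "weak_attractor \<phi> A \<longleftrightarrow>
     compact A \<and> (\<forall>t. \<phi> t ` A = A) \<and> (\<exists>U. basin_of_attraction \<phi> A U)"

end

theory Submission
  imports Defs
begin

text \<open>
A Hamiltonian vector field \<open>X\<close> on a conformal symplectic manifold of dimension \<open>2 n\<close> satisfies
\<open>L\<^sub>X \<omega> = \<eta>(X) \<omega>\<close> (\<open>lie_derivative_hamiltonian\<close>). Hence the flow multiplies \<open>\<omega>\<close> by \<open>e\<^sup>r\<close>, where \<open>r\<close> is the
winding, and the volume \<open>\<bar>\<omega>\<^sup>n\<bar>\<close> by \<open>e\<^sup>n\<^sup>r\<close> (\<open>vol_flow\<close>). So the growth of the winding can be read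
off from the volumes of the images of a set under the flow.

A point \<open>x\<close> of \<open>U - A\<close> lies in a compact set \<open>Q \<subseteq> U - A\<close>, and since its limit points are in \<open>A\<close>, its
orbit leaves \<open>Q\<close> for good. The points that stay away from \<open>Q\<close> from a given time \<open>T\<close> on form a
subset \<open>E\<close> of \<open>Q\<close> whose images at the times \<open>0, T, 2 T, \<dots>\<close> are pairwise disjoint. The manifold has finite
volume, so the integral over \<open>E\<close> of the sum of all \<open>e\<^sup>n\<^sup>r\<close> taken at these times is finite. For almost
every point of \<open>E\<close> this sum is therefore finite, which forces \<open>r\<close> to tend to \<open>-\<infinity>\<close> along these times
(\<open>disjoint_images_imp_winding\<close>), and then along all times because \<open>\<eta>(X)\<close> is bounded. Countably many
such sets exhaust \<open>U - A\<close> (\<open>winding_tends_to_minus_infinity\<close>).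

For the second claim, \<open>U - A\<close> is open and nonempty, so it is not a null set and contains a point \<open>x\<close> whose
winding tends to \<open>-\<infinity>\<close>. From \<open>dH(X) = \<eta>(X) H\<close> one gets \<open>H(\<phi>\<^sub>t x) = e\<^sup>r H(x) \<longlongrightarrow> 0\<close>, so the limit
set of \<open>x\<close> lies in \<open>A \<inter> {H = 0}\<close>. Were \<open>\<eta>\<close> exact near that set, the winding would eventually be a
continuous function of the position up to a constant, and it could not diverge while the orbit
keeps returning near a limit point (\<open>not_exact_near_omega_limit\<close>).

The transformation rule for the volume needs the derivative of the flow in the initial point,
which is the solution of the linearised equation (\<open>flow_has_derivative\<close>). All of this is local: the
manifold is covered by finitely many coordinate balls that the flow keeps in their charts during
one common time step \<open>h\<close> (\<open>flow_box_exists\<close>), the formula for one step is the change of variables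
theorem in these charts, and longer times are reached by iteration.
\<close>

section \<open>Coordinates and determinants in a Euclidean space\<close>

text \<open>Determinants and the change of variables theorem live on \<open>real ^ 'n\<close>, whereas charts take values
in an abstract Euclidean space. The standard basis, turned into a finite index type, links the two.\<close>

typedef (overloaded) 'e basis_index = "Basis :: 'e::euclidean_space set"
  morphisms basis_vector Abs_basis_index
  by (metis nonempty_Basis ex_in_conv)

lemma range_basis_vector: "range (basis_vector :: 'e::euclidean_space basis_index \<Rightarrow> 'e) = Basis"
  by (rule type_definition.Rep_range[OF type_definition_basis_index])

lemma inj_basis_vector: "inj (basis_vector :: 'e::euclidean_space basis_index \<Rightarrow> 'e)"
  by (meson basis_vector_inject injI)

lemma bij_basis_vector: "bij_betw (basis_vector :: 'e::euclidean_space basis_index \<Rightarrow> 'e) UNIV Basis"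
  by (simp add: bij_betw_def inj_basis_vector range_basis_vector)

lemma basis_vector_in_Basis [simp]: "basis_vector i \<in> Basis"
  by (rule basis_vector)

lemma inner_basis_vector: "basis_vector i \<bullet> basis_vector j = (if i = j then 1 else 0)"
  by (simp add: inner_Basis basis_vector_inject)

instance basis_index :: (euclidean_space) finite
  by standard (metis finite_Basis finite_imageD inj_basis_vector range_basis_vector)

text \<open>The order has no meaning; it comes from an arbitrary enumeration of the basis and only serves
the sort constraint of the change of variables theorem.\<close>

instantiation basis_index :: (euclidean_space) wellorder
begin

definition basis_rank :: "'a::euclidean_space basis_index \<Rightarrow> nat" where
  "basis_rank = (SOME f. inj f)"

definition less_eq_basis_index :: "'a basis_index \<Rightarrow> 'a basis_index \<Rightarrow> bool" where
  "i \<le> j \<longleftrightarrow> basis_rank i \<le> basis_rank j"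

definition less_basis_index :: "'a basis_index \<Rightarrow> 'a basis_index \<Rightarrow> bool" where
  "i < j \<longleftrightarrow> basis_rank i < basis_rank j"

instance
proof
  have inj: "inj (basis_rank :: 'a basis_index \<Rightarrow> nat)"
    unfolding basis_rank_def
    using finite_imp_inj_to_nat_seg[of "UNIV :: 'a basis_index set"] by (intro someI_ex[of inj]) auto
  fix x y z :: "'a basis_index"
  show "x < y \<longleftrightarrow> x \<le> y \<and> \<not> y \<le> x"
    by (auto simp: less_eq_basis_index_def less_basis_index_def)
  show "x \<le> x" "x \<le> y \<Longrightarrow> y \<le> z \<Longrightarrow> x \<le> z" "x \<le> y \<or> y \<le> x"
    by (auto simp: less_eq_basis_index_def)
  show "x \<le> y \<Longrightarrow> y \<le> x \<Longrightarrow> x = y"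
    using inj by (auto simp: less_eq_basis_index_def dest: injD)
next
  fix P :: "'a basis_index \<Rightarrow> bool" and a
  assume step: "\<And>x. (\<And>y. y < x \<Longrightarrow> P y) \<Longrightarrow> P x"
  show "P a"
  proof (induction a rule: measure_induct_rule[of basis_rank])
    case (less x)
    show ?case by (rule step) (rule less, simp add: less_basis_index_def)
  qed
qed

end

lemma card_basis_index: "CARD('e::euclidean_space basis_index) = DIM('e)"
  using bij_basis_vector bij_betw_same_card by blast

lemma sum_basis_vector: "(\<Sum>i\<in>UNIV. f (basis_vector i)) = (\<Sum>b\<in>Basis. f b)"
  by (rule sum.reindex_bij_betw[OF bij_basis_vector])

definition coords :: "'e::euclidean_space \<Rightarrow> real ^ 'e basis_index" where
  "coords v = (\<chi> i. v \<bullet> basis_vector i)"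

definition of_coords :: "real ^ 'e basis_index \<Rightarrow> 'e::euclidean_space" where
  "of_coords w = (\<Sum>i\<in>UNIV. (w $ i) *\<^sub>R basis_vector i)"

lemma of_coords_coords [simp]: "of_coords (coords v) = v"
  unfolding of_coords_def coords_def
  by (simp add: sum_basis_vector[of "\<lambda>b. (v \<bullet> b) *\<^sub>R b"] euclidean_representation)

lemma coords_of_coords [simp]: "coords (of_coords w) = w"
  unfolding of_coords_def coords_def
  by (simp add: vec_eq_iff inner_sum_left inner_basis_vector if_distrib[of "\<lambda>x. _ * x"] sum.delta cong: if_cong)

lemma linear_coords: "linear coords"
  by (auto intro!: linearI simp: coords_def vec_eq_iff inner_add_left)

lemma linear_of_coords: "linear of_coords"
  by (auto intro!: linearI simp: of_coords_def scaleR_add_left sum.distrib scaleR_sum_right)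

definition lin_matrix :: "('e::euclidean_space \<Rightarrow> 'e) \<Rightarrow> real ^ 'e basis_index ^ 'e basis_index" where
  "lin_matrix f = (\<chi> i j. f (basis_vector j) \<bullet> basis_vector i)"

definition gram_matrix :: "('e::euclidean_space \<Rightarrow> 'e \<Rightarrow> real) \<Rightarrow> real ^ 'e basis_index ^ 'e basis_index" where
  "gram_matrix \<beta> = (\<chi> i j. \<beta> (basis_vector i) (basis_vector j))"

lemma matrix_conj_coords: 
  fixes f :: "'e::euclidean_space \<Rightarrow> 'e" shows "matrix (coords \<circ> f \<circ> of_coords) = lin_matrix f"
proof -
  have "of_coords (axis j 1) = (basis_vector j :: 'e)" for j
    unfolding of_coords_def axis_def
    by (simp add: if_distrib[of "\<lambda>x. x *\<^sub>R _"] sum.delta cong: if_cong)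
  then show ?thesis
    by (simp add: matrix_def lin_matrix_def coords_def vec_eq_iff)
qed

lemma gram_matrix_congruence:
  fixes f :: "'e::euclidean_space \<Rightarrow> 'e"
  assumes f: "linear f" and \<beta>: "bilinear \<beta>"
  shows "gram_matrix (\<lambda>u v. \<beta> (f u) (f v)) = transpose (lin_matrix f) ** gram_matrix \<beta> ** lin_matrix f"
proof -
  have rep: "v = (\<Sum>k\<in>UNIV. (v \<bullet> basis_vector k) *\<^sub>R basis_vector k)" for v :: 'e
    by (simp add: sum_basis_vector[of "\<lambda>b. (v \<bullet> b) *\<^sub>R b"] euclidean_representation)
  have l: "linear (\<beta> v)" and l': "linear (\<lambda>u. \<beta> u v)" for v
    using \<beta> by (auto simp: bilinear_def)
  have e: "\<beta> u v = (\<Sum>l\<in>UNIV. \<Sum>k\<in>UNIV. (u \<bullet> basis_vector k) * \<beta> (basis_vector k) (basis_vector l) * (v \<bullet> basis_vector l))" for u v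
  proof -
    have "\<beta> u v = \<beta> (\<Sum>k\<in>UNIV. (u \<bullet> basis_vector k) *\<^sub>R basis_vector k) (\<Sum>l\<in>UNIV. (v \<bullet> basis_vector l) *\<^sub>R basis_vector l)"
      using rep by metis
    also have "\<dots> = (\<Sum>l\<in>UNIV. \<Sum>k\<in>UNIV. (u \<bullet> basis_vector k) * \<beta> (basis_vector k) (basis_vector l) * (v \<bullet> basis_vector l))"
      by (simp add: linear_sum[OF l] linear_sum[OF l'] linear_cmul[OF l] linear_cmul[OF l'] sum_distrib_left mult_ac)
    finally show ?thesis .
  qed
  show ?thesis
    by (simp add: vec_eq_iff gram_matrix_def lin_matrix_def transpose_def matrix_matrix_mult_def
        sum_distrib_right e[of "f _"])
qed

text \<open>For a nondegenerate alternating form \<open>\<beta>\<close> on a space of dimension \<open>2 n\<close> this is the absolute value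
of the Pfaffian, that is the density of \<open>\<beta>\<^sup>n / n!\<close> with respect to Lebesgue measure. With the square root
of the Gram determinant no exterior powers are needed.\<close>

definition gram_density :: "('e::euclidean_space \<Rightarrow> 'e \<Rightarrow> real) \<Rightarrow> real" where
  "gram_density \<beta> = sqrt \<bar>det (gram_matrix \<beta>)\<bar>"

text \<open>The Gram matrix of a pulled back form is \<open>F\<^sup>T G F\<close>, so the square root of its determinant picks
up exactly one factor \<open>\<bar>det F\<bar>\<close>: the rule by which volume densities transform.\<close>

lemma gram_density_congruence:
  assumes "linear f" "bilinear \<beta>"
  shows "gram_density (\<lambda>u v. \<beta> (f u) (f v)) = \<bar>det (lin_matrix f)\<bar> * gram_density \<beta>"
proof -
  have "\<bar>det (gram_matrix (\<lambda>u v. \<beta> (f u) (f v)))\<bar> = \<bar>det (lin_matrix f)\<bar>^2 * \<bar>det (gram_matrix \<beta>)\<bar>"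
    by (simp add: gram_matrix_congruence[OF assms] det_mul det_transpose abs_mult power2_eq_square mult_ac)
  then show ?thesis by (simp add: gram_density_def real_sqrt_mult)
qed

lemma gram_density_scale:
  fixes \<beta> :: "'e::euclidean_space \<Rightarrow> 'e \<Rightarrow> real"
  shows "gram_density (\<lambda>u v. exp c * \<beta> u v) = exp (DIM('e) / 2 * c) * gram_density \<beta>"
proof -
  have "gram_matrix (\<lambda>u v. exp c * \<beta> u v) = (\<chi> i. exp c *s (gram_matrix \<beta> $ i))"
    by (simp add: gram_matrix_def vec_eq_iff)
  then have "det (gram_matrix (\<lambda>u v. exp c * \<beta> u v)) = exp c ^ DIM('e) * det (gram_matrix \<beta>)"
    by (simp add: det_rows_mul[of "\<lambda>i. exp c" "\<lambda>i. gram_matrix \<beta> $ i"] card_basis_index)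
  moreover have "sqrt (exp c ^ DIM('e)) = exp (DIM('e) / 2 * c)"
    by (rule real_sqrt_unique) (auto simp: exp_of_nat_mult[symmetric] power2_eq_square exp_add[symmetric] field_simps)
  ultimately show ?thesis
    by (simp add: gram_density_def real_sqrt_mult abs_mult)
qed

text \<open>A vector in the kernel of the transposed Gram matrix lies in the kernel of the form.\<close>

lemma gram_density_pos:
  assumes "bilinear \<beta>" "\<And>u. (\<And>v. \<beta> u v = 0) \<Longrightarrow> u = 0"
  shows "0 < gram_density \<beta>"
proof -
  have "x = 0" if "transpose (gram_matrix \<beta>) *v x = 0" for x
  proof -
    have l': "linear (\<lambda>u. \<beta> u v)" and l: "linear (\<beta> v)" for v using assms(1) by (auto simp: bilinear_def)
    have b: "\<beta> (of_coords x) (basis_vector i) = 0" for i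
    proof -
      have "\<beta> (of_coords x) (basis_vector i) = (transpose (gram_matrix \<beta>) *v x) $ i"
        by (simp add: of_coords_def linear_sum[OF l'] linear_cmul[OF l'] matrix_vector_mult_def gram_matrix_def transpose_def mult_ac)
      then show ?thesis using that by simp
    qed
    have "\<beta> (of_coords x) v = 0" for v
    proof -
      have "\<beta> (of_coords x) v = \<beta> (of_coords x) (\<Sum>b\<in>Basis. (v \<bullet> b) *\<^sub>R b)"
        by (simp add: euclidean_representation)
      also have "\<dots> = (\<Sum>b\<in>Basis. (v \<bullet> b) * \<beta> (of_coords x) b)"
        by (simp add: linear_sum[OF l] linear_cmul[OF l])
      also have "\<dots> = 0" by (rule sum.neutral) (use b range_basis_vector in \<open>metis imageE mult_zero_right\<close>)
      finally show ?thesis .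
    qed
    then have "of_coords x = 0" by (rule assms(2))
    then have "coords (of_coords x) = coords 0" by simp
    then show ?thesis using linear_0[OF linear_coords] by simp
  qed
  then have "invertible (transpose (gram_matrix \<beta>))"
    by (metis invertible_left_inverse matrix_left_invertible_ker)
  then show ?thesis by (simp add: gram_density_def invertible_det_nz det_transpose)
qed

lemma gram_density_nonneg: "0 \<le> gram_density \<beta>" by (simp add: gram_density_def)

lemma continuous_on_gram_density:
  assumes "\<And>u v. continuous_on S (\<lambda>y. \<beta> y u v)"
  shows "continuous_on S (\<lambda>y. gram_density (\<beta> y))"
  unfolding gram_density_def det_def gram_matrix_def
  by (intro continuous_intros) (simp add: assms)

section \<open>Change of variables for nonnegative integrands\<close>

text \<open>The change of variables theorem speaks of absolutely integrable functions. For a nonnegative integrand,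
finiteness of either Lebesgue integral gives absolute integrability on that side and hence on the
other, so the two integrals agree also when they are infinite.\<close>

lemma nn_integral_change_of_variables_cart:
  fixes g :: "real^'n::{finite,wellorder} \<Rightarrow> real^'n::_" and f :: "real^'n::_ \<Rightarrow> real"
  assumes S: "S \<in> sets lebesgue"
    and der: "\<And>x. x \<in> S \<Longrightarrow> (g has_derivative g' x) (at x within S)"
    and inj: "inj_on g S"
    and f: "f \<in> borel_measurable borel" "\<And>y. 0 \<le> f y"
  shows "(\<integral>\<^sup>+x\<in>S. ennreal (\<bar>det (matrix (g' x))\<bar> * f (g x)) \<partial>lebesgue) = (\<integral>\<^sup>+y\<in>g ` S. ennreal (f y) \<partial>lebesgue)"
proof -
  define h where "h x = \<bar>det (matrix (g' x))\<bar> * f (g x)" for x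
  have h0: "0 \<le> h x" for x using f by (simp add: h_def)
  have gS: "g ` S \<in> sets lebesgue"
    using der by (intro differentiable_image_in_sets_lebesgue[OF S])
      (auto simp: differentiable_on_def differentiable_def)
  have mf: "f \<in> borel_measurable (lebesgue_on T)" if "T \<in> sets lebesgue" for T
    using f(1) by (intro measurable_restrict_space1 measurable_completion) simp
  have "continuous_on S g" using der has_derivative_continuous_on by blast
  then have "g \<in> borel_measurable (lebesgue_on S)"
    by (rule continuous_imp_measurable_on_sets_lebesgue[OF _ S])
  then have "(\<lambda>x. f (g x)) \<in> borel_measurable (lebesgue_on S)"
    using f(1) by (rule measurable_compose)
  then have mh: "h \<in> borel_measurable (lebesgue_on S)"
    unfolding h_def using borel_measurable_det_Jacobian[OF S der] by measurable
  have set_integrable: "u absolutely_integrable_on T"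
    if "T \<in> sets lebesgue" "u \<in> borel_measurable (lebesgue_on T)" "\<And>x. 0 \<le> u x"
      "(\<integral>\<^sup>+x\<in>T. ennreal (u x) \<partial>lebesgue) < \<infinity>" for T and u :: "real^'n::_ \<Rightarrow> real"
  proof -
    have "integrable lebesgue (\<lambda>x. indicator T x *\<^sub>R u x)"
    proof (rule integrableI_nonneg)
      show "(\<lambda>x. indicator T x *\<^sub>R u x) \<in> borel_measurable lebesgue"
        using that(1,2) by (simp add: borel_measurable_restrict_space_iff)
      show "(\<integral>\<^sup>+x. ennreal (indicator T x *\<^sub>R u x) \<partial>lebesgue) < \<infinity>"
        by (rule le_less_trans[OF eq_refl that(4)], rule nn_integral_cong) (auto simp: indicator_def)
    qed (use that in \<open>auto simp: indicator_def\<close>)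
    then show ?thesis by (simp add: set_integrable_def)
  qed
  have nn_value: "(\<integral>\<^sup>+x\<in>T. ennreal (u x) \<partial>lebesgue) = ennreal (integral T u)"
    if "u absolutely_integrable_on T" "\<And>x. 0 \<le> u x" for T and u :: "real^'n::_ \<Rightarrow> real"
  proof -
    have "(u has_integral integral T u) T"
      using that(1) by (simp add: absolutely_integrable_on_def has_integral_integral)
    from nn_integral_has_integral_lebesgue[OF that(2) this]
    have "(\<integral>\<^sup>+x. ennreal (indicator T x * u x) \<partial>lebesgue) = ennreal (integral T u)"
      by (simp add: nn_integral_completion)
    moreover have "(\<integral>\<^sup>+x. ennreal (indicator T x * u x) \<partial>lebesgue) = (\<integral>\<^sup>+x\<in>T. ennreal (u x) \<partial>lebesgue)"
      by (rule nn_integral_cong) (auto simp: indicator_def)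
    ultimately show ?thesis by simp
  qed
  have lift: "f absolutely_integrable_on g ` S \<and> integral (g ` S) f = b \<longleftrightarrow>
    h absolutely_integrable_on S \<and> integral S h = b" for b
    using has_absolute_integral_change_of_variables [OF S der inj, of "\<lambda>x. vec (f x) :: real^1" "vec b"]
    unfolding absolutely_integrable_on_1_iff integral_on_1_eq integrable_on_1_iff absolutely_integrable_on_def h_def
    by (auto simp: vec_eq_iff)
  have "(\<integral>\<^sup>+x\<in>S. ennreal (h x) \<partial>lebesgue) = (\<integral>\<^sup>+y\<in>g ` S. ennreal (f y) \<partial>lebesgue)"
  proof (cases "h absolutely_integrable_on S")
    case True
    then have "f absolutely_integrable_on g ` S" "integral (g ` S) f = integral S h"
      using lift by blast+
    then show ?thesis
      using nn_value[OF True h0] nn_value[of "g ` S" f] f(2) by simp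
  next
    case False
    then have "\<not> f absolutely_integrable_on g ` S" using lift by blast
    then have "(\<integral>\<^sup>+y\<in>g ` S. ennreal (f y) \<partial>lebesgue) = \<infinity>"
      using set_integrable[OF gS mf[OF gS] f(2)] by (metis infinity_ennreal_def less_top)
    moreover have "(\<integral>\<^sup>+x\<in>S. ennreal (h x) \<partial>lebesgue) = \<infinity>"
      using False set_integrable[OF S mh h0] by (metis infinity_ennreal_def less_top)
    ultimately show ?thesis by simp
  qed
  then show ?thesis by (simp add: h_def)
qed

lemma continuous_coords: "continuous_on S coords" "continuous_on T of_coords"
  using linear_coords linear_of_coords linear_continuous_on linear_conv_bounded_linear by blast+

lemma measurable_coords [measurable]: "(coords :: 'e::euclidean_space \<Rightarrow> _) \<in> borel_measurable borel" "(of_coords :: _ \<Rightarrow> 'e)  \<in> borel_measurable borel"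
  by (auto intro!: borel_measurable_continuous_onI continuous_coords)

lemma distr_lborel_coords: "distr lborel borel coords = (lborel :: (real ^ 'e::euclidean_space basis_index) measure)"
proof (rule lborel_eqI[symmetric])
  fix l u :: "real ^ 'e basis_index"
  assume "\<And>b. b \<in> Basis \<Longrightarrow> l \<bullet> b \<le> u \<bullet> b"
  then have lu: "l $ i \<le> u $ i" for i
    by (metis axis_in_Basis_iff Basis_real_def inner_axis' insertI1 mult_1 inner_commute cart_eq_inner_axis)
  have inner: "of_coords w \<bullet> basis_vector i = w $ i" for w :: "real ^ 'e basis_index" and i
    by (metis coords_of_coords coords_def vec_lambda_beta)
  have "v \<in> box (of_coords l) (of_coords u) \<longleftrightarrow> (\<forall>i. l $ i < v \<bullet> basis_vector i \<and> v \<bullet> basis_vector i < u $ i)" for v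
    by (simp add: mem_box range_basis_vector[symmetric] inner)
  then have bx: "coords -` box l u = box (of_coords l) (of_coords u)"
    by (auto simp: mem_box_cart coords_def)
  have "emeasure (distr lborel borel coords) (box l u) = emeasure lborel (box (of_coords l) (of_coords u))"
    by (simp add: emeasure_distr bx)
  also have "\<dots> = (\<Prod>b\<in>Basis. (of_coords u - of_coords l) \<bullet> b)"
    by (rule emeasure_lborel_box) (auto simp: range_basis_vector[symmetric] inner lu)
  also have "(\<Prod>b\<in>Basis. (of_coords u - of_coords l) \<bullet> b) = (\<Prod>i\<in>UNIV. u $ i - l $ i)"
    by (subst prod.reindex_bij_betw[OF bij_basis_vector, symmetric]) (simp add: inner inner_diff_left)
  also have "\<dots> = (\<Prod>b\<in>Basis. (u - l) \<bullet> b)"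
  proof -
    have "bij_betw (\<lambda>i. axis i (1::real)) UNIV (Basis :: (real ^ 'e basis_index) set)"
      by (auto simp: bij_betw_def inj_on_def axis_eq_axis Basis_vec_def)
    from prod.reindex_bij_betw[OF this, of "\<lambda>b. (u - l) \<bullet> b"] show ?thesis
      by (simp add: inner_axis inner_diff_left)
  qed
  finally show "emeasure (distr lborel borel coords) (box l u) = (\<Prod>b\<in>Basis. (u - l) \<bullet> b)" .
qed simp

lemma nn_integral_coords:
  fixes f :: "'e::euclidean_space \<Rightarrow> ennreal"
  assumes [measurable]: "f \<in> borel_measurable borel"
  shows "(\<integral>\<^sup>+x. f x \<partial>lborel) = (\<integral>\<^sup>+y. f (of_coords y) \<partial>lborel)"
  by (subst distr_lborel_coords[symmetric], subst nn_integral_distr) simp_all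

text \<open>The previous lemma conjugated by the isometry \<open>coords\<close>. The pulled back integrand \<open>h\<close> is
required to be Borel measurable as a whole. For a map that transforms one volume density into
another this is immediate, because the Jacobian times the density at the image point is then known
explicitly.\<close>

lemma nn_integral_change_of_variables:
  fixes g :: "'e::euclidean_space \<Rightarrow> 'e" and f h :: "'e \<Rightarrow> real"
  assumes S: "S \<in> sets borel" and gS: "g ` S \<in> sets borel"
    and der: "\<And>x. x \<in> S \<Longrightarrow> (g has_derivative g' x) (at x within S)"
    and inj: "inj_on g S"
    and f: "f \<in> borel_measurable borel" "\<And>y. 0 \<le> f y"
    and h: "h \<in> borel_measurable borel" "\<And>x. x \<in> S \<Longrightarrow> h x = \<bar>det (lin_matrix (g' x))\<bar> * f (g x)"
  shows "(\<integral>\<^sup>+x\<in>S. ennreal (h x) \<partial>lborel) = (\<integral>\<^sup>+y\<in>g ` S. ennreal (f y) \<partial>lborel)"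
proof -
  let ?g = "coords \<circ> g \<circ> of_coords" and ?S = "coords ` S"
  have inv: "coords ` T = of_coords -` T" for T :: "'e set"
    by (auto simp: image_iff) (metis coords_of_coords)
  have S': "?S \<in> sets lebesgue"
  proof -
    have "of_coords -` S \<inter> space borel \<in> sets borel" by (rule measurable_sets[OF measurable_coords(2) S])
    then show ?thesis by (simp add: inv)
  qed
  have im: "?g ` ?S = coords ` (g ` S)" by (simp add: image_comp o_def)
  have ind: "indicator (coords ` T) y = (indicator T (of_coords y) :: ennreal)" for T :: "'e set" and y
    by (simp add: inv indicator_def)
  have "(\<integral>\<^sup>+x\<in>S. ennreal (h x) \<partial>lborel) = (\<integral>\<^sup>+y\<in>?S. ennreal (h (of_coords y)) \<partial>lborel)"
    using S h(1) by (subst nn_integral_coords) (simp_all add: ind)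
  also have "\<dots> = (\<integral>\<^sup>+y\<in>?S. ennreal (\<bar>det (matrix (coords \<circ> g' (of_coords y) \<circ> of_coords))\<bar> * (f \<circ> of_coords) (?g y)) \<partial>lborel)"
    by (rule nn_integral_cong) (auto simp: matrix_conj_coords h(2) indicator_def)
  also have "\<dots> = (\<integral>\<^sup>+y\<in>?S. ennreal (\<bar>det (matrix (coords \<circ> g' (of_coords y) \<circ> of_coords))\<bar> * (f \<circ> of_coords) (?g y)) \<partial>lebesgue)"
    by (simp add: nn_integral_completion)
  also have "\<dots> = (\<integral>\<^sup>+y\<in>?g ` ?S. ennreal ((f \<circ> of_coords) y) \<partial>lebesgue)"
  proof (rule nn_integral_change_of_variables_cart[OF S'])
    fix y assume "y \<in> ?S"
    then have y: "of_coords y \<in> S" by auto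
    have c: "(coords has_derivative coords) F" "(of_coords has_derivative of_coords) F'" for F F'
      using linear_coords linear_of_coords linear_conv_bounded_linear bounded_linear_imp_has_derivative by blast+
    have "(g \<circ> of_coords has_derivative g' (of_coords y) \<circ> of_coords) (at y within ?S)"
      by (rule diff_chain_within[OF c(2)]) (use der[OF y] in \<open>simp add: image_comp o_def\<close>)
    then show "(?g has_derivative coords \<circ> g' (of_coords y) \<circ> of_coords) (at y within ?S)"
      using diff_chain_within[OF _ c(1)] by (metis comp_assoc)
  next
    show "inj_on ?g ?S"
      using inj by (auto simp: inj_on_def) (metis of_coords_coords)
    show "f \<circ> of_coords \<in> borel_measurable borel"
      using f(1) by simp
  qed (simp add: f)
  also have "\<dots> = (\<integral>\<^sup>+y\<in>coords ` (g ` S). ennreal (f (of_coords y)) \<partial>lborel)"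
    unfolding im nn_integral_completion by simp
  also have "\<dots> = (\<integral>\<^sup>+y\<in>g ` S. ennreal (f y) \<partial>lborel)"
    using gS f(1) by (subst (2) nn_integral_coords) (simp_all add: ind)
  finally show ?thesis .
qed

section \<open>Differentiability of flows in the initial point\<close>

text \<open>Gronwall's inequality with an inhomogeneity \<open>\<delta>\<close>. Working with \<open>\<bar>w\<bar>\<^sup>2 + \<delta>\<^sup>2\<close> rather than with \<open>\<bar>w\<bar>\<close> keeps
the quantity differentiable where \<open>w\<close> vanishes; its logarithmic derivative is at most \<open>2 L + 1\<close>.\<close>

lemma gronwall_norm:
  fixes w w' :: "real \<Rightarrow> 'a::real_inner"
  assumes der: "\<And>t. t \<in> {0..h} \<Longrightarrow> (w has_vector_derivative w' t) (at t within {0..h})"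
    and bound: "\<And>t. t \<in> {0..h} \<Longrightarrow> norm (w' t) \<le> L * norm (w t) + \<delta>"
    and L: "0 \<le> L" and \<delta>: "0 \<le> \<delta>" and t: "t \<in> {0..h}"
  shows "norm (w t) \<le> exp ((2 * L + 1) * h) * (norm (w 0) + \<delta>)"
proof -
  define K where "K = 2 * L + 1"
  define F where "F s = exp (- (K * s)) * (w s \<bullet> w s + \<delta>\<^sup>2)" for s
  define F' where "F' s = exp (- (K * s)) * (2 * (w s \<bullet> w' s)) - K * exp (- (K * s)) * (w s \<bullet> w s + \<delta>\<^sup>2)" for s
  have dF: "(F has_real_derivative F' s) (at s within {0..h})" if "s \<in> {0..h}" for s
  proof -
    have "((\<lambda>s. w s \<bullet> w s) has_real_derivative (2 * (w s \<bullet> w' s))) (at s within {0..h})"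
      using has_derivative_inner[OF der[OF that, unfolded has_vector_derivative_def] der[OF that, unfolded has_vector_derivative_def]]
      unfolding has_field_derivative_def by (rule has_derivative_eq_rhs) (auto simp: inner_commute algebra_simps)
    then show ?thesis unfolding F_def F'_def by (auto intro!: derivative_eq_intros)
  qed
  have le: "F' s \<le> 0" if "s \<in> {0..h}" for s
  proof -
    have "2 * (w s \<bullet> w' s) \<le> 2 * (norm (w s) * norm (w' s))"
      using norm_cauchy_schwarz[of "w s" "w' s"] by simp
    also have "norm (w s) * norm (w' s) \<le> norm (w s) * (L * norm (w s) + \<delta>)"
      by (rule mult_left_mono[OF bound[OF that]]) simp
    also have "2 * (norm (w s) * (L * norm (w s) + \<delta>)) \<le> K * (norm (w s))\<^sup>2 + \<delta>\<^sup>2"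
      using sum_squares_ge_zero[of "norm (w s) - \<delta>" 0] by (simp add: K_def power2_eq_square algebra_simps)
    also have "\<dots> \<le> K * (w s \<bullet> w s + \<delta>\<^sup>2)"
      using L by (simp add: K_def power2_norm_eq_inner algebra_simps)
    finally have "2 * (w s \<bullet> w' s) - K * (w s \<bullet> w s + \<delta>\<^sup>2) \<le> 0" by simp
    then have "exp (- (K * s)) * (2 * (w s \<bullet> w' s) - K * (w s \<bullet> w s + \<delta>\<^sup>2)) \<le> 0"
      by (simp add: mult_le_0_iff)
    then show ?thesis by (simp add: F'_def algebra_simps)
  qed
  have "F t \<le> F 0"
  proof (cases "t = 0")
    case False
    show ?thesis
    proof (rule DERIV_nonpos_imp_decreasing_open[where f = F and a = 0 and b = t])
      show "continuous_on {0..t} F"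
        using t by (intro continuous_on_subset[OF DERIV_continuous_on[OF dF]]) auto
      fix s assume "0 < s" "s < t"
      then show "\<exists>y. (F has_real_derivative y) (at s) \<and> y \<le> 0"
        using dF[of s] le[of s] t at_within_Icc_at[of 0 s h] by auto
    qed (use t in auto)
  qed simp
  then have "exp (- (K * t)) * ((norm (w t))\<^sup>2 + \<delta>\<^sup>2) \<le> (norm (w 0))\<^sup>2 + \<delta>\<^sup>2"
    by (simp add: F_def power2_norm_eq_inner)
  then have "(norm (w t))\<^sup>2 + \<delta>\<^sup>2 \<le> exp (K * t) * ((norm (w 0))\<^sup>2 + \<delta>\<^sup>2)"
    by (simp add: exp_minus field_simps)
  then have "(norm (w t))\<^sup>2 \<le> exp (K * t) * ((norm (w 0))\<^sup>2 + \<delta>\<^sup>2)"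
    using zero_le_power2[of \<delta>] by linarith
  also have "\<dots> \<le> (exp (K * h))\<^sup>2 * (norm (w 0) + \<delta>)\<^sup>2"
  proof (rule mult_mono)
    have "K * t \<le> K * h" using t L by (intro mult_left_mono) (auto simp: K_def)
    moreover have "0 \<le> K * h" using t L by (auto simp: K_def)
    ultimately show "exp (K * t) \<le> (exp (K * h))\<^sup>2"
      by (simp add: power2_eq_square exp_add[symmetric])
    show "(norm (w 0))\<^sup>2 + \<delta>\<^sup>2 \<le> (norm (w 0) + \<delta>)\<^sup>2"
      using \<delta> by (simp add: power2_eq_square algebra_simps)
  qed auto
  finally have "(norm (w t))\<^sup>2 \<le> (exp (K * h) * (norm (w 0) + \<delta>))\<^sup>2"
    by (simp add: power_mult_distrib)
  then show ?thesis
    unfolding K_def by (rule power2_le_imp_le) (use \<delta> in simp)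
qed

lemma continuous_on_linear_family:
  fixes A :: "'s::topological_space \<Rightarrow> 'a::euclidean_space \<Rightarrow> 'b::real_normed_vector"
  assumes "\<And>t. t \<in> S \<Longrightarrow> linear (A t)" "\<And>v. continuous_on S (\<lambda>t. A t v)" "continuous_on S f"
  shows "continuous_on S (\<lambda>t. A t (f t))"
proof -
  have "A t (f t) = (\<Sum>b\<in>Basis. (f t \<bullet> b) *\<^sub>R A t b)" if "t \<in> S" for t
  proof -
    have "A t (f t) = A t (\<Sum>b\<in>Basis. (f t \<bullet> b) *\<^sub>R b)"
      by (simp add: euclidean_representation)
    then show ?thesis
      using assms(1)[OF that] by (simp add: linear_sum linear_cmul)
  qed
  moreover have "continuous_on S (\<lambda>t. \<Sum>b\<in>Basis. (f t \<bullet> b) *\<^sub>R A t b)"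
    by (intro continuous_intros assms)
  ultimately show ?thesis by (simp cong: continuous_on_cong)
qed

text \<open>Picard iteration. On a time interval with \<open>h L \<le> 1/2\<close> the \<open>n\<close>-th and the next iterate differ by
at most \<open>2\<^sup>-\<^sup>n \<bar>v\<bar>\<close>, so they and their derivatives converge uniformly. Short times suffice, since the flow
over a long time is composed of short steps.\<close>

lemma linear_ode_solution:
  fixes A :: "real \<Rightarrow> 'a::euclidean_space \<Rightarrow> 'a"
  assumes lin: "\<And>t. t \<in> {0..h} \<Longrightarrow> linear (A t)"
    and bound: "\<And>t v. t \<in> {0..h} \<Longrightarrow> norm (A t v) \<le> L * norm v"
    and cont: "\<And>v. continuous_on {0..h} (\<lambda>t. A t v)"
    and h: "0 \<le> h" and L: "0 \<le> L" and hL: "h * L \<le> 1/2"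
  obtains w where "w 0 = v" "\<And>t. t \<in> {0..h} \<Longrightarrow> (w has_vector_derivative A t (w t)) (at t within {0..h})"
proof -
  define f where "f = rec_nat (\<lambda>t. v) (\<lambda>_ g t. v + integral {0..t} (\<lambda>s. A s (g s)))"
  have f_0: "f 0 = (\<lambda>t. v)" and f_Suc': "f (Suc n) = (\<lambda>t. v + integral {0..t} (\<lambda>s. A s (f n s)))" for n
    by (simp_all add: f_def)
  have f_Suc: "f (Suc n) t = v + integral {0..t} (\<lambda>s. A s (f n s))" for n t by (simp add: f_Suc')
  have cf: "continuous_on {0..h} (f n)" for n
  proof (induction n)
    case (Suc n)
    have "continuous_on {0..h} (\<lambda>s. A s (f n s))"
      by (rule continuous_on_linear_family[OF lin cont Suc])
    then show ?case
      unfolding f_Suc' by (intro continuous_on_add continuous_on_const indefinite_integral_continuous_1 integrable_continuous_real)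
  qed (simp add: f_0)
  have cA: "continuous_on {0..h} (\<lambda>s. A s (f n s))" for n
    by (rule continuous_on_linear_family[OF lin cont cf])
  have df: "(f (Suc n) has_vector_derivative A t (f n t)) (at t within {0..h})" if "t \<in> {0..h}" for n t
    unfolding f_Suc'
    using integral_has_vector_derivative[OF cA that]
    by (auto intro!: derivative_eq_intros)
  have step: "norm (f (Suc n) t - f n t) \<le> norm v * (1/2) ^ Suc n" if "t \<in> {0..h}" for n t
    using that
  proof (induction n arbitrary: t)
    case 0
    have "norm (integral {0..t} (\<lambda>s. A s v)) \<le> (L * norm v) * (t - 0)"
      by (rule integral_bound) (use 0 bound in \<open>auto intro: continuous_on_subset[OF cont]\<close>)
    also have "\<dots> = norm v * (t * L)" by simp
    also have "\<dots> \<le> norm v * (1/2)"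
      using 0 hL mult_right_mono[of t h L] L by (intro mult_left_mono) auto
    finally show ?case by (simp add: f_Suc f_0)
  next
    case (Suc n)
    have cD: "continuous_on {0..t} (\<lambda>s. A s (f (Suc n) s))" "continuous_on {0..t} (\<lambda>s. A s (f n s))"
      using Suc.prems by (auto intro: continuous_on_subset[OF cA])
    have "f (Suc (Suc n)) t - f (Suc n) t = integral {0..t} (\<lambda>s. A s (f (Suc n) s) - A s (f n s))"
      unfolding f_Suc[of "Suc n"] f_Suc[of n t]
      using cD by (subst integral_diff) (auto intro!: integrable_continuous_real)
    also have "norm \<dots> \<le> (L * (norm v * (1/2) ^ Suc n)) * (t - 0)"
    proof (rule integral_bound)
      fix s assume s: "s \<in> {0..t}"
      then have sh: "s \<in> {0..h}" using Suc.prems by auto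
      have "norm (A s (f (Suc n) s) - A s (f n s)) = norm (A s (f (Suc n) s - f n s))"
        using lin[OF sh] by (simp add: linear_diff)
      also have "\<dots> \<le> L * norm (f (Suc n) s - f n s)" by (rule bound[OF sh])
      also have "\<dots> \<le> L * (norm v * (1/2) ^ Suc n)"
        by (rule mult_left_mono[OF Suc.IH[OF sh] L])
      finally show "norm (A s (f (Suc n) s) - A s (f n s)) \<le> L * (norm v * (1/2) ^ Suc n)" .
    qed (use Suc.prems cD in \<open>auto intro!: continuous_intros\<close>)
    also have "\<dots> = (t * L) * (norm v * (1/2) ^ Suc n)" by simp
    also have "\<dots> \<le> (1/2) * (norm v * (1/2) ^ Suc n)"
      using Suc.prems hL mult_right_mono[of t h L] L by (intro mult_right_mono) auto
    finally show ?case by simp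
  qed
  define l where "l t = v + (\<Sum>i. f (Suc i) t - f i t)" for t
  have tel: "(\<Sum>i<n. f (Suc i) t - f i t) = f n t - v" for n t
    by (subst sum_lessThan_telescope) (simp add: f_0)
  have "uniform_limit {0..h} (\<lambda>n t. \<Sum>i<n. f (Suc i) t - f i t) (\<lambda>t. \<Sum>i. f (Suc i) t - f i t) sequentially"
    by (rule Weierstrass_m_test[of _ _ "\<lambda>i. norm v * (1/2) ^ Suc i"])
      (use step in \<open>auto intro!: summable_mult summable_geometric\<close>)
  then have ul: "uniform_limit {0..h} f l sequentially"
    unfolding tel l_def uniform_limit_iff by (simp add: dist_norm algebra_simps)
  have "\<exists>g. \<forall>t\<in>{0..h}. (\<lambda>n. f (Suc n) t) \<longlonglongrightarrow> g t \<and> (g has_derivative (\<lambda>k. k *\<^sub>R A t (l t))) (at t within {0..h})"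
  proof (rule has_derivative_sequence[where f' = "\<lambda>n t k. k *\<^sub>R A t (f n t)" and ?x0.0 = 0 and l = v])
    show "(f (Suc n) has_derivative (\<lambda>k. k *\<^sub>R A t (f n t))) (at t within {0..h})" if "t \<in> {0..h}" for n t
      using df[OF that] by (simp add: has_vector_derivative_def)
    fix e :: real assume e: "e > 0"
    have "\<forall>\<^sub>F n in sequentially. \<forall>t\<in>{0..h}. dist (f n t) (l t) < e / (L + 1)"
      using ul e L by (auto simp: uniform_limit_iff)
    then show "\<forall>\<^sub>F n in sequentially. \<forall>t\<in>{0..h}. \<forall>k. norm (k *\<^sub>R A t (f n t) - k *\<^sub>R A t (l t)) \<le> e * norm k"
    proof (rule eventually_mono, intro ballI allI)
      fix n t k assume a: "\<forall>t\<in>{0..h}. dist (f n t) (l t) < e / (L + 1)" and t: "t \<in> {0..h}"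
      have "norm (A t (f n t - l t)) \<le> L * norm (f n t - l t)" by (rule bound[OF t])
      also have "\<dots> \<le> L * (e / (L + 1))"
        using a t L by (intro mult_left_mono) (auto simp: dist_norm intro: less_imp_le)
      also have "\<dots> \<le> e" using L e by (simp add: field_simps)
      finally have "norm (A t (f n t) - A t (l t)) \<le> e" using lin[OF t] by (simp add: linear_diff)
      then have "\<bar>k\<bar> * norm (A t (f n t) - A t (l t)) \<le> \<bar>k\<bar> * e" by (rule mult_left_mono) simp
      then show "norm (k *\<^sub>R A t (f n t) - k *\<^sub>R A t (l t)) \<le> e * norm k"
        by (metis mult.commute norm_scaleR real_norm_def scaleR_diff_right)
    qed
  next
    show "(\<lambda>n. f (Suc n) 0) \<longlonglongrightarrow> v" by (simp add: f_Suc)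
  qed (use h in auto)
  then obtain g where g: "\<And>t. t \<in> {0..h} \<Longrightarrow> (\<lambda>n. f (Suc n) t) \<longlonglongrightarrow> g t"
    "\<And>t. t \<in> {0..h} \<Longrightarrow> (g has_derivative (\<lambda>k. k *\<^sub>R A t (l t))) (at t within {0..h})" by blast
  have gl: "g t = l t" if "t \<in> {0..h}" for t
  proof -
    have "(\<lambda>n. f n t) \<longlonglongrightarrow> l t" using ul that by (rule tendsto_uniform_limitI)
    then show ?thesis using LIMSEQ_unique[OF g(1)[OF that] LIMSEQ_Suc] by blast
  qed
  show ?thesis
  proof (rule that[of g])
    show "g 0 = v" using LIMSEQ_unique[OF g(1)[of 0]] h by (auto simp: f_Suc)
    show "(g has_vector_derivative A t (g t)) (at t within {0..h})" if "t \<in> {0..h}" for t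
      using g(2)[OF that] gl[OF that] by (simp add: has_vector_derivative_def)
  qed
qed

lemma continuous_on_Times_lipschitz:
  fixes u :: "real \<Rightarrow> 'a::metric_space \<Rightarrow> 'b::metric_space"
  assumes lip: "\<And>s y y'. s \<in> T \<Longrightarrow> y \<in> B \<Longrightarrow> y' \<in> B \<Longrightarrow> dist (u s y) (u s y') \<le> K * dist y y'"
    and cont: "\<And>y. y \<in> B \<Longrightarrow> continuous_on T (\<lambda>s. u s y)"
  shows "continuous_on (B \<times> T) (\<lambda>(y, s). u s y)"
  unfolding continuous_on_iff
proof (intro ballI allI impI)
  fix q :: "'a \<times> real" and e :: real
  assume q: "q \<in> B \<times> T" and e: "0 < e"
  obtain y' s' where [simp]: "q = (y', s')" by (cases q)
  have y': "y' \<in> B" and s': "s' \<in> T" using q by auto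
  obtain d where d: "d > 0" "\<And>s. s \<in> T \<Longrightarrow> dist s s' < d \<Longrightarrow> dist (u s y') (u s' y') < e / 2"
    using cont[OF y'] s' e unfolding continuous_on_iff by (metis half_gt_zero)
  define d' where "d' = min d (e / (2 * (\<bar>K\<bar> + 1)))"
  have d': "d' > 0" using d e by (simp add: d'_def)
  show "\<exists>d>0. \<forall>x'\<in>B \<times> T. dist x' q < d \<longrightarrow> dist (case x' of (y, s) \<Rightarrow> u s y) (case q of (y, s) \<Rightarrow> u s y) < e"
  proof (intro exI[of _ d'] conjI ballI impI d')
    fix x' assume x': "x' \<in> B \<times> T" "dist x' q < d'"
    obtain y s where [simp]: "x' = (y, s)" by (cases x')
    have y: "y \<in> B" and s: "s \<in> T" using x' by auto
    have dy: "dist y y' < d'" and ds: "dist s s' < d'"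
      using x'(2) dist_fst_le[of x' q] dist_snd_le[of x' q] by auto
    have "dist (u s y) (u s y') \<le> K * dist y y'" by (rule lip[OF s y y'])
    also have "\<dots> \<le> (\<bar>K\<bar> + 1) * dist y y'" by (intro mult_right_mono) auto
    also have "\<dots> \<le> (\<bar>K\<bar> + 1) * (e / (2 * (\<bar>K\<bar> + 1)))"
      using dy by (intro mult_left_mono) (auto simp: d'_def)
    also have "\<dots> = e / 2" by (simp add: field_simps)
    finally have "dist (u s y) (u s y') \<le> e / 2" .
    moreover have "dist (u s y') (u s' y') < e / 2" using d(2)[OF s] ds by (simp add: d'_def)
    ultimately show "dist (case x' of (y, s) \<Rightarrow> u s y) (case q of (y, s) \<Rightarrow> u s y) < e"
      using dist_triangle[of "u s y" "u s' y'" "u s y'"] by simp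
  qed
qed

lemma flow_lipschitz:
  fixes u :: "real \<Rightarrow> 'a::euclidean_space \<Rightarrow> 'a"
  assumes lip: "\<And>z z'. z \<in> Q \<Longrightarrow> z' \<in> Q \<Longrightarrow> norm (X z' - X z) \<le> L * norm (z' - z)"
    and u: "\<And>y t. y \<in> B \<Longrightarrow> t \<in> {0..h} \<Longrightarrow> u t y \<in> Q"
      "\<And>y. y \<in> B \<Longrightarrow> u 0 y = y"
      "\<And>y t. y \<in> B \<Longrightarrow> t \<in> {0..h} \<Longrightarrow> ((\<lambda>t. u t y) has_vector_derivative X (u t y)) (at t within {0..h})"
    and L: "0 \<le> L" and y: "y \<in> B" "y' \<in> B" and t: "t \<in> {0..h}"
  shows "norm (u t y' - u t y) \<le> exp ((2 * L + 1) * h) * norm (y' - y)"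
  using gronwall_norm[of h "\<lambda>t. u t y' - u t y" "\<lambda>t. X (u t y') - X (u t y)" L 0 t] assms
  by (simp add: has_vector_derivative_diff)

text \<open>The derivative of the flow in the initial point is the solution \<open>W\<close> of the linearised equation.
The error \<open>u(t, y') - u(t, y) - W(y' - y)\<close> solves this equation up to the Taylor remainder of the
vector field, which is quadratic in \<open>\<bar>y' - y\<bar>\<close> because the flow is Lipschitz; by Gronwall the error
itself is quadratic.\<close>

lemma flow_has_derivative:
  fixes u :: "real \<Rightarrow> 'a::euclidean_space \<Rightarrow> 'a"
  assumes lin: "\<And>z. z \<in> Q \<Longrightarrow> linear (DX z)"
    and bound: "\<And>z v. z \<in> Q \<Longrightarrow> norm (DX z v) \<le> L * norm v"
    and cont: "\<And>v. continuous_on Q (\<lambda>z. DX z v)"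
    and lip: "\<And>z z'. z \<in> Q \<Longrightarrow> z' \<in> Q \<Longrightarrow> norm (X z' - X z) \<le> L * norm (z' - z)"
    and taylor: "\<And>z z'. z \<in> Q \<Longrightarrow> z' \<in> Q \<Longrightarrow> norm (X z' - X z - DX z (z' - z)) \<le> C * (norm (z' - z))\<^sup>2"
    and u: "\<And>y t. y \<in> B \<Longrightarrow> t \<in> {0..h} \<Longrightarrow> u t y \<in> Q"
      "\<And>y. y \<in> B \<Longrightarrow> u 0 y = y"
      "\<And>y t. y \<in> B \<Longrightarrow> t \<in> {0..h} \<Longrightarrow> ((\<lambda>t. u t y) has_vector_derivative X (u t y)) (at t within {0..h})"
    and h: "0 \<le> h" and L: "0 \<le> L" and C: "0 \<le> C" and hL: "h * L \<le> 1/2"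
    and B: "open B" and y: "y \<in> B"
  obtains W where "\<And>v. W v 0 = v"
    "\<And>t v. t \<in> {0..h} \<Longrightarrow> (W v has_vector_derivative DX (u t y) (W v t)) (at t within {0..h})"
    "\<And>t. t \<in> {0..h} \<Longrightarrow> (u t has_derivative (\<lambda>v. W v t)) (at y)"
proof -
  define A where "A t = DX (u t y)" for t
  have linA: "linear (A t)" and boundA: "norm (A t v) \<le> L * norm v" if "t \<in> {0..h}" for t v
    using that lin bound u(1) y by (auto simp: A_def)
  have cu: "continuous_on {0..h} (\<lambda>t. u t y)"
    using u(3)[OF y] by (rule continuous_on_vector_derivative)
  have contA: "continuous_on {0..h} (\<lambda>t. A t v)" for v
    unfolding A_def by (rule continuous_on_compose2[OF cont cu]) (use u(1) y in auto)
  have "\<exists>w. w 0 = v \<and> (\<forall>t\<in>{0..h}. (w has_vector_derivative A t (w t)) (at t within {0..h}))" for v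
    using linear_ode_solution[OF linA boundA contA h L hL, where v = v] by metis
  then obtain W where W0: "\<And>v. W v 0 = v"
    and dW: "\<And>v t. t \<in> {0..h} \<Longrightarrow> (W v has_vector_derivative A t (W v t)) (at t within {0..h})"
    by metis
  define K where "K = exp ((2 * L + 1) * h)"
  have K: "0 < K" by (simp add: K_def)
  \<comment> \<open>Uniqueness of solutions is what makes \<open>W\<close> linear in its initial value.\<close>
  have unique: "w t = 0" if w: "w 0 = 0" "\<And>t. t \<in> {0..h} \<Longrightarrow> (w has_vector_derivative A t (w t)) (at t within {0..h})"
    and t: "t \<in> {0..h}" for w t
    using gronwall_norm[of h w "\<lambda>t. A t (w t)" L 0 t] w boundA L t by simp
  have linW: "linear (\<lambda>v. W v t)" if t: "t \<in> {0..h}" for t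
  proof (rule linearI)
    fix v v' c
    have "(\<lambda>t. W (v + v') t - (W v t + W v' t)) t = 0"
      by (rule unique[OF _ _ t])
        (auto simp: W0 linear_diff[OF linA] linear_add[OF linA] intro!: has_vector_derivative_diff has_vector_derivative_add dW)
    then show "W (v + v') t = W v t + W v' t" by simp
    have "(\<lambda>t. W (c *\<^sub>R v) t - c *\<^sub>R W v t) t = 0"
    proof (rule unique[OF _ _ t])
      fix s assume s: "s \<in> {0..h}"
      have "((\<lambda>t. W (c *\<^sub>R v) t - c *\<^sub>R W v t) has_vector_derivative A s (W (c *\<^sub>R v) s) - c *\<^sub>R A s (W v s)) (at s within {0..h})"
        by (intro has_vector_derivative_diff bounded_linear.has_vector_derivative[OF bounded_linear_scaleR_right] dW s)
      then show "((\<lambda>t. W (c *\<^sub>R v) t - c *\<^sub>R W v t) has_vector_derivative A s (W (c *\<^sub>R v) s - c *\<^sub>R W v s)) (at s within {0..h})"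
        using linA[OF s] by (simp add: linear_diff linear_cmul)
    qed (simp add: W0)
    then show "W (c *\<^sub>R v) t = c *\<^sub>R W v t" by simp
  qed
  have quad: "norm (u t y' - u t y - W (y' - y) t) \<le> K * (C * K\<^sup>2 * (norm (y' - y))\<^sup>2)"
    if y': "y' \<in> B" and t: "t \<in> {0..h}" for y' t
  proof -
    define w where "w t = u t y' - u t y - W (y' - y) t" for t
    have "norm (w t) \<le> exp ((2 * L + 1) * h) * (norm (w 0) + C * K\<^sup>2 * (norm (y' - y))\<^sup>2)"
    proof (rule gronwall_norm[where w' = "\<lambda>t. X (u t y') - X (u t y) - A t (W (y' - y) t)"])
      fix s assume s: "s \<in> {0..h}"
      show "(w has_vector_derivative X (u s y') - X (u s y) - A s (W (y' - y) s)) (at s within {0..h})"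
        unfolding w_def by (intro has_vector_derivative_diff u dW y y' s)
      have Q: "u s y \<in> Q" "u s y' \<in> Q" using u(1) y y' s by auto
      have "X (u s y') - X (u s y) - A s (W (y' - y) s)
        = A s (w s) + (X (u s y') - X (u s y) - A s (u s y' - u s y))"
        using linA[OF s] by (simp add: w_def linear_diff)
      also have "norm \<dots> \<le> L * norm (w s) + C * (norm (u s y' - u s y))\<^sup>2"
        using taylor[OF Q] boundA[OF s] by (intro norm_triangle_mono) (auto simp: A_def)
      also have "\<dots> \<le> L * norm (w s) + C * (K * norm (y' - y))\<^sup>2"
        using flow_lipschitz[where u = u, OF lip u L y y' s] C
        by (intro add_left_mono mult_left_mono power_mono) (auto simp: K_def)
      finally show "norm (X (u s y') - X (u s y) - A s (W (y' - y) s)) \<le> L * norm (w s) + C * K\<^sup>2 * (norm (y' - y))\<^sup>2"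
        by (simp add: power_mult_distrib mult_ac)
    qed (use L C t in auto)
    then show ?thesis by (simp add: w_def u(2) y y' W0 K_def)
  qed
  have "(u t has_derivative (\<lambda>v. W v t)) (at y)" if t: "t \<in> {0..h}" for t
    unfolding has_derivative_at'
  proof (intro conjI allI impI)
    show "bounded_linear (\<lambda>v. W v t)" using linW[OF t] linear_conv_bounded_linear by blast
    fix e :: real assume e: "0 < e"
    obtain r where r: "r > 0" "ball y r \<subseteq> B" using B y by (auto simp: open_contains_ball)
    define M where "M = K * (C * K\<^sup>2) + 1"
    have M: "M > 0" using K C by (simp add: M_def add_nonneg_pos)
    show "\<exists>d>0. \<forall>x'. 0 < norm (x' - y) \<and> norm (x' - y) < d \<longrightarrow> norm (u t x' - u t y - W (x' - y) t) / norm (x' - y) < e"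
    proof (intro exI conjI allI impI)
      show "0 < min r (e / M)" using r e M by simp
      fix x' assume x': "0 < norm (x' - y) \<and> norm (x' - y) < min r (e / M)"
      then have "x' \<in> B" using r by (auto simp: dist_norm norm_minus_commute)
      from quad[OF this t] have "norm (u t x' - u t y - W (x' - y) t) \<le> (K * (C * K\<^sup>2) * norm (x' - y)) * norm (x' - y)"
        by (simp add: power2_eq_square mult_ac)
      then have "norm (u t x' - u t y - W (x' - y) t) / norm (x' - y) \<le> K * (C * K\<^sup>2) * norm (x' - y)"
        using x' by (simp add: field_simps)
      also have "\<dots> \<le> M * norm (x' - y)" by (rule mult_right_mono) (auto simp: M_def)
      also have "\<dots> < e" using x' M by (simp add: field_simps)
      finally show "norm (u t x' - u t y - W (x' - y) t) / norm (x' - y) < e" .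
    qed
  qed
  then show ?thesis using that[of W] W0 dW by (auto simp: A_def)
qed

section \<open>Smooth functions on Euclidean space\<close>

lemma smooth_on_has_derivative:
  "smooth_on S f \<Longrightarrow> x \<in> S \<Longrightarrow> (f has_derivative frechet_derivative f (at x)) (at x)"
  unfolding smooth_on_def by (metis Ck_on.simps(2) frechet_derivative_works)

lemma smooth_on_directional:
  "smooth_on S f \<Longrightarrow> smooth_on S (\<lambda>x. frechet_derivative f (at x) v)"
  unfolding smooth_on_def by (metis Ck_on.simps(2))

lemma smooth_on_continuous: "smooth_on S f \<Longrightarrow> continuous_on S f"
  unfolding smooth_on_def by (metis Ck_on.simps(1))

lemma smooth_on_linear:
  "smooth_on S f \<Longrightarrow> x \<in> S \<Longrightarrow> linear (frechet_derivative f (at x))"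
  using smooth_on_has_derivative has_derivative_linear by blast

lemma norm_linear_le_sum:
  fixes f :: "'a::euclidean_space \<Rightarrow> 'b::real_normed_vector"
  assumes "linear f" "\<And>b. b \<in> Basis \<Longrightarrow> norm (f b) \<le> M b"
  shows "norm (f v) \<le> (\<Sum>b\<in>Basis. M b) * norm v"
proof -
  have "f v = f (\<Sum>b\<in>Basis. (v \<bullet> b) *\<^sub>R b)" by (simp add: euclidean_representation)
  also have "\<dots> = (\<Sum>b\<in>Basis. (v \<bullet> b) *\<^sub>R f b)" using assms(1) by (simp add: linear_sum linear_cmul)
  also have "norm \<dots> \<le> (\<Sum>b\<in>Basis. M b * norm v)"
  proof (rule sum_norm_le)
    fix b :: 'a assume b: "b \<in> Basis"
    have "norm ((v \<bullet> b) *\<^sub>R f b) = \<bar>v \<bullet> b\<bar> * norm (f b)" by simp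
    also have "\<dots> \<le> norm v * M b"
      using b assms(2)[OF b] by (intro mult_mono) (auto simp: Basis_le_norm)
    finally show "norm ((v \<bullet> b) *\<^sub>R f b) \<le> M b * norm v" by (simp add: mult.commute)
  qed
  finally show ?thesis by (simp add: sum_distrib_right)
qed

lemma smooth_on_lipschitz:
  fixes f :: "'a::euclidean_space \<Rightarrow> 'b::real_normed_vector"
  assumes f: "smooth_on S f" and Q: "compact Q" "convex Q" "Q \<subseteq> S"
  obtains L where "0 \<le> L" "\<And>z v. z \<in> Q \<Longrightarrow> norm (frechet_derivative f (at z) v) \<le> L * norm v"
    "\<And>z z'. z \<in> Q \<Longrightarrow> z' \<in> Q \<Longrightarrow> norm (f z' - f z) \<le> L * norm (z' - z)"
proof -
  have "\<exists>M. \<forall>z\<in>Q. norm (frechet_derivative f (at z) b) \<le> M" for b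
  proof -
    have "continuous_on Q (\<lambda>z. frechet_derivative f (at z) b)"
      using smooth_on_continuous[OF smooth_on_directional[OF f]] Q(3) continuous_on_subset by blast
    then have "bounded ((\<lambda>z. frechet_derivative f (at z) b) ` Q)"
      using Q(1) compact_continuous_image compact_imp_bounded by blast
    then show ?thesis by (auto simp: bounded_iff)
  qed
  then obtain M where M: "\<And>b z. z \<in> Q \<Longrightarrow> norm (frechet_derivative f (at z) b) \<le> M b" by metis
  define L where "L = \<bar>\<Sum>b\<in>Basis. M b\<bar>"
  have D: "norm (frechet_derivative f (at z) v) \<le> L * norm v" if z: "z \<in> Q" for z v
  proof -
    have "norm (frechet_derivative f (at z) v) \<le> (\<Sum>b\<in>Basis. M b) * norm v"
      by (rule norm_linear_le_sum[OF smooth_on_linear[OF f] M]) (use Q(3) z in auto)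
    also have "\<dots> \<le> L * norm v" by (rule mult_right_mono) (auto simp: L_def)
    finally show ?thesis .
  qed
  show ?thesis
  proof (rule that[OF _ D])
    fix z z' assume z: "z \<in> Q" "z' \<in> Q"
    show "norm (f z' - f z) \<le> L * norm (z' - z)"
    proof (rule differentiable_bound[where f = f, OF Q(2) _ _ z(2) z(1)])
      show "(f has_derivative frechet_derivative f (at x)) (at x within Q)" if "x \<in> Q" for x
        by (rule has_derivative_at_withinI[OF smooth_on_has_derivative[OF f]]) (use Q(3) that in auto)
      show "onorm (frechet_derivative f (at x)) \<le> L" if "x \<in> Q" for x
        by (rule onorm_le) (rule D[OF that])
    qed
  qed (auto simp: L_def)
qed

text \<open>The derivative is itself Lipschitz on the compact convex set, so the map minus its linear part at
\<open>z\<close> has a derivative of size at most \<open>C \<bar>z' - z\<bar>\<close> along the segment.\<close>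

lemma smooth_on_taylor:
  fixes f :: "'a::euclidean_space \<Rightarrow> 'b::real_normed_vector"
  assumes f: "smooth_on S f" and Q: "compact Q" "convex Q" "Q \<subseteq> S"
  obtains C where "0 \<le> C"
    "\<And>z z'. z \<in> Q \<Longrightarrow> z' \<in> Q \<Longrightarrow> norm (f z' - f z - frechet_derivative f (at z) (z' - z)) \<le> C * (norm (z' - z))\<^sup>2"
proof -
  let ?D = "\<lambda>z. frechet_derivative f (at z)"
  have "\<exists>L. 0 \<le> L \<and> (\<forall>z\<in>Q. \<forall>z'\<in>Q. norm (?D z' b - ?D z b) \<le> L * norm (z' - z))" for b
    using smooth_on_lipschitz[OF smooth_on_directional[OF f] Q] by metis
  then obtain L where L: "\<And>b. 0 \<le> L b"
    "\<And>b z z'. z \<in> Q \<Longrightarrow> z' \<in> Q \<Longrightarrow> norm (?D z' b - ?D z b) \<le> L b * norm (z' - z)" by metis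
  define C where "C = (\<Sum>b\<in>Basis. L b)"
  have C: "0 \<le> C" by (simp add: C_def L sum_nonneg)
  show ?thesis
  proof (rule that[OF C])
    fix z z' assume z: "z \<in> Q" "z' \<in> Q"
    have seg: "closed_segment z z' \<subseteq> Q" using z Q(2) by (simp add: closed_segment_subset)
    have lin: "linear (?D x)" if "x \<in> Q" for x using smooth_on_linear[OF f] that Q by blast
    have "norm ((f z' - ?D z z') - (f z - ?D z z)) \<le> (C * norm (z' - z)) * norm (z' - z)"
    proof (rule differentiable_bound[where f = "\<lambda>x. f x - ?D z x"])
      fix x assume x: "x \<in> closed_segment z z'"
      then have xQ: "x \<in> Q" using seg by auto
      have "(f has_derivative ?D x) (at x within closed_segment z z')"
        by (rule has_derivative_at_withinI[OF smooth_on_has_derivative[OF f]]) (use Q(3) xQ in auto)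
      moreover have "(?D z has_derivative ?D z) (at x within closed_segment z z')"
        using lin[OF z(1)] linear_conv_bounded_linear bounded_linear_imp_has_derivative by blast
      ultimately show "((\<lambda>x. f x - ?D z x) has_derivative (\<lambda>v. ?D x v - ?D z v)) (at x within closed_segment z z')"
        by (rule has_derivative_diff)
      show "onorm (\<lambda>v. ?D x v - ?D z v) \<le> C * norm (z' - z)"
      proof (rule onorm_le)
        fix v
        have "norm (?D x v - ?D z v) \<le> (\<Sum>b\<in>Basis. L b * norm (x - z)) * norm v"
          by (rule norm_linear_le_sum[where f = "\<lambda>v. ?D x v - ?D z v"])
            (auto intro!: linear_compose_sub lin xQ z L)
        also have "\<dots> \<le> C * norm (z' - z) * norm v"
          using segment_bound1[OF x] C
          by (intro mult_right_mono) (auto simp: C_def sum_distrib_right[symmetric] L intro!: mult_left_mono)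
        finally show "norm (?D x v - ?D z v) \<le> C * norm (z' - z) * norm v" .
      qed
    qed auto
    then show "norm (f z' - f z - ?D z (z' - z)) \<le> C * (norm (z' - z))\<^sup>2"
      using lin[OF z(1)] by (simp add: linear_diff power2_eq_square algebra_simps)
  qed
qed

text \<open>The mean value theorem applied twice, once in each direction.\<close>

lemma second_difference_mean_value:
  fixes f :: "'a::euclidean_space \<Rightarrow> real"
  assumes f: "smooth_on S f" and s: "0 < s"
    and sub: "\<And>a b. 0 \<le> a \<Longrightarrow> a \<le> s \<Longrightarrow> 0 \<le> b \<Longrightarrow> b \<le> s \<Longrightarrow> y + a *\<^sub>R u + b *\<^sub>R v \<in> S"
  obtains a b where "0 < a" "a < s" "0 < b" "b < s"
    "f (y + s *\<^sub>R u + s *\<^sub>R v) - f (y + s *\<^sub>R u) - f (y + s *\<^sub>R v) + f y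
     = s\<^sup>2 * frechet_derivative (\<lambda>z. frechet_derivative f (at z) u) (at (y + a *\<^sub>R u + b *\<^sub>R v)) v"
proof -
  let ?g = "\<lambda>z. frechet_derivative f (at z) u"
  have du: "((\<lambda>a. f (y + a *\<^sub>R u + b *\<^sub>R v)) has_real_derivative ?g (y + a *\<^sub>R u + b *\<^sub>R v)) (at a)"
    if "0 \<le> a" "a \<le> s" "0 \<le> b" "b \<le> s" for a b
  proof -
    have "((\<lambda>a. f (y + a *\<^sub>R u + b *\<^sub>R v)) has_derivative (\<lambda>k. frechet_derivative f (at (y + a *\<^sub>R u + b *\<^sub>R v)) (k *\<^sub>R u))) (at a)"
      by (rule has_derivative_compose[OF _ smooth_on_has_derivative[OF f]])
        (use sub that in \<open>auto intro!: derivative_eq_intros\<close>)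
    then show ?thesis
      using smooth_on_linear[OF f sub[OF that]] by (simp add: has_field_derivative_def linear_cmul mult.commute[of _ "?g _"])
  qed
  have dv: "((\<lambda>b. ?g (y + a *\<^sub>R u + b *\<^sub>R v)) has_real_derivative frechet_derivative ?g (at (y + a *\<^sub>R u + b *\<^sub>R v)) v) (at b)"
    if "0 \<le> a" "a \<le> s" "0 \<le> b" "b \<le> s" for a b
  proof -
    have g: "smooth_on S ?g" by (rule smooth_on_directional[OF f])
    have "((\<lambda>b. ?g (y + a *\<^sub>R u + b *\<^sub>R v)) has_derivative (\<lambda>k. frechet_derivative ?g (at (y + a *\<^sub>R u + b *\<^sub>R v)) (k *\<^sub>R v))) (at b)"
      by (rule has_derivative_compose[OF _ smooth_on_has_derivative[OF g]])
        (use sub that in \<open>auto intro!: derivative_eq_intros\<close>)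
    then show ?thesis
      using smooth_on_linear[OF g sub[OF that]]
      by (simp add: has_field_derivative_def linear_cmul mult.commute[of _ "frechet_derivative ?g _ _"])
  qed
  define F where "F a = f (y + a *\<^sub>R u + s *\<^sub>R v) - f (y + a *\<^sub>R u + 0 *\<^sub>R v)" for a
  have "\<exists>a>0. a < s \<and> F s - F 0 = (s - 0) * (?g (y + a *\<^sub>R u + s *\<^sub>R v) - ?g (y + a *\<^sub>R u + 0 *\<^sub>R v))"
  proof (rule MVT2[OF s])
    fix a assume "0 \<le> a" "a \<le> s"
    then show "(F has_real_derivative ?g (y + a *\<^sub>R u + s *\<^sub>R v) - ?g (y + a *\<^sub>R u + 0 *\<^sub>R v)) (at a)"
      unfolding F_def by (intro DERIV_diff du) (use s in auto)
  qed
  then obtain a where a: "0 < a" "a < s"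
    "F s - F 0 = s * (?g (y + a *\<^sub>R u + s *\<^sub>R v) - ?g (y + a *\<^sub>R u + 0 *\<^sub>R v))" by auto
  have "\<exists>b>0. b < s \<and> ?g (y + a *\<^sub>R u + s *\<^sub>R v) - ?g (y + a *\<^sub>R u + 0 *\<^sub>R v)
    = (s - 0) * frechet_derivative ?g (at (y + a *\<^sub>R u + b *\<^sub>R v)) v"
    by (rule MVT2[OF s]) (use a dv in auto)
  then obtain b where b: "0 < b" "b < s"
    "?g (y + a *\<^sub>R u + s *\<^sub>R v) - ?g (y + a *\<^sub>R u + 0 *\<^sub>R v) = s * frechet_derivative ?g (at (y + a *\<^sub>R u + b *\<^sub>R v)) v"
    by auto
  show ?thesis
    by (rule that[OF a(1,2) b(1,2)]) (use a(3)[unfolded b(3)] in \<open>simp add: F_def power2_eq_square algebra_simps\<close>)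
qed

text \<open>The second difference over a small parallelogram is symmetric in its two sides, and divided by
\<open>s\<^sup>2\<close> it is close to the mixed derivative taken in either order.\<close>

lemma second_derivative_symmetric:
  fixes f :: "'a::euclidean_space \<Rightarrow> real"
  assumes S: "open S" and f: "smooth_on S f" and y: "y \<in> S"
  shows "frechet_derivative (\<lambda>z. frechet_derivative f (at z) u) (at y) v
    = frechet_derivative (\<lambda>z. frechet_derivative f (at z) v) (at y) u" (is "?D u v y = ?D v u y")
proof (rule ccontr)
  assume "?D u v y \<noteq> ?D v u y"
  define e where "e = dist (?D u v y) (?D v u y) / 2"
  have e: "e > 0" using \<open>?D u v y \<noteq> ?D v u y\<close> by (simp add: e_def)
  have c: "isCont (?D u v) y" for u v
    using smooth_on_continuous[OF smooth_on_directional[OF smooth_on_directional[OF f]]] S y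
    by (simp add: continuous_on_eq_continuous_at)
  have ev: "\<forall>\<^sub>F z in nhds y. dist (?D u v z) (?D u v y) < e" for u v
  proof -
    have "(?D u v \<longlongrightarrow> ?D u v y) (nhds y)"
      using c[of u v] unfolding isCont_def by (rule tendsto_at_iff_tendsto_nhds[THEN iffD1])
    then show ?thesis using e by (rule tendstoD)
  qed
  have "\<forall>\<^sub>F z in nhds y. z \<in> S" using S y by (rule eventually_nhds_in_open)
  with ev[of u v] ev[of v u] have "\<forall>\<^sub>F z in nhds y. z \<in> S \<and> dist (?D u v z) (?D u v y) < e \<and> dist (?D v u z) (?D v u y) < e"
    by eventually_elim auto
  then obtain d where d: "d > 0" "\<And>z. dist z y < d \<Longrightarrow> z \<in> S \<and> dist (?D u v z) (?D u v y) < e \<and> dist (?D v u z) (?D v u y) < e"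
    by (auto simp: eventually_nhds_metric)
  define s where "s = d / (norm u + norm v + 1)"
  have nuv: "norm u + norm v + 1 > 0" by (simp add: add_nonneg_pos)
  then have s: "s > 0" using d by (simp add: s_def)
  have near: "dist (y + a *\<^sub>R u + b *\<^sub>R v) y < d" if "0 \<le> a" "a \<le> s" "0 \<le> b" "b \<le> s" for a b
  proof -
    have "dist (y + a *\<^sub>R u + b *\<^sub>R v) y \<le> a * norm u + b * norm v"
      using that norm_triangle_ineq[of "a *\<^sub>R u" "b *\<^sub>R v"] by (simp add: dist_norm add.assoc)
    also have "\<dots> \<le> s * norm u + s * norm v" using that by (intro add_mono mult_right_mono) auto
    also have "\<dots> < s * (norm u + norm v + 1)" using s by (simp add: algebra_simps)
    also have "\<dots> = d" using nuv by (simp add: s_def)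
    finally show ?thesis .
  qed
  obtain a b where ab: "0 < a" "a < s" "0 < b" "b < s"
    "f (y + s *\<^sub>R u + s *\<^sub>R v) - f (y + s *\<^sub>R u) - f (y + s *\<^sub>R v) + f y = s\<^sup>2 * ?D u v (y + a *\<^sub>R u + b *\<^sub>R v)"
    using second_difference_mean_value[OF f s, of y u v] near d(2) by blast
  have near': "dist (y + a *\<^sub>R v + b *\<^sub>R u) y < d" if "0 \<le> a" "a \<le> s" "0 \<le> b" "b \<le> s" for a b
    using near[OF that(3,4,1,2)] by (simp add: algebra_simps)
  obtain a' b' where ab': "0 < a'" "a' < s" "0 < b'" "b' < s"
    "f (y + s *\<^sub>R v + s *\<^sub>R u) - f (y + s *\<^sub>R v) - f (y + s *\<^sub>R u) + f y = s\<^sup>2 * ?D v u (y + a' *\<^sub>R v + b' *\<^sub>R u)"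
    using second_difference_mean_value[OF f s, of y v u] near' d(2) by blast
  have "s\<^sup>2 * ?D u v (y + a *\<^sub>R u + b *\<^sub>R v) = s\<^sup>2 * ?D v u (y + a' *\<^sub>R v + b' *\<^sub>R u)"
    unfolding ab(5)[symmetric] ab'(5)[symmetric] by (simp add: algebra_simps)
  then have eq: "?D u v (y + a *\<^sub>R u + b *\<^sub>R v) = ?D v u (y + a' *\<^sub>R v + b' *\<^sub>R u)" using s by simp
  have "dist (?D u v (y + a *\<^sub>R u + b *\<^sub>R v)) (?D u v y) < e" "dist (?D v u (y + a' *\<^sub>R v + b' *\<^sub>R u)) (?D v u y) < e"
    using d(2)[OF near[of a b]] d(2)[OF near'[of a' b']] ab ab' by auto
  then have "dist (?D u v y) (?D v u y) < 2 * e" unfolding eq by (metis dist_triangle_half_r e_def field_sum_of_halves mult_2)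
  then show False by (simp add: e_def)
qed

lemma bilinear_expand:
  fixes \<beta> :: "'a::euclidean_space \<Rightarrow> 'a \<Rightarrow> real"
  assumes "bilinear \<beta>"
  shows "\<beta> u v = (\<Sum>a\<in>Basis. \<Sum>b\<in>Basis. (u \<bullet> a) * (v \<bullet> b) * \<beta> a b)"
proof -
  have l: "linear (\<beta> v)" and l': "linear (\<lambda>u. \<beta> u v)" for v
    using assms by (auto simp: bilinear_def)
  have "\<beta> u v = \<beta> (\<Sum>a\<in>Basis. (u \<bullet> a) *\<^sub>R a) (\<Sum>b\<in>Basis. (v \<bullet> b) *\<^sub>R b)"
    by (simp add: euclidean_representation)
  also have "\<dots> = (\<Sum>a\<in>Basis. \<Sum>b\<in>Basis. (u \<bullet> a) * (v \<bullet> b) * \<beta> a b)"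
    by (simp add: linear_sum[OF l] linear_sum[OF l'] linear_cmul[OF l] linear_cmul[OF l'] sum_distrib_left mult_ac)
      (rule sum.swap)
  finally show ?thesis .
qed

text \<open>The product rule for a form with variable coefficients evaluated on varying vectors, obtained by
expanding the form in the standard basis.\<close>

lemma has_derivative_bilinear_form:
  fixes \<omega> :: "'a::euclidean_space \<Rightarrow> 'a \<Rightarrow> 'a \<Rightarrow> real" and c p q :: "'c::real_normed_vector \<Rightarrow> 'a"
  assumes S: "open S" and bil: "\<And>y. y \<in> S \<Longrightarrow> bilinear (\<omega> y)"
    and diff: "\<And>u v y. y \<in> S \<Longrightarrow> (\<lambda>y. \<omega> y u v) differentiable (at y)"
    and c: "(c has_derivative c') (at x within T)" "\<And>x. x \<in> T \<Longrightarrow> c x \<in> S" and x: "x \<in> T"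
    and p: "(p has_derivative p') (at x within T)" and q: "(q has_derivative q') (at x within T)"
  shows "((\<lambda>x. \<omega> (c x) (p x) (q x)) has_derivative
    (\<lambda>k. frechet_derivative (\<lambda>z. \<omega> z (p x) (q x)) (at (c x)) (c' k) + \<omega> (c x) (p' k) (q x) + \<omega> (c x) (p x) (q' k)))
    (at x within T)"
proof -
  let ?D = "\<lambda>u v. frechet_derivative (\<lambda>z. \<omega> z u v) (at (c x))"
  have cx: "c x \<in> S" by (rule c(2)[OF x])
  have D: "((\<lambda>z. \<omega> z u v) has_derivative ?D u v) (at (c x))" for u v
    using diff[OF cx] by (simp add: frechet_derivative_works)
  have D_expand: "?D u v = (\<lambda>k. \<Sum>a\<in>Basis. \<Sum>b\<in>Basis. (u \<bullet> a) * (v \<bullet> b) * ?D a b k)" for u v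
  proof (rule has_derivative_unique[OF D])
    have "((\<lambda>z. \<Sum>a\<in>Basis. \<Sum>b\<in>Basis. (u \<bullet> a) * (v \<bullet> b) * \<omega> z a b) has_derivative
      (\<lambda>k. \<Sum>a\<in>Basis. \<Sum>b\<in>Basis. (u \<bullet> a) * (v \<bullet> b) * ?D a b k)) (at (c x))"
      by (intro has_derivative_sum has_derivative_mult_right D)
    then show "((\<lambda>z. \<omega> z u v) has_derivative (\<lambda>k. \<Sum>a\<in>Basis. \<Sum>b\<in>Basis. (u \<bullet> a) * (v \<bullet> b) * ?D a b k)) (at (c x))"
      by (rule has_derivative_transform_within_open[OF _ S cx]) (rule bilinear_expand[OF bil, symmetric])
  qed
  have Dc: "((\<lambda>x. \<omega> (c x) a b) has_derivative (\<lambda>k. ?D a b (c' k))) (at x within T)" for a b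
    by (rule has_derivative_compose[OF c(1) D])
  have "((\<lambda>x. \<Sum>a\<in>Basis. \<Sum>b\<in>Basis. (p x \<bullet> a) * (q x \<bullet> b) * \<omega> (c x) a b) has_derivative
    (\<lambda>k. \<Sum>a\<in>Basis. \<Sum>b\<in>Basis. (p x \<bullet> a) * (q x \<bullet> b) * ?D a b (c' k)
       + ((p x \<bullet> a) * (q' k \<bullet> b) + (p' k \<bullet> a) * (q x \<bullet> b)) * \<omega> (c x) a b)) (at x within T)"
    by (intro has_derivative_sum has_derivative_mult has_derivative_inner_left p q Dc)
  also have "(\<lambda>k. \<Sum>a\<in>Basis. \<Sum>b\<in>Basis. (p x \<bullet> a) * (q x \<bullet> b) * ?D a b (c' k)
       + ((p x \<bullet> a) * (q' k \<bullet> b) + (p' k \<bullet> a) * (q x \<bullet> b)) * \<omega> (c x) a b)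
    = (\<lambda>k. ?D (p x) (q x) (c' k) + \<omega> (c x) (p' k) (q x) + \<omega> (c x) (p x) (q' k))"
  proof
    fix k
    have 1: "?D (p x) (q x) (c' k) = (\<Sum>a\<in>Basis. \<Sum>b\<in>Basis. (p x \<bullet> a) * (q x \<bullet> b) * ?D a b (c' k))"
      using D_expand[of "p x" "q x"] by (rule fun_cong)
    show "(\<Sum>a\<in>Basis. \<Sum>b\<in>Basis. (p x \<bullet> a) * (q x \<bullet> b) * ?D a b (c' k)
       + ((p x \<bullet> a) * (q' k \<bullet> b) + (p' k \<bullet> a) * (q x \<bullet> b)) * \<omega> (c x) a b)
     = ?D (p x) (q x) (c' k) + \<omega> (c x) (p' k) (q x) + \<omega> (c x) (p x) (q' k)"
      unfolding 1 bilinear_expand[OF bil[OF cx], of "p' k"] bilinear_expand[OF bil[OF cx], of "p x" "q' k"]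
      by (simp only: sum.distrib distrib_right)
  qed
  finally show ?thesis
    by (rule has_derivative_transform_within[OF _ zero_less_one x]) (rule bilinear_expand[OF bil[OF c(2)], symmetric])
qed

section \<open>The Lie derivative of the form along a Hamiltonian field\<close>

lemma alternating_swap:
  assumes "bilinear \<beta>" "\<And>u. \<beta> u u = (0::real)"
  shows "\<beta> u v = - \<beta> v u"
proof -
  have "\<beta> (u + v) (u + v) = \<beta> u u + \<beta> u v + \<beta> v u + \<beta> v v"
    by (simp add: bilinear_ladd[OF assms(1)] bilinear_radd[OF assms(1)])
  then show ?thesis by (simp add: assms(2))
qed

text \<open>In coordinates, \<open>L\<^sub>X \<omega> = \<eta>(X) \<omega>\<close>. By Cartan's formula
\<open>L\<^sub>X \<omega> = d(\<iota>\<^sub>X \<omega>) + \<iota>\<^sub>X d\<omega> = d(dH - H \<eta>) + \<iota>\<^sub>X (\<eta> \<and> \<omega>)\<close>, and everything cancels except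
\<open>\<eta>(X) \<omega>\<close> because \<open>d\<eta> = 0\<close> and \<open>d(dH) = 0\<close>; the latter is the symmetry of second derivatives.\<close>

lemma lie_derivative_hamiltonian:
  fixes \<omega> :: "'a::euclidean_space \<Rightarrow> 'a \<Rightarrow> 'a \<Rightarrow> real" and \<eta> :: "'a \<Rightarrow> 'a \<Rightarrow> real"
    and H :: "'a \<Rightarrow> real" and X :: "'a \<Rightarrow> 'a"
  assumes S: "open S" and y: "y \<in> S"
    and X: "smooth_on S X" and H: "smooth_on S H"
    and \<eta>: "\<And>v. smooth_on S (\<lambda>y. \<eta> y v)"
    and \<omega>: "\<And>u v. smooth_on S (\<lambda>y. \<omega> y u v)" and bil: "\<And>y. y \<in> S \<Longrightarrow> bilinear (\<omega> y)"
    and alt: "\<And>y u. y \<in> S \<Longrightarrow> \<omega> y u u = 0"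
    and closed: "\<And>u v. frechet_derivative (\<lambda>z. \<eta> z v) (at y) u = frechet_derivative (\<lambda>z. \<eta> z u) (at y) v"
    and twisted: "\<And>u v w. frechet_derivative (\<lambda>z. \<omega> z v w) (at y) u - frechet_derivative (\<lambda>z. \<omega> z u w) (at y) v
      + frechet_derivative (\<lambda>z. \<omega> z u v) (at y) w
      = \<eta> y u * \<omega> y v w - \<eta> y v * \<omega> y u w + \<eta> y w * \<omega> y u v"
    and ham: "\<And>y v. y \<in> S \<Longrightarrow> \<omega> y (X y) v = frechet_derivative H (at y) v - H y * \<eta> y v"
  shows "frechet_derivative (\<lambda>z. \<omega> z u v) (at y) (X y) + \<omega> y (frechet_derivative X (at y) u) v
    + \<omega> y u (frechet_derivative X (at y) v) = \<eta> y (X y) * \<omega> y u v"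
proof -
  let ?DX = "frechet_derivative X (at y)" and ?DH = "frechet_derivative H (at y)"
  let ?D\<omega> = "\<lambda>u v. frechet_derivative (\<lambda>z. \<omega> z u v) (at y)"
  \<comment> \<open>Differentiating the equation that defines the Hamiltonian vector field.\<close>
  have diff: "?D\<omega> (X y) v u + \<omega> y (?DX u) v
    = frechet_derivative (\<lambda>z. frechet_derivative H (at z) v) (at y) u
      - (H y * frechet_derivative (\<lambda>z. \<eta> z v) (at y) u + ?DH u * \<eta> y v)" for u v
  proof -
    have "((\<lambda>z. \<omega> z (X z) v) has_derivative (\<lambda>k. ?D\<omega> (X y) v k + \<omega> y (?DX k) v + \<omega> y (X y) 0)) (at y within S)"
    proof (rule has_derivative_bilinear_form[OF S bil _ _ _ y])
      show "(\<lambda>z. \<omega> z u v) differentiable (at z)" if "z \<in> S" for u v z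
        by (rule differentiableI[OF smooth_on_has_derivative[OF \<omega> that]])
      show "(X has_derivative ?DX) (at y within S)"
        by (rule has_derivative_at_withinI[OF smooth_on_has_derivative[OF X y]])
    qed simp_all
    then have "((\<lambda>z. \<omega> z (X z) v) has_derivative (\<lambda>k. ?D\<omega> (X y) v k + \<omega> y (?DX k) v)) (at y)"
      using bilinear_rzero[OF bil[OF y]] at_within_open[OF y S] by simp
    moreover have "((\<lambda>z. \<omega> z (X z) v) has_derivative (\<lambda>k. frechet_derivative (\<lambda>z. frechet_derivative H (at z) v) (at y) k
      - (H y * frechet_derivative (\<lambda>z. \<eta> z v) (at y) k + ?DH k * \<eta> y v))) (at y)"
    proof (rule has_derivative_transform_within_open[OF _ S y])
      show "((\<lambda>z. frechet_derivative H (at z) v - H z * \<eta> z v) has_derivative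
        (\<lambda>k. frechet_derivative (\<lambda>z. frechet_derivative H (at z) v) (at y) k
          - (H y * frechet_derivative (\<lambda>z. \<eta> z v) (at y) k + ?DH k * \<eta> y v))) (at y)"
        by (intro has_derivative_diff has_derivative_mult smooth_on_has_derivative[OF _ y] smooth_on_directional H \<eta>)
    qed (simp add: ham)
    ultimately show ?thesis by (auto dest: has_derivative_unique fun_cong)
  qed
  have swap: "\<omega> y u v = - \<omega> y v u" for u v
    by (rule alternating_swap[OF bil[OF y] alt[OF y]])
  \<comment> \<open>This is \<open>d(dH) = 0\<close>.\<close>
  have sym: "frechet_derivative (\<lambda>z. frechet_derivative H (at z) v) (at y) u
    = frechet_derivative (\<lambda>z. frechet_derivative H (at z) u) (at y) v"
    by (rule second_derivative_symmetric[OF S H y])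
  have "?D\<omega> u v (X y) = ?D\<omega> (X y) v u - ?D\<omega> (X y) u v
      + \<eta> y (X y) * \<omega> y u v - \<eta> y u * \<omega> y (X y) v + \<eta> y v * \<omega> y (X y) u"
    using twisted[of u v "X y"] by simp
  moreover have "\<omega> y u (?DX v) = - \<omega> y (?DX v) u" by (rule swap)
  ultimately show ?thesis
    using diff[of v u] diff[of u v] sym closed[of v u] ham[OF y, of u] ham[OF y, of v]
    by (simp add: algebra_simps)
qed

text \<open>The infinitesimal identity \<open>L\<^sub>X \<omega> = g \<omega>\<close> integrates to \<open>\<phi>\<^sub>t\<^sup>* \<omega> = e\<^sup>r \<omega>\<close> with \<open>r\<close> the integral of \<open>g\<close> along
the orbit: \<open>e\<^sup>-\<^sup>r \<omega>(p, q)\<close> is constant when \<open>p\<close> and \<open>q\<close> are transported by the linearised flow.\<close>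

lemma form_along_linearised_flow:
  fixes \<omega> :: "'a::euclidean_space \<Rightarrow> 'a \<Rightarrow> 'a \<Rightarrow> real" and c p q :: "real \<Rightarrow> 'a"
  assumes S: "open S" and bil: "\<And>y. y \<in> S \<Longrightarrow> bilinear (\<omega> y)"
    and \<omega>: "\<And>u v. smooth_on S (\<lambda>y. \<omega> y u v)"
    and lie: "\<And>y u v. y \<in> S \<Longrightarrow> frechet_derivative (\<lambda>z. \<omega> z u v) (at y) (X y) + \<omega> y (DX y u) v
      + \<omega> y u (DX y v) = g y * \<omega> y u v"
    and c: "\<And>t. t \<in> {0..h} \<Longrightarrow> c t \<in> S"
      "\<And>t. t \<in> {0..h} \<Longrightarrow> (c has_vector_derivative X (c t)) (at t within {0..h})"
    and p: "\<And>t. t \<in> {0..h} \<Longrightarrow> (p has_vector_derivative DX (c t) (p t)) (at t within {0..h})"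
    and q: "\<And>t. t \<in> {0..h} \<Longrightarrow> (q has_vector_derivative DX (c t) (q t)) (at t within {0..h})"
    and g: "continuous_on S g" and t: "t \<in> {0..h}"
  shows "\<omega> (c t) (p t) (q t) = exp (integral {0..t} (\<lambda>s. g (c s))) * \<omega> (c 0) (p 0) (q 0)"
proof -
  let ?r = "\<lambda>t. integral {0..t} (\<lambda>s. g (c s))"
  have h: "0 \<le> h" using t by simp
  have cc: "continuous_on {0..h} (\<lambda>s. g (c s))"
    using continuous_on_vector_derivative[OF c(2)] c(1) by (intro continuous_on_compose2[OF g]) auto
  have "((\<lambda>t. exp (- ?r t) * \<omega> (c t) (p t) (q t)) has_derivative (\<lambda>k. 0)) (at s within {0..h})" if s: "s \<in> {0..h}" for s
  proof -
    have "((\<lambda>t. \<omega> (c t) (p t) (q t)) has_derivative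
      (\<lambda>k. frechet_derivative (\<lambda>z. \<omega> z (p s) (q s)) (at (c s)) (k *\<^sub>R X (c s))
        + \<omega> (c s) (k *\<^sub>R DX (c s) (p s)) (q s) + \<omega> (c s) (p s) (k *\<^sub>R DX (c s) (q s)))) (at s within {0..h})"
    proof (rule has_derivative_bilinear_form[OF S bil _ _ c(1) s])
      show "(\<lambda>z. \<omega> z u v) differentiable (at z)" if "z \<in> S" for u v z
        by (rule differentiableI[OF smooth_on_has_derivative[OF \<omega> that]])
    qed (use c(2)[OF s] p[OF s] q[OF s] in \<open>simp_all add: has_vector_derivative_def\<close>)
    moreover have "linear (frechet_derivative (\<lambda>z. \<omega> z (p s) (q s)) (at (c s)))"
      by (rule smooth_on_linear[OF \<omega> c(1)[OF s]])
    ultimately have "((\<lambda>t. \<omega> (c t) (p t) (q t)) has_derivative (\<lambda>k. k * (g (c s) * \<omega> (c s) (p s) (q s)))) (at s within {0..h})"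
      unfolding lie[OF c(1)[OF s], symmetric]
      by (simp add: linear_cmul bilinear_lmul[OF bil[OF c(1)[OF s]]] bilinear_rmul[OF bil[OF c(1)[OF s]]] algebra_simps)
    then have 1: "((\<lambda>t. \<omega> (c t) (p t) (q t)) has_real_derivative g (c s) * \<omega> (c s) (p s) (q s)) (at s within {0..h})"
      by (simp add: has_field_derivative_def mult.commute[of _ "g _ * _"])
    have 2: "(?r has_real_derivative g (c s)) (at s within {0..h})"
      using integral_has_vector_derivative[OF cc s] by (simp add: has_real_derivative_iff_has_vector_derivative)
    have "((\<lambda>t. exp (- ?r t) * \<omega> (c t) (p t) (q t)) has_real_derivative 0) (at s within {0..h})"
      by (rule derivative_eq_intros 1 2 refl | simp)+
    then show ?thesis by (simp add: has_field_derivative_def lambda_zero)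
  qed
  then obtain C where C: "\<And>s. s \<in> {0..h} \<Longrightarrow> exp (- ?r s) * \<omega> (c s) (p s) (q s) = C"
    using has_derivative_zero_constant[of "{0..h}" "\<lambda>t. exp (- ?r t) * \<omega> (c t) (p t) (q t)"] by auto
  have "exp (- ?r t) * \<omega> (c t) (p t) (q t) = \<omega> (c 0) (p 0) (q 0)"
    using C[OF t] C[of 0] h by simp
  then show ?thesis by (simp add: exp_minus field_simps)
qed

section \<open>Charts and flows of vector fields\<close>

locale atlas =
  fixes \<A> :: "('m::{t2_space, second_countable_topology}, 'e::euclidean_space) chart set"
  assumes atlas: "smooth_atlas \<A>"
begin

lemma chart_at: obtains k where "k \<in> \<A>" "p \<in> cdom k"
  using atlas unfolding smooth_atlas_def by blast

lemma
  assumes k: "k \<in> \<A>"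
  shows open_cdom: "open (cdom k)" and open_cimage: "open (cimage k)"
    and homeo: "homeomorphism (cdom k) (cimage k) (cmap k) (cinv k)"
  using atlas k unfolding smooth_atlas_def by blast+

lemma cmap_continuous: "k \<in> \<A> \<Longrightarrow> continuous_on (cdom k) (cmap k)"
  and cinv_continuous: "k \<in> \<A> \<Longrightarrow> continuous_on (cimage k) (cinv k)"
  and cinv_cmap: "k \<in> \<A> \<Longrightarrow> p \<in> cdom k \<Longrightarrow> cinv k (cmap k p) = p"
  and cmap_cinv: "k \<in> \<A> \<Longrightarrow> y \<in> cimage k \<Longrightarrow> cmap k (cinv k y) = y"
  and cinv_in_cdom: "k \<in> \<A> \<Longrightarrow> y \<in> cimage k \<Longrightarrow> cinv k y \<in> cdom k"
  and cmap_in_cimage: "k \<in> \<A> \<Longrightarrow> p \<in> cdom k \<Longrightarrow> cmap k p \<in> cimage k"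
  using homeo unfolding homeomorphism_def by blast+

lemma open_cmap_preimage: "k \<in> \<A> \<Longrightarrow> open B \<Longrightarrow> open (cdom k \<inter> cmap k -` B)"
  using continuous_open_preimage[OF cmap_continuous open_cdom] by blast

lemma open_cinv_preimage: "k \<in> \<A> \<Longrightarrow> open V \<Longrightarrow> open (cimage k \<inter> cinv k -` V)"
  using continuous_open_preimage[OF cinv_continuous open_cimage] by blast

lemma cinv_image_eq:
  assumes k: "k \<in> \<A>" and B: "B \<subseteq> cimage k"
  shows "cinv k ` B = cdom k \<inter> cmap k -` B"
proof safe
  fix y assume "y \<in> B"
  then show "cinv k y \<in> cdom k" "cinv k y \<in> cmap k -` B"
    using B cmap_cinv[OF k, of y] cinv_in_cdom[OF k, of y] by auto
next
  fix p assume "p \<in> cdom k" "cmap k p \<in> B"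
  then show "p \<in> cinv k ` B" using cinv_cmap[OF k, of p] by (metis imageI)
qed

lemma cmap_image_eq:
  assumes k: "k \<in> \<A>"
  shows "cmap k ` (cdom k \<inter> V) = cimage k \<inter> cinv k -` V"
proof safe
  fix p assume "p \<in> cdom k" "p \<in> V"
  then show "cmap k p \<in> cimage k" "cmap k p \<in> cinv k -` V"
    using cinv_cmap[OF k, of p] cmap_in_cimage[OF k, of p] by auto
next
  fix y assume "y \<in> cimage k" "cinv k y \<in> V"
  then show "y \<in> cmap k ` (cdom k \<inter> V)"
    using cmap_cinv[OF k, of y] cinv_in_cdom[OF k, of y] by (metis IntI imageI)
qed

lemma overlap_eq: "k \<in> \<A> \<Longrightarrow> overlap k l = cimage k \<inter> cinv k -` cdom l"
  unfolding overlap_def by (rule cmap_image_eq)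

lemma transition_has_derivative:
  assumes "k \<in> \<A>" "l \<in> \<A>" "y \<in> overlap k l"
  shows "(transition k l has_derivative frechet_derivative (transition k l) (at y)) (at y)"
proof (rule smooth_on_has_derivative[OF _ assms(3)])
  show "smooth_on (overlap k l) (transition k l)"
    using assms(1,2) atlas unfolding smooth_atlas_def by blast
qed

lemma transition_inj:
  assumes "k \<in> \<A>" "l \<in> \<A>" shows "inj_on (transition k l) (overlap k l)"
proof (rule inj_onI)
  fix y z assume "y \<in> overlap k l" "z \<in> overlap k l" "transition k l y = transition k l z"
  then have yz: "y \<in> cimage k" "z \<in> cimage k" "cinv k y \<in> cdom l" "cinv k z \<in> cdom l"
    and "cmap l (cinv k y) = cmap l (cinv k z)"
    by (auto simp: overlap_eq[OF assms(1)] transition_def)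
  then have "cinv k y = cinv k z" using cinv_cmap[OF assms(2)] by metis
  then show "y = z" using yz(1,2) cmap_cinv[OF assms(1)] by metis
qed

lemma chart_ball:
  assumes "k \<in> \<A>" "p \<in> cdom k"
  obtains r where "r > 0" "cball (cmap k p) (2 * r) \<subseteq> cimage k"
proof -
  obtain r where r: "r > 0" "cball (cmap k p) r \<subseteq> cimage k"
    using open_cimage[OF assms(1)] cmap_in_cimage[OF assms] by (auto simp: open_contains_cball)
  show ?thesis by (rule that[of "r/2"]) (use r in auto)
qed

end

locale vector_field_flow = atlas \<A>
  for \<A> :: "('m::{t2_space, second_countable_topology}, 'e::euclidean_space) chart set" +
  fixes X :: "('m, 'e) vfield" and \<phi> :: "real \<Rightarrow> 'm \<Rightarrow> 'm"
  assumes vector_field: "vector_field \<A> X" and flow: "flow_of \<A> X \<phi>"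
begin

lemma X_smooth: "k \<in> \<A> \<Longrightarrow> smooth_on (cimage k) (X k)"
  using vector_field by (simp add: vector_field_def)

definition integral_curve :: "(real \<Rightarrow> 'm) \<Rightarrow> bool" where
  "integral_curve c \<longleftrightarrow> continuous_on UNIV c \<and>
     (\<forall>t. \<forall>k\<in>\<A>. c t \<in> cdom k \<longrightarrow> ((\<lambda>s. cmap k (c s)) has_vector_derivative X k (cmap k (c t))) (at t))"

lemma integral_curve_flow: "integral_curve (\<lambda>t. \<phi> t x)"
  using flow by (simp add: flow_of_def integral_curve_def)

lemma flow_0: "\<phi> 0 x = x"
  using flow by (simp add: flow_of_def)

lemma integral_curve_shift:
  assumes "integral_curve c" shows "integral_curve (\<lambda>t. c (s + t))"
  unfolding integral_curve_def
proof (intro conjI allI ballI impI)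
  show "continuous_on UNIV (\<lambda>t. c (s + t))"
  proof (rule continuous_on_compose2[of UNIV c UNIV "\<lambda>t. s + t"])
    show "continuous_on UNIV c" using assms by (simp add: integral_curve_def)
  qed (auto intro: continuous_intros)
  fix t k assume "k \<in> \<A>" "c (s + t) \<in> cdom k"
  then have "((\<lambda>s. cmap k (c s)) has_vector_derivative X k (cmap k (c (s + t)))) (at (s + t))"
    using assms by (simp add: integral_curve_def)
  moreover have "((\<lambda>t. s + t) has_vector_derivative 1) (at t)"
    by (auto intro!: derivative_eq_intros)
  ultimately show "((\<lambda>t. cmap k (c (s + t))) has_vector_derivative X k (cmap k (c (s + t)))) (at t)"
    using vector_diff_chain_at[of "\<lambda>t. s + t" 1 t "\<lambda>s. cmap k (c s)"] by (simp add: o_def)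
qed

text \<open>Inside a chart two curves with a common point satisfy the same differential equation, so Gronwall's
inequality applies to their difference.\<close>

lemma integral_curve_locally_unique:
  assumes c: "integral_curve c1" "integral_curve c2" and eq: "c1 t0 = c2 t0"
  obtains d where "d > 0" "\<And>t. \<bar>t - t0\<bar> < d \<Longrightarrow> c1 t = c2 t"
proof -
  obtain k where k: "k \<in> \<A>" "c1 t0 \<in> cdom k" by (rule chart_at)
  obtain r where r: "r > 0" "cball (cmap k (c1 t0)) (2 * r) \<subseteq> cimage k" by (rule chart_ball[OF k])
  define Q where "Q = cball (cmap k (c1 t0)) (2 * r)"
  obtain L where L: "0 \<le> L" "\<And>z z'. z \<in> Q \<Longrightarrow> z' \<in> Q \<Longrightarrow> norm (X k z' - X k z) \<le> L * norm (z' - z)"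
    using smooth_on_lipschitz[OF X_smooth[OF k(1)], of Q] r(2) by (metis Q_def compact_cball convex_cball)
  define V where "V = cdom k \<inter> cmap k -` ball (cmap k (c1 t0)) (2 * r)"
  have V: "open V" unfolding V_def by (intro open_cmap_preimage k open_ball)
  have near: "\<exists>d>0. \<forall>t. \<bar>t - t0\<bar> < d \<longrightarrow> c t \<in> V" if "integral_curve c" "c t0 = c1 t0" for c
  proof -
    have "open (c -` V)" using that(1) V by (auto simp: integral_curve_def open_vimage)
    moreover have "t0 \<in> c -` V" using that(2) k r by (simp add: V_def)
    ultimately obtain d where "d > 0" "ball t0 d \<subseteq> c -` V" by (meson open_contains_ball)
    moreover have "t \<in> ball t0 d \<longleftrightarrow> \<bar>t - t0\<bar> < d" for t
      by (simp add: dist_real_def abs_minus_commute)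
    ultimately show ?thesis by blast
  qed
  obtain d1 where d1: "d1 > 0" "\<And>t. \<bar>t - t0\<bar> < d1 \<Longrightarrow> c1 t \<in> V" using near[OF c(1)] by blast
  obtain d2 where d2: "d2 > 0" "\<And>t. \<bar>t - t0\<bar> < d2 \<Longrightarrow> c2 t \<in> V" using near[OF c(2)] eq by metis
  show ?thesis
  proof (rule that[of "min d1 d2"])
    fix t assume t: "\<bar>t - t0\<bar> < min d1 d2"
    \<comment> \<open>Both time directions are treated at once: \<open>\<sigma>\<close> is the sign of \<open>t - t0\<close>.\<close>
    define \<sigma> :: real where "\<sigma> = (if t0 \<le> t then 1 else -1)"
    define h where "h = \<bar>t - t0\<bar>"
    have th: "t = t0 + \<sigma> * h" and \<sigma>: "\<bar>\<sigma>\<bar> = 1" by (auto simp: \<sigma>_def h_def)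
    have in_V: "c1 (t0 + \<sigma> * s) \<in> V" "c2 (t0 + \<sigma> * s) \<in> V" if "s \<in> {0..h}" for s
      using that t \<sigma> by (auto intro!: d1 d2 simp: abs_mult h_def)
    have der: "((\<lambda>s. cmap k (c (t0 + \<sigma> * s))) has_vector_derivative \<sigma> *\<^sub>R X k (cmap k (c (t0 + \<sigma> * s)))) (at s within {0..h})"
      if "integral_curve c" "c (t0 + \<sigma> * s) \<in> V" for c s
    proof -
      have "((\<lambda>s. cmap k (c s)) has_vector_derivative X k (cmap k (c (t0 + \<sigma> * s)))) (at (t0 + \<sigma> * s))"
        using that k by (simp add: integral_curve_def V_def)
      moreover have "((\<lambda>s. t0 + \<sigma> * s) has_vector_derivative \<sigma>) (at s)"
        by (auto intro!: derivative_eq_intros)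
      ultimately show ?thesis
        using vector_diff_chain_at[of "\<lambda>s. t0 + \<sigma> * s" \<sigma> s "\<lambda>s. cmap k (c s)"]
        by (simp add: o_def has_vector_derivative_at_within)
    qed
    let ?w = "\<lambda>s. cmap k (c1 (t0 + \<sigma> * s)) - cmap k (c2 (t0 + \<sigma> * s))"
    have "norm (?w h) \<le> exp ((2 * L + 1) * h) * (norm (?w 0) + 0)"
    proof (rule gronwall_norm)
      fix s assume s: "s \<in> {0..h}"
      show "(?w has_vector_derivative (\<sigma> *\<^sub>R X k (cmap k (c1 (t0 + \<sigma> * s))) - \<sigma> *\<^sub>R X k (cmap k (c2 (t0 + \<sigma> * s))))) (at s within {0..h})"
        by (intro has_vector_derivative_diff der c in_V s)
      have "norm (X k (cmap k (c1 (t0 + \<sigma> * s))) - X k (cmap k (c2 (t0 + \<sigma> * s)))) \<le> L * norm (?w s)"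
        using in_V[OF s] by (intro L) (auto simp: V_def Q_def)
      then show "norm (\<sigma> *\<^sub>R X k (cmap k (c1 (t0 + \<sigma> * s))) - \<sigma> *\<^sub>R X k (cmap k (c2 (t0 + \<sigma> * s)))) \<le> L * norm (?w s) + 0"
        using \<sigma> by (simp add: scaleR_diff_right[symmetric])
    qed (use L h_def in auto)
    then have "cmap k (c1 t) = cmap k (c2 t)" using eq th by simp
    moreover have "c1 t \<in> cdom k" "c2 t \<in> cdom k"
      using d1(2)[of t] d2(2)[of t] t by (auto simp: V_def)
    ultimately show "c1 t = c2 t" using cinv_cmap[OF k(1)] by metis
  qed (use d1 d2 in auto)
qed

text \<open>The set of times at which two curves agree is closed because the manifold is Hausdorff, and open by
local uniqueness.\<close>

lemma integral_curve_unique: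
  assumes c: "integral_curve c1" "integral_curve c2" and eq: "c1 0 = c2 0"
  shows "c1 t = c2 t"
proof -
  let ?E = "{t. c1 t = c2 t}"
  have "closed ?E" using c by (intro closed_Collect_eq) (auto simp: integral_curve_def)
  moreover have "open ?E"
    unfolding open_dist
  proof safe
    fix t0 assume "c1 t0 = c2 t0"
    then obtain d where "d > 0" "\<And>t. \<bar>t - t0\<bar> < d \<Longrightarrow> c1 t = c2 t"
      using integral_curve_locally_unique[OF c] by metis
    then show "\<exists>e>0. \<forall>y. dist y t0 < e \<longrightarrow> y \<in> ?E" by (auto simp: dist_real_def)
  qed
  ultimately have "?E = {} \<or> ?E = UNIV"
    by (intro iffD1[OF clopen] conjI)
  moreover have "0 \<in> ?E" using eq by simp
  ultimately have "t \<in> ?E" by auto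
  then show ?thesis by simp
qed

lemma flow_add: "\<phi> (s + t) x = \<phi> t (\<phi> s x)"
  by (rule integral_curve_unique[OF integral_curve_shift[OF integral_curve_flow] integral_curve_flow])
    (simp add: flow_0)

lemma flow_inverse: "\<phi> (- t) (\<phi> t x) = x" "\<phi> t (\<phi> (- t) x) = x"
  using flow_add[of t "-t" x] flow_add[of "-t" t x] by (simp_all add: flow_0)

lemma inj_flow: "inj (\<phi> t)"
  by (metis flow_inverse(1) injI)

lemma surj_flow: "surj (\<phi> t)"
  by (metis flow_inverse(2) surjI)

lemma flow_continuous_time: "continuous_on S (\<lambda>t. \<phi> t x)"
  using integral_curve_flow[of x] continuous_on_subset[of UNIV _ S] by (auto simp: integral_curve_def)

lemma flow_derivative:
  assumes "k \<in> \<A>" "\<phi> t x \<in> cdom k"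
  shows "((\<lambda>s. cmap k (\<phi> s x)) has_vector_derivative X k (cmap k (\<phi> t x))) (at t within T)"
  using integral_curve_flow[of x] assms by (auto simp: integral_curve_def intro: has_vector_derivative_at_within)

text \<open>An orbit that starts in the small ball cannot leave the chart before time \<open>h\<close>: up to its first exit
time from the ball of twice the radius it moves with speed at most \<open>M\<close>, hence by less than \<open>r\<close>. The
closed ball is needed as an intermediate set, since coordinate maps mean nothing outside the chart
and the exit point must still be seen in it.\<close>

lemma flow_stays_in_chart:
  assumes k: "k \<in> \<A>" and sub: "cball y0 (2 * r) \<subseteq> cimage k"
    and M: "\<And>z. z \<in> cball y0 (2 * r) \<Longrightarrow> norm (X k z) \<le> M" "0 \<le> M" "h * M < r"
    and x: "x \<in> cdom k" "cmap k x \<in> ball y0 r" and t: "t \<in> {0..h}"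
  shows "\<phi> t x \<in> cdom k \<and> cmap k (\<phi> t x) \<in> cball y0 (2 * r)"
proof -
  define V where "V = cdom k \<inter> cmap k -` ball y0 (2 * r)"
  define D where "D = cinv k ` cball y0 (2 * r)"
  have V: "open V" unfolding V_def by (intro open_cmap_preimage k open_ball)
  have "compact D" unfolding D_def
    by (rule compact_continuous_image[OF continuous_on_subset[OF cinv_continuous[OF k] sub]]) simp
  then have D: "closed D" by (rule compact_imp_closed)
  have D_eq: "D = cdom k \<inter> cmap k -` cball y0 (2 * r)" unfolding D_def by (rule cinv_image_eq[OF k sub])
  have "r > 0" using x(2) by (simp add: order.strict_trans1[OF zero_le_dist])
  have xV: "x \<in> V" using x \<open>r > 0\<close> by (simp add: V_def)
  have "\<phi> t x \<in> V"
  proof (rule ccontr)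
    assume out: "\<phi> t x \<notin> V"
    \<comment> \<open>The infimum of this closed set is the first exit time.\<close>
    define E where "E = {s \<in> {0..t}. \<phi> s x \<in> - V}"
    have "closed E" unfolding E_def
      using continuous_closed_preimage[OF flow_continuous_time, of "{0..t}" "- V" x] V
      by (simp add: closed_Compl vimage_def Int_def)
    moreover have "t \<in> E" using out t by (simp add: E_def)
    moreover have bdd: "bdd_below E" by (auto simp: E_def intro: bdd_belowI[of _ 0])
    ultimately have \<tau>: "Inf E \<in> E" by (intro closed_contains_Inf) auto
    define \<tau> where "\<tau> = Inf E"
    have before: "\<phi> s x \<in> V" if "s \<in> {0..<\<tau>}" for s
    proof (rule ccontr)
      assume "\<phi> s x \<notin> V"
      then have "s \<in> E" using that \<tau> by (auto simp: E_def \<tau>_def)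
      then show False using that cInf_lower[OF _ bdd] by (auto simp: \<tau>_def not_le[symmetric])
    qed
    have \<tau>h: "0 \<le> \<tau>" "\<tau> \<le> t" "\<phi> \<tau> x \<notin> V" using \<tau> by (auto simp: E_def \<tau>_def)
    have "\<tau> \<noteq> 0" using \<tau>h(3) xV by (auto simp: flow_0)
    then have \<tau>0: "0 < \<tau>" using \<tau>h by simp
    have "\<phi> s x \<in> D" if "s \<in> {0..\<tau>}" for s
    proof -
      have "(\<lambda>s. \<phi> s x) ` closure {0..<\<tau>} \<subseteq> D"
      proof (rule image_closure_subset[OF flow_continuous_time D])
        show "(\<lambda>s. \<phi> s x) ` {0..<\<tau>} \<subseteq> D"
          using before ball_subset_cball[of y0 "2 * r"] unfolding V_def D_eq by blast
      qed
      then show ?thesis using that \<tau>0 by auto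
    qed
    then have D': "\<phi> s x \<in> cdom k \<and> cmap k (\<phi> s x) \<in> cball y0 (2 * r)" if "s \<in> {0..\<tau>}" for s
      using that D_eq by blast
    have "norm (cmap k (\<phi> \<tau> x) - cmap k (\<phi> 0 x)) \<le> M * norm (\<tau> - 0)"
    proof (rule differentiable_bound[of "{0..\<tau>}" "\<lambda>s. cmap k (\<phi> s x)" "\<lambda>s v. v *\<^sub>R X k (cmap k (\<phi> s x))"])
      show "((\<lambda>s. cmap k (\<phi> s x)) has_derivative (\<lambda>v. v *\<^sub>R X k (cmap k (\<phi> s x)))) (at s within {0..\<tau>})"
        if "s \<in> {0..\<tau>}" for s
        using flow_derivative[OF k, of s x "{0..\<tau>}"] D'[OF that] by (simp add: has_vector_derivative_def)
      show "onorm (\<lambda>v. v *\<^sub>R X k (cmap k (\<phi> s x))) \<le> M" if "s \<in> {0..\<tau>}" for s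
      proof (rule onorm_le)
        have "norm (X k (cmap k (\<phi> s x))) \<le> M" using M(1) D'[OF that] by blast
        then show "norm (v *\<^sub>R X k (cmap k (\<phi> s x))) \<le> M * norm v" for v
          using mult_left_mono[of _ M "\<bar>v\<bar>"] by (simp add: mult.commute[of M])
      qed
    qed (use \<tau>0 in auto)
    also have "\<dots> \<le> h * M" using \<tau>h t M(2) mult_right_mono[of \<tau> h M] by (simp add: mult.commute)
    also have "\<dots> < r" by (rule M(3))
    finally have "dist (cmap k x) (cmap k (\<phi> \<tau> x)) < r" by (simp add: flow_0 dist_norm norm_minus_commute)
    then have "dist y0 (cmap k (\<phi> \<tau> x)) < 2 * r"
      using x(2) dist_triangle[of y0 "cmap k (\<phi> \<tau> x)" "cmap k x"] by auto
    then have "\<phi> \<tau> x \<in> V" using D'[of \<tau>] \<tau>0 by (simp add: V_def)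
    then show False using \<tau>h by simp
  qed
  then show ?thesis by (auto simp: V_def)
qed

end

section \<open>Hamiltonian systems in charts\<close>

locale hamiltonian_system = vector_field_flow \<A> X \<phi>
  for \<A> :: "('m::{t2_space, second_countable_topology}, 'e::euclidean_space) chart set"
    and X :: "('m, 'e) vfield" and \<phi> :: "real \<Rightarrow> 'm \<Rightarrow> 'm" +
  fixes \<eta> :: "('m, 'e) form1" and \<omega> :: "('m, 'e) form2" and H :: "'m \<Rightarrow> real"
  assumes compact_space: "compact (UNIV :: 'm set)"
    and conformal: "conformal_symplectic \<A> \<eta> \<omega>"
    and H: "smooth_function_on \<A> UNIV H"
    and hamiltonian: "hamiltonian_vector_field \<A> \<eta> \<omega> H X"
begin

lemma one_form: "one_form \<A> \<eta>" and two_form: "two_form \<A> \<omega>"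
  using conformal by (simp_all add: conformal_symplectic_def)

lemma H_smooth: "k \<in> \<A> \<Longrightarrow> smooth_on (cimage k) (H \<circ> cinv k)"
  using H by (simp add: smooth_function_on_def cimage_def)

lemma \<eta>_smooth: "k \<in> \<A> \<Longrightarrow> smooth_on (cimage k) (\<lambda>y. \<eta> k y v)"
  and \<eta>_linear: "k \<in> \<A> \<Longrightarrow> y \<in> cimage k \<Longrightarrow> linear (\<eta> k y)"
  and \<eta>_transition: "k \<in> \<A> \<Longrightarrow> l \<in> \<A> \<Longrightarrow> y \<in> overlap k l \<Longrightarrow>
    \<eta> k y v = \<eta> l (transition k l y) (frechet_derivative (transition k l) (at y) v)"
  using one_form unfolding one_form_def by blast+

lemma \<omega>_smooth: "k \<in> \<A> \<Longrightarrow> smooth_on (cimage k) (\<lambda>y. \<omega> k y u v)"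
  and \<omega>_bilinear: "k \<in> \<A> \<Longrightarrow> y \<in> cimage k \<Longrightarrow> bilinear (\<omega> k y)"
  and \<omega>_alternating: "k \<in> \<A> \<Longrightarrow> y \<in> cimage k \<Longrightarrow> \<omega> k y u u = 0"
  and \<omega>_transition: "k \<in> \<A> \<Longrightarrow> l \<in> \<A> \<Longrightarrow> y \<in> overlap k l \<Longrightarrow>
    \<omega> k y u v = \<omega> l (transition k l y) (frechet_derivative (transition k l) (at y) u)
      (frechet_derivative (transition k l) (at y) v)"
  using two_form unfolding two_form_def by blast+

lemma X_transition: "k \<in> \<A> \<Longrightarrow> l \<in> \<A> \<Longrightarrow> y \<in> overlap k l \<Longrightarrow>
    X l (transition k l y) = frechet_derivative (transition k l) (at y) (X k y)"
  using vector_field unfolding vector_field_def by blast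

lemma hamiltonian_chart:
  "k \<in> \<A> \<Longrightarrow> y \<in> cimage k \<Longrightarrow>
    \<omega> k y (X k y) v = frechet_derivative (H \<circ> cinv k) (at y) v - (H \<circ> cinv k) y * \<eta> k y v"
  using hamiltonian unfolding hamiltonian_vector_field_def twisted_deriv0_def ext_deriv0_def by auto

definition volume_density :: "('m, 'e) chart \<Rightarrow> 'e \<Rightarrow> real" where
  "volume_density k y = gram_density (\<omega> k y)"

lemma volume_density_pos: "k \<in> \<A> \<Longrightarrow> y \<in> cimage k \<Longrightarrow> 0 < volume_density k y"
  unfolding volume_density_def using conformal
  by (intro gram_density_pos \<omega>_bilinear) (auto simp: conformal_symplectic_def)

lemma volume_density_continuous: "k \<in> \<A> \<Longrightarrow> continuous_on (cimage k) (volume_density k)"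
  unfolding volume_density_def by (intro continuous_on_gram_density smooth_on_continuous \<omega>_smooth)

lemma volume_density_transition:
  assumes k: "k \<in> \<A>" "l \<in> \<A>" and y: "y \<in> overlap k l"
  shows "volume_density k y = \<bar>det (lin_matrix (frechet_derivative (transition k l) (at y)))\<bar> * volume_density l (transition k l y)"
proof -
  have "cinv k y \<in> cdom l" "y \<in> cimage k" using y by (auto simp: overlap_eq[OF k(1)])
  then have "transition k l y \<in> cimage l"
    using cmap_in_cimage[OF k(2)] by (simp add: transition_def)
  then have b: "bilinear (\<omega> l (transition k l y))" by (rule \<omega>_bilinear[OF k(2)])
  have lin: "linear (frechet_derivative (transition k l) (at y))"
    using transition_has_derivative[OF k y] by (rule has_derivative_linear)
  have "\<omega> k y = (\<lambda>u v. \<omega> l (transition k l y) (frechet_derivative (transition k l) (at y) u)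
      (frechet_derivative (transition k l) (at y) v))"
    using \<omega>_transition[OF k y] by (intro ext)
  then show ?thesis
    unfolding volume_density_def using gram_density_congruence[OF lin b] by simp
qed

abbreviation lee :: "'m \<Rightarrow> real" where
  "lee \<equiv> pairing \<A> \<eta> X"

abbreviation wind :: "real \<Rightarrow> 'm \<Rightarrow> real" where
  "wind \<equiv> winding \<A> \<eta> X \<phi>"

text \<open>The transformation laws of \<open>\<eta>\<close> and \<open>X\<close> cancel, so the chart selected in \<^const>\<open>pairing\<close> is irrelevant.\<close>

lemma lee_chart:
  assumes k: "k \<in> \<A>" and p: "p \<in> cdom k"
  shows "lee p = \<eta> k (cmap k p) (X k (cmap k p))"
proof -
  define l where "l = (SOME l. l \<in> \<A> \<and> p \<in> cdom l)"
  have l: "l \<in> \<A>" "p \<in> cdom l"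
    using someI[of "\<lambda>l. l \<in> \<A> \<and> p \<in> cdom l" k] k p by (auto simp: l_def)
  have y: "cmap k p \<in> overlap k l" using p l by (auto simp: overlap_def)
  have t: "transition k l (cmap k p) = cmap l p" by (simp add: transition_def cinv_cmap k p)
  have "\<eta> k (cmap k p) (X k (cmap k p)) = \<eta> l (cmap l p) (X l (cmap l p))"
    using \<eta>_transition[OF k l(1) y] X_transition[OF k l(1) y] t by simp
  then show ?thesis by (simp add: pairing_def l_def Let_def)
qed

lemma lee_in_chart_continuous: "k \<in> \<A> \<Longrightarrow> continuous_on (cimage k) (\<lambda>y. \<eta> k y (X k y))"
  by (rule continuous_on_linear_family)
    (auto intro: \<eta>_linear smooth_on_continuous \<eta>_smooth X_smooth)

lemma lee_continuous: "continuous_on UNIV lee"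
  unfolding continuous_on_eq_continuous_at[OF open_UNIV]
proof
  fix p
  obtain k where k: "k \<in> \<A>" "p \<in> cdom k" by (rule chart_at)
  have "continuous_on (cdom k) (\<lambda>p. \<eta> k (cmap k p) (X k (cmap k p)))"
    by (rule continuous_on_compose2[OF lee_in_chart_continuous[OF k(1)] cmap_continuous[OF k(1)]])
      (use cmap_in_cimage[OF k(1)] in auto)
  then have "continuous_on (cdom k) lee"
    by (rule continuous_on_eq) (simp add: lee_chart[OF k(1)])
  then show "isCont lee p"
    using continuous_on_eq_continuous_at[OF open_cdom[OF k(1)]] k(2) by blast
qed

lemma lee_flow_continuous: "continuous_on S (\<lambda>s. lee (\<phi> s x))"
  by (rule continuous_on_compose2[OF lee_continuous flow_continuous_time]) simp

lemma lee_flow_integrable: "(\<lambda>s. lee (\<phi> s x)) integrable_on {a..b}"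
  by (rule integrable_continuous_real[OF lee_flow_continuous])

lemma wind_nonneg: "0 \<le> t \<Longrightarrow> wind t x = integral {0..t} (\<lambda>s. lee (\<phi> s x))"
  by (simp add: winding_def)

lemma wind_0: "wind 0 x = 0"
  by (simp add: winding_def)

lemma wind_add:
  assumes "0 \<le> s" "0 \<le> t"
  shows "wind (s + t) x = wind s x + wind t (\<phi> s x)"
proof -
  have "integral {0..s + t} (\<lambda>s. lee (\<phi> s x)) = integral {0..s} (\<lambda>s. lee (\<phi> s x)) + integral {s..s + t} (\<lambda>s. lee (\<phi> s x))"
    using assms by (intro Henstock_Kurzweil_Integration.integral_combine[symmetric] lee_flow_integrable) auto
  also have "integral {s..s + t} (\<lambda>s. lee (\<phi> s x)) = integral {0..t} ((\<lambda>s. lee (\<phi> s x)) \<circ> (\<lambda>u. u + s))"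
    using integral_shift[of 0 s t "\<lambda>s. lee (\<phi> s x)"] lee_flow_continuous by (simp add: add.commute)
  also have "\<dots> = integral {0..t} (\<lambda>u. lee (\<phi> u (\<phi> s x)))"
    by (simp add: o_def add.commute[of _ s] flow_add)
  finally show ?thesis using assms by (simp add: wind_nonneg)
qed

lemma lie_derivative_chart:
  assumes k: "k \<in> \<A>" and y: "y \<in> cimage k"
  shows "frechet_derivative (\<lambda>z. \<omega> k z u v) (at y) (X k y) + \<omega> k y (frechet_derivative (X k) (at y) u) v
    + \<omega> k y u (frechet_derivative (X k) (at y) v) = \<eta> k y (X k y) * \<omega> k y u v"
proof (rule lie_derivative_hamiltonian[OF open_cimage[OF k] y X_smooth[OF k] H_smooth[OF k]
      \<eta>_smooth[OF k] \<omega>_smooth[OF k] \<omega>_bilinear[OF k] \<omega>_alternating[OF k] _ _ hamiltonian_chart[OF k]])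
  fix u v w
  have "ext_deriv1 \<eta> k y u v = 0" and tw: "twisted_deriv2 \<eta> \<omega> k y u v w = 0"
    using conformal k y unfolding conformal_symplectic_def by blast+
  then show "frechet_derivative (\<lambda>z. \<eta> k z v) (at y) u = frechet_derivative (\<lambda>z. \<eta> k z u) (at y) v"
    by (simp add: ext_deriv1_def)
  show "frechet_derivative (\<lambda>z. \<omega> k z v w) (at y) u - frechet_derivative (\<lambda>z. \<omega> k z u w) (at y) v
      + frechet_derivative (\<lambda>z. \<omega> k z u v) (at y) w
      = \<eta> k y u * \<omega> k y v w - \<eta> k y v * \<omega> k y u w + \<eta> k y w * \<omega> k y u v"
    using tw by (simp add: twisted_deriv2_def ext_deriv2_def wedge12_def)
qed

end

section \<open>Flow boxes\<close>

context hamiltonian_system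
begin

text \<open>The coordinate ball \<open>B\<close> is carried by the time-\<open>h\<close> flow into the domain of its own chart, and
there the flow multiplies the conformal volume by \<open>e\<^sup>n\<^sup>r\<close>, where \<open>2 n\<close> is the dimension and \<open>r\<close> the winding.\<close>

definition flow_box :: "('m, 'e) chart \<Rightarrow> 'e set \<Rightarrow> real \<Rightarrow> bool" where
  "flow_box k B h \<longleftrightarrow> k \<in> \<A> \<and> open B \<and> compact (closure B) \<and> closure B \<subseteq> cimage k \<and>
     \<phi> h ` cinv k ` B \<subseteq> cdom k \<and>
     continuous_on (cinv k ` B) (\<phi> h) \<and> continuous_on (cinv k ` B) (wind h) \<and>
     (\<forall>y\<in>B. \<exists>W. ((\<lambda>y. cmap k (\<phi> h (cinv k y))) has_derivative W) (at y) \<and>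
        exp (DIM('e) / 2 * wind h (cinv k y)) * volume_density k y
        = \<bar>det (lin_matrix W)\<bar> * volume_density k (cmap k (\<phi> h (cinv k y))))"

text \<open>The bound \<open>h0\<close> keeps the orbits in the chart and makes the linearised equation solvable by Picard
iteration. Both properties pass to smaller times, so that finitely many boxes can share one time
step. The volume factor comes from \<open>\<phi>\<^sub>h\<^sup>* \<omega> = e\<^sup>r \<omega>\<close> by taking Gram densities of both sides.\<close>

lemma flow_box_exists:
  assumes k: "k \<in> \<A>" and p: "p \<in> cdom k"
  obtains B h0 where "h0 > 0" "cmap k p \<in> B" "\<And>h. h \<in> {0..h0} \<Longrightarrow> flow_box k B h"
proof -
  obtain r where r: "r > 0" "cball (cmap k p) (2 * r) \<subseteq> cimage k" by (rule chart_ball[OF k p])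
  define y0 where "y0 = cmap k p"
  define Q where "Q = cball y0 (2 * r)"
  define B where "B = ball y0 r"
  define V where "V = cinv k ` B"
  have Q: "compact Q" "convex Q" "Q \<subseteq> cimage k" using r by (simp_all add: Q_def y0_def)
  have BQ: "B \<subseteq> Q" using r by (auto simp: B_def Q_def)
  note X = X_smooth[OF k]
  obtain L where L: "0 \<le> L" "\<And>z v. z \<in> Q \<Longrightarrow> norm (frechet_derivative (X k) (at z) v) \<le> L * norm v"
    "\<And>z z'. z \<in> Q \<Longrightarrow> z' \<in> Q \<Longrightarrow> norm (X k z' - X k z) \<le> L * norm (z' - z)"
    by (rule smooth_on_lipschitz[OF X Q]) blast
  obtain C where C: "0 \<le> C"
    "\<And>z z'. z \<in> Q \<Longrightarrow> z' \<in> Q \<Longrightarrow> norm (X k z' - X k z - frechet_derivative (X k) (at z) (z' - z)) \<le> C * (norm (z' - z))\<^sup>2"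
    by (rule smooth_on_taylor[OF X Q]) blast
  have "bounded (X k ` Q)"
    using compact_continuous_image[OF continuous_on_subset[OF smooth_on_continuous[OF X] Q(3)] Q(1)]
    by (rule compact_imp_bounded)
  then obtain M where M: "0 < M" "\<And>z. z \<in> Q \<Longrightarrow> norm (X k z) \<le> M" by (auto simp: bounded_pos)
  define h0 where "h0 = min (1 / (2 * (L + 1))) (r / (M + 1))"
  have h0: "h0 > 0" using L(1) M(1) r(1) by (simp add: h0_def)
  have DX_lin: "linear (frechet_derivative (X k) (at z))" if "z \<in> Q" for z
    using smooth_on_linear[OF X] Q(3) that by blast
  have DX_cont: "continuous_on Q (\<lambda>z. frechet_derivative (X k) (at z) v)" for v
    by (rule continuous_on_subset[OF smooth_on_continuous[OF smooth_on_directional[OF X]] Q(3)])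
  have "flow_box k B h" if hh: "h \<in> {0..h0}" for h
  proof -
    have h: "0 \<le> h" using hh by simp
    have hL: "h * L \<le> 1 / 2"
    proof -
      have "h * L \<le> 1 / (2 * (L + 1)) * L" using hh L(1) by (intro mult_right_mono) (auto simp: h0_def)
      also have "\<dots> \<le> 1 / 2" using L(1) by (simp add: field_simps)
      finally show ?thesis .
    qed
    have hM: "h * M < r"
    proof -
      have "h * M \<le> r / (M + 1) * M" using hh M(1) by (intro mult_right_mono) (auto simp: h0_def)
      also have "\<dots> < r" using M(1) r(1) by (simp add: field_simps)
      finally show ?thesis .
    qed
    define u where "u t y = cmap k (\<phi> t (cinv k y))" for t y
    have B_chart: "cinv k y \<in> cdom k" "cmap k (cinv k y) = y" if "y \<in> B" for y
      using that BQ Q(3) cinv_in_cdom[OF k] cmap_cinv[OF k] by blast+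
    have stay: "\<phi> t (cinv k y) \<in> cdom k" "u t y \<in> Q" if "y \<in> B" "t \<in> {0..h}" for t y
      using flow_stays_in_chart[OF k, of y0 r M h "cinv k y" t] r M hM B_chart[OF that(1)] that
      by (auto simp: Q_def B_def u_def y0_def)
    have u0: "u 0 y = y" if "y \<in> B" for y using B_chart[OF that] by (simp add: u_def flow_0)
    have du: "((\<lambda>t. u t y) has_vector_derivative X k (u t y)) (at t within {0..h})" if "y \<in> B" "t \<in> {0..h}" for y t
      unfolding u_def by (rule flow_derivative[OF k stay(1)[OF that]])
    have V_eq: "V = cdom k \<inter> cmap k -` B"
      unfolding V_def using BQ Q(3) by (intro cinv_image_eq[OF k]) auto
    have u_joint: "continuous_on (B \<times> {0..h}) (\<lambda>(y, s). u s y)"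
    proof (rule continuous_on_Times_lipschitz)
      show "dist (u s y) (u s y') \<le> exp ((2 * L + 1) * h) * dist y y'" if "s \<in> {0..h}" "y \<in> B" "y' \<in> B" for s y y'
        using flow_lipschitz[of Q "X k" L B h u y' y s, OF L(3) stay(2) u0 du L(1)] that by (simp add: dist_norm)
      show "continuous_on {0..h} (\<lambda>s. u s y)" if "y \<in> B" for y
        by (rule continuous_on_vector_derivative[OF du[OF that]])
    qed
    have "continuous_on (V \<times> {0..h}) (\<lambda>q. (cmap k (fst q), snd q))"
      by (intro continuous_on_Pair continuous_on_compose2[OF cmap_continuous[OF k]] continuous_on_fst
          continuous_on_snd continuous_on_id) (auto simp: V_eq)
    moreover have "(\<lambda>q. (cmap k (fst q), snd q)) ` (V \<times> {0..h}) \<subseteq> B \<times> {0..h}"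
      by (auto simp: V_eq)
    ultimately have "continuous_on (V \<times> {0..h}) (\<lambda>q. u (snd q) (cmap k (fst q)))"
      using continuous_on_compose2[OF u_joint, of "V \<times> {0..h}" "\<lambda>q. (cmap k (fst q), snd q)"] by simp
    then have "continuous_on (V \<times> {0..h}) (\<lambda>q. cinv k (u (snd q) (cmap k (fst q))))"
      by (rule continuous_on_compose2[OF cinv_continuous[OF k]]) (use stay Q(3) V_eq in auto)
    then have joint: "continuous_on (V \<times> {0..h}) (\<lambda>q. \<phi> (snd q) (fst q))"
    proof (rule continuous_on_eq)
      fix q assume q: "q \<in> V \<times> {0..h}"
      then have "fst q \<in> cdom k" "cmap k (fst q) \<in> B" "snd q \<in> {0..h}" by (auto simp: V_eq)
      then show "cinv k (u (snd q) (cmap k (fst q))) = \<phi> (snd q) (fst q)"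
        using stay(1)[of "cmap k (fst q)" "snd q"] by (simp add: u_def cinv_cmap[OF k])
    qed
    have "continuous_on V (\<lambda>x. integral (cbox 0 h) (\<lambda>s. lee (\<phi> s x)))"
      by (rule integral_continuous_on_param)
        (use continuous_on_compose2[OF lee_continuous joint] in \<open>simp add: split_beta\<close>)
    then have wind_cont: "continuous_on V (wind h)"
      using wind_nonneg[OF h] by (simp add: cbox_interval)
    have flow_cont: "continuous_on V (\<phi> h)"
      by (rule continuous_on_compose2[OF joint, of _ "\<lambda>x. (x, h)", simplified]) (auto intro!: continuous_intros simp: h)
    have jac: "\<exists>W. (u h has_derivative W) (at y) \<and>
        exp (DIM('e) / 2 * wind h (cinv k y)) * volume_density k y = \<bar>det (lin_matrix W)\<bar> * volume_density k (u h y)"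
      if y: "y \<in> B" for y
    proof -
      obtain W where W: "\<And>v. W v 0 = v"
        "\<And>t v. t \<in> {0..h} \<Longrightarrow> (W v has_vector_derivative frechet_derivative (X k) (at (u t y)) (W v t)) (at t within {0..h})"
        "\<And>t. t \<in> {0..h} \<Longrightarrow> (u t has_derivative (\<lambda>v. W v t)) (at y)"
        by (rule flow_has_derivative[of Q "\<lambda>z. frechet_derivative (X k) (at z)" L "X k" C B h u y,
              OF DX_lin L(2) DX_cont L(3) C(2) stay(2) u0 du h L(1) C(1) hL _ y]) (auto simp: B_def)
      have in_im: "u t y \<in> cimage k" if "t \<in> {0..h}" for t using stay(2)[OF y that] Q(3) by blast
      have hI: "h \<in> {0..h}" using h by simp
      have lee_u: "\<eta> k (u s y) (X k (u s y)) = lee (\<phi> s (cinv k y))" if "s \<in> {0..h}" for s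
        using lee_chart[OF k stay(1)[OF y that]] by (simp add: u_def)
      have int: "integral {0..h} (\<lambda>s. \<eta> k (u s y) (X k (u s y))) = wind h (cinv k y)"
        unfolding wind_nonneg[OF h] by (rule integral_cong) (rule lee_u)
      have form: "\<omega> k (u h y) (W a h) (W b h) = exp (wind h (cinv k y)) * \<omega> k y a b" for a b
        using form_along_linearised_flow[of "cimage k" "\<omega> k" "X k" "\<lambda>z. frechet_derivative (X k) (at z)"
            "\<lambda>z. \<eta> k z (X k z)" h "\<lambda>t. u t y" "W a" "W b" h, OF open_cimage[OF k] \<omega>_bilinear[OF k]
            \<omega>_smooth[OF k] lie_derivative_chart[OF k] in_im du[OF y] W(2) W(2) lee_in_chart_continuous[OF k] hI]
        by (simp add: int W(1) u0[OF y])
      have lin: "linear (\<lambda>v. W v h)" using W(3)[OF hI] by (rule has_derivative_linear)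
      have "\<bar>det (lin_matrix (\<lambda>v. W v h))\<bar> * volume_density k (u h y) = gram_density (\<lambda>a b. \<omega> k (u h y) (W a h) (W b h))"
        unfolding volume_density_def
        by (rule gram_density_congruence[OF lin \<omega>_bilinear[OF k in_im[OF hI]], symmetric])
      also have "\<dots> = exp (DIM('e) / 2 * wind h (cinv k y)) * volume_density k y"
        unfolding form volume_density_def by (rule gram_density_scale)
      finally show ?thesis using W(3)[OF hI] by metis
    qed
    have clB: "closure B \<subseteq> Q" unfolding B_def Q_def using r(1) by (auto simp: closure_ball)
    show ?thesis
      unfolding flow_box_def u_def[symmetric] V_def[symmetric]
    proof (intro conjI ballI)
      show "compact (closure B)" by (simp add: B_def)
      show "closure B \<subseteq> cimage k" using clB Q(3) by blast
      show "\<phi> h ` V \<subseteq> cdom k" using stay(1) h by (auto simp: V_def)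
      show "\<exists>W. (u h has_derivative W) (at y) \<and>
        exp (DIM('e) / 2 * wind h (cinv k y)) * volume_density k y = \<bar>det (lin_matrix W)\<bar> * volume_density k (u h y)"
        if "y \<in> B" for y by (rule jac[OF that])
    qed (use k wind_cont flow_cont in \<open>auto simp: B_def\<close>)
  qed
  then show ?thesis using that[OF h0, of B] r(1) by (simp add: B_def y0_def)
qed

end

section \<open>Transport of the conformal volume\<close>

text \<open>By compactness finitely many flow boxes with a common time step cover the manifold. Only
multiples of this time step are used to compare volumes; the winding at the times in between is
controlled by \<open>winding_limit_from_steps\<close>.\<close>

locale boxed_system = hamiltonian_system \<A> X \<phi> \<eta> \<omega> H
  for \<A> :: "('m::{t2_space, second_countable_topology}, 'e::euclidean_space) chart set"
    and X :: "('m, 'e) vfield" and \<phi> :: "real \<Rightarrow> 'm \<Rightarrow> 'm"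
    and \<eta> :: "('m, 'e) form1" and \<omega> :: "('m, 'e) form2" and H :: "'m \<Rightarrow> real" +
  fixes h :: real and N :: nat and K :: "nat \<Rightarrow> ('m, 'e) chart" and B :: "nat \<Rightarrow> 'e set"
  assumes h_pos: "0 < h" and box: "\<And>i. i < N \<Longrightarrow> flow_box (K i) (B i) h"
    and cover: "(\<Union>i<N. cinv (K i) ` B i) = UNIV"
begin

definition patch :: "nat \<Rightarrow> 'm set" where
  "patch i = cinv (K i) ` B i"

text \<open>The pieces partition the manifold into Borel sets, each contained in one chart.\<close>

definition piece :: "nat \<Rightarrow> 'm set" where
  "piece i = patch i - (\<Union>j<i. patch j)"

lemma K_chart: "i < N \<Longrightarrow> K i \<in> \<A>" and B_open: "i < N \<Longrightarrow> open (B i)"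
  and B_compact: "i < N \<Longrightarrow> compact (closure (B i))" and B_closure: "i < N \<Longrightarrow> closure (B i) \<subseteq> cimage (K i)"
  and B_sub: "i < N \<Longrightarrow> B i \<subseteq> cimage (K i)"
proof -
  show 1: "i < N \<Longrightarrow> K i \<in> \<A>" "i < N \<Longrightarrow> open (B i)" "i < N \<Longrightarrow> compact (closure (B i))" "i < N \<Longrightarrow> closure (B i) \<subseteq> cimage (K i)"
    using box[of i] unfolding flow_box_def by blast+
  show "i < N \<Longrightarrow> B i \<subseteq> cimage (K i)"
    using 1(4) closure_subset[of "B i"] by blast
qed

lemma patch_eq: "i < N \<Longrightarrow> patch i = cdom (K i) \<inter> cmap (K i) -` B i"
  unfolding patch_def by (intro cinv_image_eq K_chart B_sub)

lemma open_patch: "i < N \<Longrightarrow> open (patch i)"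
  by (simp add: patch_eq open_cmap_preimage K_chart B_open)

lemma flow_patch: "i < N \<Longrightarrow> \<phi> h ` patch i \<subseteq> cdom (K i)"
  and flow_continuous_patch: "i < N \<Longrightarrow> continuous_on (patch i) (\<phi> h)"
  and wind_continuous_patch: "i < N \<Longrightarrow> continuous_on (patch i) (wind h)"
  using box unfolding flow_box_def patch_def by blast+

lemma patch_cover: "\<exists>i<N. x \<in> patch i"
  using cover unfolding patch_def by blast

lemma piece_sub: "piece i \<subseteq> patch i"
  by (auto simp: piece_def)

lemma piece_cover: "\<exists>i<N. x \<in> piece i"
proof -
  have ex: "\<exists>i. i < N \<and> x \<in> patch i" using patch_cover by blast
  define i where "i = (LEAST i. i < N \<and> x \<in> patch i)"
  have i: "i < N \<and> x \<in> patch i" unfolding i_def by (rule LeastI_ex[OF ex])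
  moreover have "x \<notin> patch j" if "j < i" for j
    using not_less_Least[of j "\<lambda>i. i < N \<and> x \<in> patch i"] that i by (auto simp: i_def)
  ultimately show ?thesis by (auto simp: piece_def)
qed

lemma piece_disjoint: "x \<in> piece i \<Longrightarrow> x \<in> piece j \<Longrightarrow> i = j"
  unfolding piece_def by (metis DiffD1 DiffD2 UN_I lessThan_iff linorder_neqE_nat)

lemma piece_borel: "i < N \<Longrightarrow> piece i \<in> sets borel"
  unfolding piece_def by (intro sets.Diff borel_open open_patch open_UN ballI) auto

lemma continuous_if_patches:
  assumes "\<And>i. i < N \<Longrightarrow> continuous_on (patch i) f"
  shows "continuous_on UNIV f"
  unfolding continuous_on_eq_continuous_at[OF open_UNIV]
proof
  fix x
  obtain i where i: "i < N" "x \<in> patch i" using patch_cover by blast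
  then show "isCont f x"
    using assms[OF i(1)] continuous_on_eq_continuous_at[OF open_patch[OF i(1)]] by blast
qed

lemma flow_step_continuous: "continuous_on UNIV (\<phi> h)"
  by (rule continuous_if_patches[OF flow_continuous_patch])

lemma wind_step_continuous: "continuous_on UNIV (wind h)"
  by (rule continuous_if_patches[OF wind_continuous_patch])

abbreviation time :: "nat \<Rightarrow> real" where
  "time n \<equiv> real n * h"

lemma time_Suc: "time (Suc n) = h + time n"
  by (simp add: algebra_simps)

lemma flow_Suc: "\<phi> (time (Suc n)) x = \<phi> (time n) (\<phi> h x)"
  unfolding time_Suc by (rule flow_add)

lemma wind_Suc: "wind (time (Suc n)) x = wind h x + wind (time n) (\<phi> h x)"
  unfolding time_Suc using h_pos by (intro wind_add) auto

lemma flow_continuous: "continuous_on UNIV (\<phi> (time n))"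
proof (induction n)
  case (Suc n)
  have "continuous_on UNIV (\<lambda>x. \<phi> (time n) (\<phi> h x))"
    by (rule continuous_on_compose2[OF Suc flow_step_continuous]) simp
  then show ?case by (simp add: flow_Suc[abs_def] del: of_nat_Suc)
qed (simp add: flow_0)

lemma wind_continuous: "continuous_on UNIV (wind (time n))"
proof (induction n)
  case (Suc n)
  have "continuous_on UNIV (\<lambda>x. wind h x + wind (time n) (\<phi> h x))"
    by (intro continuous_on_add wind_step_continuous continuous_on_compose2[OF Suc flow_step_continuous]) simp
  then show ?case by (simp add: wind_Suc[abs_def] del: of_nat_Suc)
qed (simp add: wind_0)

lemma flow_inverse_continuous: "continuous_on UNIV (\<phi> (- time n))"
  using continuous_on_inv[OF flow_continuous[of n] compact_space, of "\<phi> (- time n)"] surj_flow[of "time n"]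
  by (simp add: flow_inverse)

lemma flow_image_eq: "\<phi> t ` Q = \<phi> (- t) -` Q"
  using flow_inverse by (auto simp: image_iff) (metis flow_inverse(2))

lemma flow_image_borel:
  assumes "Q \<in> sets borel" shows "\<phi> (time n) ` Q \<in> sets borel"
  using measurable_sets[OF borel_measurable_continuous_onI[OF flow_inverse_continuous, of n] assms]
  by (simp add: flow_image_eq)

lemma flow_measurable: "\<phi> (time n) \<in> borel_measurable borel"
  by (rule borel_measurable_continuous_onI[OF flow_continuous])

lemma wind_measurable: "wind (time n) \<in> borel_measurable borel"
  by (rule borel_measurable_continuous_onI[OF wind_continuous])

lemma flow_step_image_borel: "Q \<in> sets borel \<Longrightarrow> \<phi> h ` Q \<in> sets borel"
  using flow_image_borel[of Q 1] by simp

lemma cinv_preimage_borel: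
  assumes "k \<in> \<A>" "Q \<in> sets borel" shows "cimage k \<inter> cinv k -` Q \<in> sets borel"
proof -
  have "cinv k \<in> measurable (restrict_space borel (cimage k)) borel"
    by (rule borel_measurable_continuous_on_restrict[OF cinv_continuous[OF assms(1)]])
  from measurable_sets[OF this assms(2)]
  have "cinv k -` Q \<inter> cimage k \<in> sets (restrict_space borel (cimage k))"
    by (simp add: space_restrict_space)
  then show ?thesis
    using open_cimage[OF assms(1)] by (simp add: sets_restrict_space_iff Int_commute)
qed

lemma chart_image_borel:
  assumes "k \<in> \<A>" "Q \<in> sets borel" "Q \<subseteq> cdom k" shows "cmap k ` Q \<in> sets borel"
  using cmap_image_eq[OF assms(1), of Q] cinv_preimage_borel[OF assms(1,2)] assms(3)
  by (simp add: Int_absorb1)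

definition local_density :: "('m, 'e) chart \<Rightarrow> ('m \<Rightarrow> real) \<Rightarrow> 'e \<Rightarrow> real" where
  "local_density k f y = (if y \<in> cimage k then f (cinv k y) * volume_density k y else 0)"

lemma local_density_measurable:
  assumes k: "k \<in> \<A>" and f: "f \<in> borel_measurable borel"
  shows "local_density k f \<in> borel_measurable borel"
proof -
  have "cinv k \<in> measurable (restrict_space borel (cimage k)) borel"
    by (rule borel_measurable_continuous_on_restrict[OF cinv_continuous[OF k]])
  then have "(\<lambda>y. f (cinv k y)) \<in> borel_measurable (restrict_space borel (cimage k))"
    using f by (rule measurable_compose)
  moreover have "volume_density k \<in> borel_measurable (restrict_space borel (cimage k))"
    by (rule borel_measurable_continuous_on_restrict[OF volume_density_continuous[OF k]])
  ultimately have "(\<lambda>y. f (cinv k y) * volume_density k y) \<in> borel_measurable (restrict_space borel (cimage k))"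
    by (rule borel_measurable_times)
  then have "(\<lambda>y. indicator (cimage k) y *\<^sub>R (f (cinv k y) * volume_density k y)) \<in> borel_measurable borel"
    using open_cimage[OF k] by (subst (asm) borel_measurable_restrict_space_iff) auto
  then show ?thesis
    by (rule measurable_cong[THEN iffD1, rotated]) (simp add: local_density_def)
qed

lemma volume_density_nonneg: "0 \<le> volume_density k y"
  by (simp add: volume_density_def gram_density_nonneg)

lemma local_density_nonneg: "(\<And>x. 0 \<le> f x) \<Longrightarrow> 0 \<le> local_density k f y"
  by (simp add: local_density_def volume_density_nonneg)

text \<open>For \<open>Q\<close> inside the domain of the chart, the integral of \<open>f\<close> over \<open>Q\<close> with respect to the volume \<open>\<bar>\<omega>\<^sup>n\<bar> / n!\<close>.\<close>

definition chart_integral :: "('m, 'e) chart \<Rightarrow> 'm set \<Rightarrow> ('m \<Rightarrow> real) \<Rightarrow> ennreal" where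
  "chart_integral k Q f = (\<integral>\<^sup>+y\<in>cmap k ` Q. ennreal (local_density k f y) \<partial>lborel)"

lemma chart_integral_change_chart:
  assumes k: "k \<in> \<A>" "l \<in> \<A>" and Q: "Q \<in> sets borel" "Q \<subseteq> cdom k" "Q \<subseteq> cdom l"
    and f: "f \<in> borel_measurable borel" "\<And>x. 0 \<le> f x"
  shows "chart_integral k Q f = chart_integral l Q f"
proof -
  have im: "transition k l ` cmap k ` Q = cmap l ` Q"
    using Q(2) cinv_cmap[OF k(1)] by (force simp: transition_def image_iff)
  have sub: "cmap k ` Q \<subseteq> overlap k l" using Q by (auto simp: overlap_def)
  have "(\<integral>\<^sup>+y\<in>cmap k ` Q. ennreal (local_density k f y) \<partial>lborel)
    = (\<integral>\<^sup>+y\<in>transition k l ` cmap k ` Q. ennreal (local_density l f y) \<partial>lborel)"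
  proof (rule nn_integral_change_of_variables)
    show "cmap k ` Q \<in> sets borel" by (rule chart_image_borel[OF k(1) Q(1,2)])
    show "transition k l ` cmap k ` Q \<in> sets borel" unfolding im by (rule chart_image_borel[OF k(2) Q(1,3)])
    show "inj_on (transition k l) (cmap k ` Q)" by (rule inj_on_subset[OF transition_inj[OF k] sub])
    fix y assume "y \<in> cmap k ` Q"
    then have y: "y \<in> overlap k l" using sub by blast
    show "(transition k l has_derivative frechet_derivative (transition k l) (at y)) (at y within cmap k ` Q)"
      by (rule has_derivative_at_withinI[OF transition_has_derivative[OF k y]])
    have c: "y \<in> cimage k" "cinv k y \<in> cdom l" using y by (auto simp: overlap_eq[OF k(1)])
    have "transition k l y \<in> cimage l" "cinv l (transition k l y) = cinv k y"
      using cmap_in_cimage[OF k(2) c(2)] cinv_cmap[OF k(2) c(2)] by (simp_all add: transition_def)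
    then show "local_density k f y = \<bar>det (lin_matrix (frechet_derivative (transition k l) (at y)))\<bar> * local_density l f (transition k l y)"
      using c volume_density_transition[OF k y] by (simp add: local_density_def)
  qed (use local_density_measurable k f local_density_nonneg in auto)
  then show ?thesis by (simp add: chart_integral_def im)
qed

text \<open>The Jacobian of the flow with respect to the conformal volume, \<open>e\<^sup>n\<^sup>r\<close> in dimension \<open>2 n\<close>.\<close>

definition jac :: "real \<Rightarrow> 'm \<Rightarrow> real" where
  "jac t x = exp (DIM('e) / 2 * wind t x)"

lemma jac_Suc: "jac (time (Suc n)) x = jac h x * jac (time n) (\<phi> h x)"
  by (simp add: jac_def wind_Suc distrib_left exp_add del: of_nat_Suc)

lemma jac_measurable: "jac (time n) \<in> borel_measurable borel"
  unfolding jac_def using wind_measurable by measurable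

lemma jac_0: "jac 0 x = 1" by (simp add: jac_def wind_0)

lemma jac_pos: "0 < jac t x" by (simp add: jac_def)

text \<open>On a single box the transformation formula for the time-\<open>h\<close> map is the change of variables
theorem; the box is designed so that the image is measured in the same chart.\<close>

lemma chart_integral_flow:
  assumes i: "i < N" and Q: "Q \<in> sets borel" "Q \<subseteq> patch i"
    and f: "f \<in> borel_measurable borel" "\<And>x. 0 \<le> f x"
  shows "chart_integral (K i) Q (\<lambda>x. f (\<phi> h x) * jac h x) = chart_integral (K i) (\<phi> h ` Q) f"
proof -
  note k = K_chart[OF i]
  let ?u = "\<lambda>y. cmap (K i) (\<phi> h (cinv (K i) y))"
  have Qd: "Q \<subseteq> cdom (K i)" using Q(2) patch_eq[OF i] by blast
  have \<phi>Qd: "\<phi> h ` Q \<subseteq> cdom (K i)" using Q(2) flow_patch[OF i] by blast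
  have QB: "cmap (K i) ` Q \<subseteq> B i" using Q(2) patch_eq[OF i] by blast
  have im: "?u ` cmap (K i) ` Q = cmap (K i) ` \<phi> h ` Q"
    using Qd cinv_cmap[OF k] by (force simp: image_iff)
  have "\<forall>y\<in>B i. \<exists>W. (?u has_derivative W) (at y) \<and>
        jac h (cinv (K i) y) * volume_density (K i) y = \<bar>det (lin_matrix W)\<bar> * volume_density (K i) (?u y)"
    using box[OF i] unfolding flow_box_def jac_def by blast
  then obtain W where W: "\<And>y. y \<in> B i \<Longrightarrow> (?u has_derivative W y) (at y)"
    "\<And>y. y \<in> B i \<Longrightarrow> jac h (cinv (K i) y) * volume_density (K i) y = \<bar>det (lin_matrix (W y))\<bar> * volume_density (K i) (?u y)"
    by metis
  have "(\<integral>\<^sup>+y\<in>cmap (K i) ` Q. ennreal (local_density (K i) (\<lambda>x. f (\<phi> h x) * jac h x) y) \<partial>lborel)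
    = (\<integral>\<^sup>+y\<in>?u ` cmap (K i) ` Q. ennreal (local_density (K i) f y) \<partial>lborel)"
  proof (rule nn_integral_change_of_variables)
    show "cmap (K i) ` Q \<in> sets borel" by (rule chart_image_borel[OF k Q(1) Qd])
    show "?u ` cmap (K i) ` Q \<in> sets borel"
      unfolding im by (rule chart_image_borel[OF k flow_step_image_borel[OF Q(1)] \<phi>Qd])
    show "inj_on ?u (cmap (K i) ` Q)"
    proof (rule inj_onI)
      fix y z assume "y \<in> cmap (K i) ` Q" "z \<in> cmap (K i) ` Q" and eq: "?u y = ?u z"
      then obtain p q where pq: "p \<in> Q" "q \<in> Q" "y = cmap (K i) p" "z = cmap (K i) q" by blast
      then have inv: "cinv (K i) y = p" "cinv (K i) z = q" using Qd cinv_cmap[OF k] by auto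
      have "\<phi> h p \<in> cdom (K i)" "\<phi> h q \<in> cdom (K i)" using pq \<phi>Qd by auto
      then have "\<phi> h p = \<phi> h q" using eq inv cinv_cmap[OF k] by metis
      then have "p = q" using inj_flow by (simp add: inj_eq)
      then show "y = z" using pq by simp
    qed
    fix y assume y: "y \<in> cmap (K i) ` Q"
    then have yB: "y \<in> B i" using QB by blast
    show "(?u has_derivative W y) (at y within cmap (K i) ` Q)"
      by (rule has_derivative_at_withinI[OF W(1)[OF yB]])
    obtain p where p: "p \<in> Q" "y = cmap (K i) p" using y by blast
    have inv: "cinv (K i) y = p" using p Qd cinv_cmap[OF k] by auto
    have \<phi>p: "\<phi> h p \<in> cdom (K i)" using p \<phi>Qd by auto
    have "?u y \<in> cimage (K i)" "cinv (K i) (?u y) = \<phi> h p" "y \<in> cimage (K i)"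
      using \<phi>p cmap_in_cimage[OF k] cinv_cmap[OF k] inv yB B_sub[OF i] by auto
    then show "local_density (K i) (\<lambda>x. f (\<phi> h x) * jac h x) y
      = \<bar>det (lin_matrix (W y))\<bar> * local_density (K i) f (?u y)"
      using W(2)[OF yB] by (simp add: local_density_def inv mult_ac)
  next
    have "(\<lambda>x. f (\<phi> h x) * jac h x) \<in> borel_measurable borel"
      using flow_measurable[of 1] jac_measurable[of 1] f(1) by simp
    then show "local_density (K i) (\<lambda>x. f (\<phi> h x) * jac h x) \<in> borel_measurable borel"
      by (rule local_density_measurable[OF k])
  qed (use local_density_measurable[OF k f(1)] local_density_nonneg f in auto)
  then show ?thesis by (simp add: chart_integral_def im)
qed

lemma chart_integral_sum:
  fixes n :: nat
  assumes k: "k \<in> \<A>" and Q: "\<And>i. i < n \<Longrightarrow> Q i \<in> sets borel" "\<And>i. i < n \<Longrightarrow> Q i \<subseteq> cdom k"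
    and disj: "\<And>i j x. i < n \<Longrightarrow> j < n \<Longrightarrow> x \<in> Q i \<Longrightarrow> x \<in> Q j \<Longrightarrow> i = j"
    and f: "f \<in> borel_measurable borel"
  shows "(\<Sum>i<n. chart_integral k (Q i) f) = chart_integral k (\<Union>i<n. Q i) f"
proof -
  \<comment> \<open>The chart is injective, so the coordinate images are disjoint as well.\<close>
  have ind: "(\<Sum>i<n. indicator (cmap k ` Q i) y) = (indicator (cmap k ` (\<Union>i<n. Q i)) y :: ennreal)" for y
  proof (cases "y \<in> cmap k ` (\<Union>i<n. Q i)")
    case True
    then obtain i p where i: "i < n" "p \<in> Q i" "y = cmap k p" by blast
    have "y \<in> cmap k ` Q j \<longleftrightarrow> j = i" if "j < n" for j
    proof
      assume "y \<in> cmap k ` Q j"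
      then obtain q where q: "q \<in> Q j" "y = cmap k q" by blast
      then have "p = q" using i Q(2) that cinv_cmap[OF k] by (metis subsetD)
      then show "j = i" using disj[OF that i(1)] i q by blast
    qed (use i in auto)
    then have "(\<Sum>j<n. indicator (cmap k ` Q j) y) = (\<Sum>j<n. if j = i then 1 else (0::ennreal))"
      by (intro sum.cong) (auto simp: indicator_def)
    also have "\<dots> = 1" using i(1) by (subst sum.delta) auto
    finally show ?thesis using True by simp
  next
    case False
    then show ?thesis by (auto simp: indicator_def intro!: sum.neutral)
  qed
  have meas: "(\<lambda>y. ennreal (local_density k f y) * indicator (cmap k ` Q i) y) \<in> borel_measurable lborel" if "i < n" for i
    using local_density_measurable[OF k f] chart_image_borel[OF k Q(1)[OF that] Q(2)[OF that]] by measurable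
  have "(\<Sum>i<n. chart_integral k (Q i) f)
    = (\<integral>\<^sup>+y. (\<Sum>i<n. ennreal (local_density k f y) * indicator (cmap k ` Q i) y) \<partial>lborel)"
    unfolding chart_integral_def by (rule nn_integral_sum[symmetric]) (use meas in auto)
  also have "\<dots> = chart_integral k (\<Union>i<n. Q i) f"
    unfolding chart_integral_def by (simp add: sum_distrib_left[symmetric] ind)
  finally show ?thesis .
qed

definition vol_on :: "'m set \<Rightarrow> ('m \<Rightarrow> real) \<Rightarrow> ennreal" where
  "vol_on Q f = (\<Sum>i<N. chart_integral (K i) (piece i \<inter> Q) f)"

abbreviation vol :: "('m \<Rightarrow> real) \<Rightarrow> ennreal" where
  "vol \<equiv> vol_on UNIV"

lemma piece_in_cdom: "i < N \<Longrightarrow> piece i \<subseteq> cdom (K i)"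
  using piece_sub patch_eq by blast

lemma chart_integral_eq_vol_on:
  assumes k: "k \<in> \<A>" and Q: "Q \<in> sets borel" "Q \<subseteq> cdom k"
    and f: "f \<in> borel_measurable borel" "\<And>x. 0 \<le> f x"
  shows "chart_integral k Q f = vol_on Q f"
proof -
  have "Q = (\<Union>i<N. piece i \<inter> Q)" using piece_cover by blast
  then have "chart_integral k Q f = chart_integral k (\<Union>i<N. piece i \<inter> Q) f" by simp
  also have "\<dots> = (\<Sum>i<N. chart_integral k (piece i \<inter> Q) f)"
    by (rule chart_integral_sum[symmetric, OF k])
      (use Q f piece_borel piece_disjoint in auto)
  also have "\<dots> = vol_on Q f"
    unfolding vol_on_def
    by (intro sum.cong chart_integral_change_chart k K_chart f)
      (use Q piece_borel piece_in_cdom in auto)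
  finally show ?thesis .
qed

lemma vol_on_sum:
  fixes n :: nat
  assumes Q: "\<And>i. i < n \<Longrightarrow> Q i \<in> sets borel"
    and disj: "\<And>i j x. i < n \<Longrightarrow> j < n \<Longrightarrow> x \<in> Q i \<Longrightarrow> x \<in> Q j \<Longrightarrow> i = j"
    and f: "f \<in> borel_measurable borel"
  shows "(\<Sum>i<n. vol_on (Q i) f) = vol_on (\<Union>i<n. Q i) f"
proof -
  have "(\<Sum>i<n. vol_on (Q i) f) = (\<Sum>j<N. \<Sum>i<n. chart_integral (K j) (piece j \<inter> Q i) f)"
    unfolding vol_on_def by (rule sum.swap)
  also have "\<dots> = (\<Sum>j<N. chart_integral (K j) (\<Union>i<n. piece j \<inter> Q i) f)"
    by (intro sum.cong chart_integral_sum K_chart f)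
      (use Q piece_borel piece_in_cdom disj in auto)
  finally show ?thesis by (simp add: vol_on_def)
qed

text \<open>The flow maps the partition into pieces to another Borel partition of the manifold, each part of
which again lies in one chart. Hence the transformation formulas of the single boxes add up.\<close>

lemma vol_step:
  assumes f: "f \<in> borel_measurable borel" "\<And>x. 0 \<le> f x"
  shows "vol (\<lambda>x. f (\<phi> h x) * jac h x) = vol f"
proof -
  have "vol (\<lambda>x. f (\<phi> h x) * jac h x) = (\<Sum>i<N. chart_integral (K i) (\<phi> h ` piece i) f)"
    unfolding vol_on_def
    by (intro sum.cong refl) (simp add: chart_integral_flow piece_borel piece_sub f)
  also have "\<dots> = (\<Sum>i<N. vol_on (\<phi> h ` piece i) f)"
  proof (intro sum.cong refl chart_integral_eq_vol_on f)
    fix i assume "i \<in> {..<N}"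
    then have i: "i < N" by simp
    show "K i \<in> \<A>" by (rule K_chart[OF i])
    show "\<phi> h ` piece i \<in> sets borel" by (rule flow_step_image_borel[OF piece_borel[OF i]])
    show "\<phi> h ` piece i \<subseteq> cdom (K i)" using flow_patch[OF i] piece_sub by blast
  qed
  also have "\<dots> = vol_on (\<Union>i<N. \<phi> h ` piece i) f"
  proof (rule vol_on_sum[OF _ _ f(1)])
    show "\<phi> h ` piece i \<in> sets borel" if "i < N" for i
      by (rule flow_step_image_borel[OF piece_borel[OF that]])
    show "i = j" if "x \<in> \<phi> h ` piece i" "x \<in> \<phi> h ` piece j" for i j x
      using that piece_disjoint inj_flow[of h] by (auto simp: inj_eq)
  qed
  also have "(\<Union>i<N. \<phi> h ` piece i) = UNIV"
  proof -
    have "(\<Union>i<N. piece i) = UNIV" using piece_cover by blast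
    then have "\<phi> h ` (\<Union>i<N. piece i) = UNIV" using surj_flow by simp
    then show ?thesis by (simp add: image_UN)
  qed
  finally show ?thesis .
qed

text \<open>Liouville's theorem for the conformal volume: \<open>\<phi>\<^sub>t\<^sup>* \<omega>\<^sup>n = e\<^sup>n\<^sup>r \<omega>\<^sup>n\<close> at multiples of the time step, by
iterating one step with the cocycle property of the Jacobian.\<close>

lemma vol_flow:
  assumes f: "f \<in> borel_measurable borel" "\<And>x. 0 \<le> f x"
  shows "vol (\<lambda>x. f (\<phi> (time n) x) * jac (time n) x) = vol f"
proof (induction n)
  case 0
  then show ?case by (simp add: flow_0 jac_0)
next
  case (Suc n)
  let ?g = "\<lambda>x. f (\<phi> (time n) x) * jac (time n) x"
  have "vol (\<lambda>x. f (\<phi> (time (Suc n)) x) * jac (time (Suc n)) x) = vol (\<lambda>x. ?g (\<phi> h x) * jac h x)"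
    unfolding flow_Suc jac_Suc by (simp only: mult.assoc mult.commute[of "jac h _"])
  also have "\<dots> = vol ?g"
  proof (rule vol_step)
    show "?g \<in> borel_measurable borel"
      using flow_measurable[of n] jac_measurable[of n] f(1) by simp
    show "0 \<le> ?g x" for x by (intro mult_nonneg_nonneg f(2) less_imp_le[OF jac_pos])
  qed
  finally show ?case using Suc.IH by simp
qed

end

section \<open>Wandering sets\<close>

lemma (in atlas) null_set_UN:
  assumes "countable I" "\<And>i. i \<in> I \<Longrightarrow> null_set \<A> (S i)"
  shows "null_set \<A> (\<Union>i\<in>I. S i)"
  unfolding null_set_def
proof
  fix k assume "k \<in> \<A>"
  then have "(\<Union>i\<in>I. cmap k ` (cdom k \<inter> S i)) \<in> null_sets lebesgue"
    using assms by (intro null_sets_UN') (auto simp: null_set_def negligible_iff_null_sets)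
  moreover have "cmap k ` (cdom k \<inter> (\<Union>i\<in>I. S i)) = (\<Union>i\<in>I. cmap k ` (cdom k \<inter> S i))" by blast
  ultimately show "negligible (cmap k ` (cdom k \<inter> (\<Union>i\<in>I. S i)))"
    by (simp add: negligible_iff_null_sets)
qed

lemma (in atlas) null_set_subset: "null_set \<A> T \<Longrightarrow> S \<subseteq> T \<Longrightarrow> null_set \<A> S"
  unfolding null_set_def by (meson Int_mono image_mono negligible_subset order_refl)

text \<open>Coordinate images of open sets are open, and a nonempty open subset of a Euclidean space is not
negligible.\<close>

lemma (in atlas) open_null_set_empty:
  assumes "open S" "null_set \<A> S" shows "S = {}"
proof (rule ccontr)
  assume "S \<noteq> {}"
  then obtain p where p: "p \<in> S" by blast
  obtain k where k: "k \<in> \<A>" "p \<in> cdom k" by (rule chart_at)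
  have "open (cmap k ` (cdom k \<inter> S))"
    unfolding cmap_image_eq[OF k(1)] by (rule open_cinv_preimage[OF k(1) assms(1)])
  moreover have "negligible (cmap k ` (cdom k \<inter> S))" using assms(2) k(1) by (simp add: null_set_def)
  ultimately show False using open_not_negligible p k(2) by blast
qed

context boxed_system
begin

text \<open>Smooth transition maps preserve negligible sets, so it is enough to look at each piece in its
own chart.\<close>

lemma null_set_if_pieces:
  assumes "\<And>i. i < N \<Longrightarrow> negligible (cmap (K i) ` (piece i \<inter> S))"
  shows "null_set \<A> S"
  unfolding null_set_def
proof
  fix k assume k: "k \<in> \<A>"
  let ?S = "\<lambda>i. cmap (K i) ` (piece i \<inter> S \<inter> cdom k)"
  have "negligible (transition (K i) k ` ?S i)" if i: "i < N" for i
  proof (rule negligible_differentiable_image_negligible)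
    show "negligible (?S i)" by (rule negligible_subset[OF assms[OF i]]) blast
    have "?S i \<subseteq> overlap (K i) k" using piece_in_cdom[OF i] by (auto simp: overlap_def)
    then show "transition (K i) k differentiable_on ?S i"
      unfolding differentiable_on_def
      using transition_has_derivative[OF K_chart[OF i] k] by (meson differentiable_def has_derivative_at_withinI subsetD)
  qed simp
  then have "negligible (\<Union>i\<in>{..<N}. transition (K i) k ` ?S i)" by (intro negligible_Union) auto
  moreover have "cmap k ` (cdom k \<inter> S) \<subseteq> (\<Union>i\<in>{..<N}. transition (K i) k ` ?S i)"
  proof
    fix y assume "y \<in> cmap k ` (cdom k \<inter> S)"
    then obtain p where p: "p \<in> cdom k" "p \<in> S" "y = cmap k p" by blast
    obtain i where i: "i < N" "p \<in> piece i" using piece_cover by blast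
    then have "y = transition (K i) k (cmap (K i) p)"
      using p cinv_cmap[OF K_chart[OF i(1)]] piece_in_cdom[OF i(1)] by (auto simp: transition_def)
    then show "y \<in> (\<Union>i\<in>{..<N}. transition (K i) k ` ?S i)" using i p by blast
  qed
  ultimately show "negligible (cmap k ` (cdom k \<inter> S))" by (rule negligible_subset)
qed

lemma vol_finite: "vol (\<lambda>x. 1) < \<infinity>"
proof -
  have "chart_integral (K i) (piece i) (\<lambda>x. 1) < \<infinity>" if i: "i < N" for i
  proof -
    have "bounded (volume_density (K i) ` closure (B i))"
      by (rule compact_imp_bounded[OF compact_continuous_image[OF
            continuous_on_subset[OF volume_density_continuous[OF K_chart[OF i]] B_closure[OF i]] B_compact[OF i]]])
    then obtain C where C: "0 < C" "\<And>y. y \<in> closure (B i) \<Longrightarrow> \<bar>volume_density (K i) y\<bar> \<le> C"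
      by (auto simp: bounded_pos)
    have sub: "cmap (K i) ` piece i \<subseteq> closure (B i)"
      using piece_sub[of i] patch_eq[OF i] closure_subset[of "B i"] by blast
    have "chart_integral (K i) (piece i) (\<lambda>x. 1) \<le> (\<integral>\<^sup>+y. ennreal C * indicator (closure (B i)) y \<partial>lborel)"
      unfolding chart_integral_def
    proof (rule nn_integral_mono)
      fix y
      have "local_density (K i) (\<lambda>x. 1) y \<le> C" if "y \<in> closure (B i)"
        using C(2)[OF that] C(1) by (auto simp: local_density_def dest: abs_le_D1)
      then show "ennreal (local_density (K i) (\<lambda>x. 1) y) * indicator (cmap (K i) ` piece i) y
        \<le> ennreal C * indicator (closure (B i)) y"
        using sub by (auto simp: indicator_def ennreal_leI)
    qed
    also have "\<dots> = ennreal C * emeasure lborel (closure (B i))"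
      by (rule nn_integral_cmult_indicator) simp
    also have "\<dots> < \<infinity>"
      using emeasure_compact_finite[OF B_compact[OF i]] by (simp add: ennreal_mult_less_top)
    finally show ?thesis .
  qed
  then show ?thesis by (simp add: vol_on_def)
qed

lemma vol_indicator: "vol (indicator Q) = vol_on Q (\<lambda>x. 1)"
  unfolding vol_on_def
proof (rule sum.cong[OF refl])
  fix i assume "i \<in> {..<N}"
  then have i: "i < N" by simp
  have "ennreal (local_density (K i) (indicator Q) y) * indicator (cmap (K i) ` piece i) y
    = ennreal (local_density (K i) (\<lambda>x. 1) y) * indicator (cmap (K i) ` (piece i \<inter> Q)) y" for y
  proof (cases "y \<in> cmap (K i) ` piece i")
    case True
    then obtain p where p: "p \<in> piece i" "y = cmap (K i) p" by blast
    then have inv: "cinv (K i) y = p" using piece_in_cdom[OF i] cinv_cmap[OF K_chart[OF i]] by auto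
    have "y \<in> cmap (K i) ` (piece i \<inter> Q) \<longleftrightarrow> p \<in> Q"
    proof
      assume "y \<in> cmap (K i) ` (piece i \<inter> Q)"
      then obtain q where "q \<in> piece i" "q \<in> Q" "y = cmap (K i) q" by blast
      then have "p = q" using inv piece_in_cdom[OF i] cinv_cmap[OF K_chart[OF i]] by auto
      then show "p \<in> Q" using \<open>q \<in> Q\<close> by simp
    qed (use p in blast)
    then show ?thesis using True by (simp add: local_density_def inv indicator_def)
  qed (auto simp: indicator_def)
  then show "chart_integral (K i) (piece i \<inter> UNIV) (indicator Q) = chart_integral (K i) (piece i \<inter> Q) (\<lambda>x. 1)"
    by (simp add: chart_integral_def)
qed

lemma vol_on_mono: "vol_on Q (\<lambda>x. 1) \<le> vol (\<lambda>x. 1)"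
  unfolding vol_on_def chart_integral_def
  by (intro sum_mono nn_integral_mono mult_left_mono) (auto simp: indicator_def)

text \<open>The easy half of the Hopf decomposition. The images of \<open>Q\<close> at multiples of \<open>m\<close> steps are disjoint and the total
volume is finite, so their volumes have a finite sum. By Liouville's theorem this sum is the
integral over \<open>Q\<close> of the sum of the Jacobians; so the latter is finite almost everywhere,
its terms tend to \<open>0\<close>, and their logarithms to \<open>-\<infinity>\<close>.\<close>

lemma disjoint_images_imp_winding:
  assumes Q: "Q \<in> sets borel"
    and disj: "\<And>i j x. x \<in> \<phi> (time (i * m)) ` Q \<Longrightarrow> x \<in> \<phi> (time (j * m)) ` Q \<Longrightarrow> i = j"
  shows "null_set \<A> {x \<in> Q. \<not> filterlim (\<lambda>j. wind (time (j * m)) x) at_bot sequentially}" (is "null_set \<A> ?bad")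
proof (rule null_set_if_pieces)
  fix i assume i: "i < N"
  note k = K_chart[OF i]
  define f where "f j x = indicator Q x * jac (time (j * m)) x" for j x
  have f0: "0 \<le> f j x" for j x by (simp add: f_def indicator_def less_imp_le[OF jac_pos])
  have mf: "f j \<in> borel_measurable borel" for j
    unfolding f_def using Q jac_measurable[of "j * m"] by measurable
  let ?g = "\<lambda>j y. ennreal (local_density (K i) (f j) y) * indicator (cmap (K i) ` piece i) y"
  have mg: "?g j \<in> borel_measurable lborel" for j
    using local_density_measurable[OF k mf[of j]] chart_image_borel[OF k piece_borel[OF i] piece_in_cdom[OF i]]
    by measurable
  have vol_f: "vol (f j) = vol_on (\<phi> (time (j * m)) ` Q) (\<lambda>x. 1)" for j
  proof -
    let ?t = "time (j * m)"
    have "f j x = indicator (\<phi> ?t ` Q) (\<phi> ?t x) * jac ?t x" for x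
      using inj_flow[of ?t] by (simp add: f_def indicator_def inj_image_mem_iff)
    then have "vol (f j) = vol (\<lambda>x. indicator (\<phi> ?t ` Q) (\<phi> ?t x) * jac ?t x)" by presburger
    also have "\<dots> = vol (indicator (\<phi> ?t ` Q))"
      by (rule vol_flow[OF borel_measurable_indicator[OF flow_image_borel[OF Q]]]) simp
    finally show ?thesis by (simp only: vol_indicator)
  qed
  \<comment> \<open>The disjoint images together have at most the total volume.\<close>
  have partial: "(\<Sum>j<n. (\<integral>\<^sup>+y. ?g j y \<partial>lborel)) \<le> vol (\<lambda>x. 1)" for n
  proof -
    have "(\<Sum>j<n. (\<integral>\<^sup>+y. ?g j y \<partial>lborel)) \<le> (\<Sum>j<n. vol (f j))"
    proof (rule sum_mono)
      fix j
      have "(\<integral>\<^sup>+y. ?g j y \<partial>lborel) = chart_integral (K i) (piece i \<inter> UNIV) (f j)"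
        by (simp add: chart_integral_def)
      also have "\<dots> \<le> vol (f j)"
        unfolding vol_on_def using i by (intro member_le_sum) auto
      finally show "(\<integral>\<^sup>+y. ?g j y \<partial>lborel) \<le> vol (f j)" .
    qed
    also have "\<dots> = vol_on (\<Union>j<n. \<phi> (time (j * m)) ` Q) (\<lambda>x. 1)"
      unfolding vol_f using disj by (intro vol_on_sum flow_image_borel[OF Q]) auto
    also have "\<dots> \<le> vol (\<lambda>x. 1)" by (rule vol_on_mono)
    finally show ?thesis .
  qed
  have "(\<integral>\<^sup>+y. (\<Sum>j. ?g j y) \<partial>lborel) = (\<Sum>j. (\<integral>\<^sup>+y. ?g j y \<partial>lborel))"
    by (rule nn_integral_suminf) (rule mg)
  also have "\<dots> \<le> vol (\<lambda>x. 1)"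
    unfolding suminf_eq_SUP by (rule SUP_least) (rule partial)
  also have "\<dots> < \<infinity>" by (rule vol_finite)
  finally have "(\<integral>\<^sup>+y. (\<Sum>j. ?g j y) \<partial>lborel) \<noteq> \<infinity>" by (rule less_imp_neq)
  moreover have "(\<lambda>y. \<Sum>j. ?g j y) \<in> borel_measurable lborel"
    by (rule borel_measurable_suminf_order) (rule mg)
  ultimately have "AE y in lborel. (\<Sum>j. ?g j y) \<noteq> \<infinity>"
    by (rule nn_integral_PInf_AE[rotated])
  then obtain Z where Z: "Z \<in> null_sets lborel" "{y. \<not> (\<Sum>j. ?g j y) \<noteq> \<infinity>} \<subseteq> Z"
    by (auto simp: eventually_ae_filter)
  have "negligible Z" using null_sets_completionI[OF Z(1)] by (simp add: negligible_iff_null_sets)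
  then show "negligible (cmap (K i) ` (piece i \<inter> ?bad))"
  proof (rule negligible_subset)
    show "cmap (K i) ` (piece i \<inter> ?bad) \<subseteq> Z"
    proof (rule subsetI, rule ccontr)
      fix y assume "y \<in> cmap (K i) ` (piece i \<inter> ?bad)" and notZ: "y \<notin> Z"
      then obtain p where p: "p \<in> piece i" "p \<in> Q" "\<not> filterlim (\<lambda>j. wind (time (j * m)) p) at_bot sequentially"
        "y = cmap (K i) p" by blast
      have pd: "p \<in> cdom (K i)" using p(1) piece_in_cdom[OF i] by blast
      have y: "cinv (K i) y = p" "y \<in> cimage (K i)"
        using p(4) cinv_cmap[OF k pd] cmap_in_cimage[OF k pd] by auto
      have \<rho>: "0 < volume_density (K i) y" by (rule volume_density_pos[OF k y(2)])
      have g: "?g j y = ennreal (jac (time (j * m)) p * volume_density (K i) y)" for j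
        using p y by (simp add: local_density_def f_def)
      have "(\<Sum>j. ?g j y) \<noteq> \<infinity>" using notZ Z(2) by blast
      then have "(\<Sum>j. ennreal (jac (time (j * m)) p * volume_density (K i) y)) \<noteq> \<infinity>"
        unfolding g .
      then have "summable (\<lambda>j. jac (time (j * m)) p * volume_density (K i) y)"
        using jac_pos \<rho> by (intro summable_suminf_not_top) (auto intro: less_imp_le)
      then have "(\<lambda>j. jac (time (j * m)) p * volume_density (K i) y) \<longlonglongrightarrow> 0" by (rule summable_LIMSEQ_zero)
      then have "(\<lambda>j. jac (time (j * m)) p * volume_density (K i) y / volume_density (K i) y) \<longlonglongrightarrow> 0 / volume_density (K i) y"
        using \<rho> by (intro tendsto_divide tendsto_const) auto
      then have lim: "(\<lambda>j. jac (time (j * m)) p) \<longlonglongrightarrow> 0" using \<rho> by simp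
      have "filterlim (\<lambda>j. wind (time (j * m)) p) at_bot sequentially"
        unfolding filterlim_at_bot
      proof
        fix z
        have "\<forall>\<^sub>F j in sequentially. jac (time (j * m)) p < exp (DIM('e) / 2 * z)"
          by (rule order_tendstoD(2)[OF lim]) simp
        then show "\<forall>\<^sub>F j in sequentially. wind (time (j * m)) p \<le> z"
          by (rule eventually_mono) (simp add: jac_def)
      qed
      then show False using p(3) by simp
    qed
  qed
qed

lemma lee_bounded: obtains C where "0 < C" "\<And>x. \<bar>lee x\<bar> \<le> C"
proof -
  have "bounded (lee ` UNIV)"
    by (rule compact_imp_bounded[OF compact_continuous_image[OF lee_continuous compact_space]])
  then show ?thesis using that by (auto simp: bounded_pos)
qed

text \<open>The winding changes at bounded speed since \<open>\<eta>(X)\<close> is bounded on the compact manifold.\<close>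

lemma winding_limit_from_steps:
  assumes m: "0 < m" and lim: "filterlim (\<lambda>j. wind (time (j * m)) x) at_bot sequentially"
  shows "filterlim (\<lambda>t. wind t x) at_bot at_top"
proof -
  obtain C where C: "0 < C" "\<And>x. \<bar>lee x\<bar> \<le> C" by (rule lee_bounded) blast
  define T where "T = real m * h"
  have T: "0 < T" using m h_pos by (simp add: T_def)
  show ?thesis
    unfolding filterlim_at_bot
  proof
    fix z
    obtain J where J: "\<And>j. j \<ge> J \<Longrightarrow> wind (time (j * m)) x \<le> z - C * T"
      using lim unfolding filterlim_at_bot eventually_sequentially by metis
    have "wind t x \<le> z" if t: "t \<ge> real (Suc J) * T" for t
    proof -
      define j where "j = nat \<lfloor>t / T\<rfloor>"
      have t0: "0 \<le> t" using t T by (meson mult_nonneg_nonneg of_nat_0_le_iff less_imp_le order_trans)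
      have jt: "real j * T \<le> t" "t < real j * T + T"
      proof -
        have fl: "real j = of_int \<lfloor>t / T\<rfloor>" using t0 T by (simp add: j_def)
        have "real j \<le> t / T" "t / T < real j + 1" unfolding fl by linarith+
        then show "real j * T \<le> t" "t < real j * T + T" using T by (simp_all add: field_simps)
      qed
      have "real (Suc J) * T < (real j + 1) * T" using t jt(2) by (simp add: algebra_simps)
      then have "real (Suc J) < real j + 1" using T by (simp only: mult_less_cancel_right_pos)
      then have "J \<le> j" by simp
      have tm: "time (j * m) = real j * T" by (simp add: T_def)
      define s where "s = t - real j * T"
      have s: "0 \<le> s" "s \<le> T" using jt by (auto simp: s_def)
      have "wind t x = wind (real j * T) x + wind s (\<phi> (real j * T) x)"
        using wind_add[of "real j * T" s x] s T by (simp add: s_def)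
      also have "wind s (\<phi> (real j * T) x) \<le> C * T"
      proof -
        have "norm (integral {0..s} (\<lambda>u. lee (\<phi> u (\<phi> (real j * T) x)))) \<le> C * (s - 0)"
          by (rule integral_bound[OF s(1) lee_flow_continuous]) (simp add: C(2))
        then have "wind s (\<phi> (real j * T) x) \<le> C * s" by (simp add: wind_nonneg s(1))
        also have "\<dots> \<le> C * T" using s C(1) by simp
        finally show ?thesis .
      qed
      moreover have "wind (real j * T) x \<le> z - C * T"
        using J[OF \<open>J \<le> j\<close>] unfolding tm .
      ultimately show ?thesis by linarith
    qed
    then show "\<forall>\<^sub>F t in at_top. wind t x \<le> z" by (auto simp: eventually_at_top_linorder)
  qed
qed

text \<open>Points that never return to \<open>Q\<close> from step \<open>Suc m\<close> on form a set whose images under multiples of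
\<open>Suc m\<close> steps are disjoint. These sets exhaust \<open>Q\<close> as \<open>m\<close> grows.\<close>

lemma winding_limit_of_leaving:
  assumes Q: "Q \<in> sets borel" and leave: "\<And>x. x \<in> Q \<Longrightarrow> \<exists>m. \<forall>n\<ge>m. \<phi> (time n) x \<notin> Q"
  shows "null_set \<A> {x \<in> Q. \<not> filterlim (\<lambda>t. wind t x) at_bot at_top}"
proof -
  define E where "E m = {x \<in> Q. \<forall>n\<ge>Suc m. \<phi> (time n) x \<notin> Q}" for m
  have "null_set \<A> {x \<in> E m. \<not> filterlim (\<lambda>j. wind (time (j * Suc m)) x) at_bot sequentially}" for m
  proof (rule disjoint_images_imp_winding)
    have "E m = Q \<inter> (\<Inter>n\<in>{Suc m..}. - (\<phi> (time n) -` Q))" by (auto simp: E_def)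
    moreover have "- (\<phi> (time n) -` Q) \<in> sets borel" for n
      using measurable_sets[OF flow_measurable Q, of n] by (simp add: sets.compl_sets Compl_eq_Diff_UNIV)
    ultimately show "E m \<in> sets borel" using Q by (auto intro!: sets.Int sets.countable_INT'')
    have "\<not> (i < j)" if x: "x \<in> \<phi> (time (i * Suc m)) ` E m" "x \<in> \<phi> (time (j * Suc m)) ` E m" for i j x
    proof
      assume "i < j"
      then obtain d where d: "j = i + Suc d" by (metis less_imp_Suc_add add_Suc_right)
      obtain a b where ab: "a \<in> E m" "b \<in> E m" "x = \<phi> (time (i * Suc m)) a" "x = \<phi> (time (j * Suc m)) b"
        using x by blast
      have "time (j * Suc m) = time (Suc d * Suc m) + time (i * Suc m)"
        by (simp add: d algebra_simps)
      then have "\<phi> (time (i * Suc m)) a = \<phi> (time (i * Suc m)) (\<phi> (time (Suc d * Suc m)) b)"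
        using ab(3,4) by (simp only: flow_add)
      then have "a = \<phi> (time (Suc d * Suc m)) b" using inj_flow by (simp only: inj_eq)
      moreover have "Suc d * Suc m \<ge> Suc m" by simp
      ultimately show False using ab(1,2) unfolding E_def by blast
    qed
    then show "i = j" if "x \<in> \<phi> (time (i * Suc m)) ` E m" "x \<in> \<phi> (time (j * Suc m)) ` E m" for i j x
      using that by (metis linorder_neqE_nat)
  qed
  then have "null_set \<A> (\<Union>m\<in>UNIV. {x \<in> E m. \<not> filterlim (\<lambda>j. wind (time (j * Suc m)) x) at_bot sequentially})"
    by (intro null_set_UN) auto
  then show ?thesis
  proof (rule null_set_subset, intro subsetI)
    fix x assume x: "x \<in> {x \<in> Q. \<not> filterlim (\<lambda>t. wind t x) at_bot at_top}"
    then obtain m where "\<forall>n\<ge>m. \<phi> (time n) x \<notin> Q" using leave by blast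
    then have "x \<in> E m" using x by (simp add: E_def)
    moreover have "\<not> filterlim (\<lambda>j. wind (time (j * Suc m)) x) at_bot sequentially"
      using winding_limit_from_steps[of "Suc m" x] x by blast
    ultimately show "x \<in> (\<Union>m\<in>UNIV. {x \<in> E m. \<not> filterlim (\<lambda>j. wind (time (j * Suc m)) x) at_bot sequentially})"
      by blast
  qed
qed

end

section \<open>Attractors and the Lee form\<close>

text \<open>Otherwise the closed sets of late orbit points all meet the compact set \<open>C\<close>, and by the finite
intersection property so does the limit set.\<close>

lemma omega_limit_avoids_closed:
  fixes \<phi> :: "real \<Rightarrow> 'm::topological_space \<Rightarrow> 'm"
  assumes compact: "compact (UNIV :: 'm set)" and C: "closed C" "C \<inter> omega_limit \<phi> x = {}"
  obtains T where "\<And>t. T \<le> t \<Longrightarrow> \<phi> t x \<notin> C"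
proof (rule ccontr)
  assume "\<not> thesis"
  then have rec: "\<exists>t\<ge>T. \<phi> t x \<in> C" for T using that by blast
  let ?F = "\<lambda>T. closure ((\<lambda>t. \<phi> t x) ` {T..})"
  have "C \<inter> (\<Inter>(range ?F)) \<noteq> {}"
  proof (rule compact_imp_fip)
    show "compact C" using compact_Int_closed[OF compact C(1)] by simp
    show "closed S" if "S \<in> range ?F" for S using that by auto
    fix F' assume "finite F'" "F' \<subseteq> range ?F"
    then obtain I where I: "finite I" "F' = ?F ` I" by (meson finite_subset_image)
    obtain t where t: "t \<ge> Max (insert 0 I)" "\<phi> t x \<in> C" using rec by blast
    have "\<phi> t x \<in> ?F T" if "T \<in> I" for T
    proof -
      have "T \<le> t" using t(1) I(1) that by simp
      then have "\<phi> t x \<in> (\<lambda>t. \<phi> t x) ` {T..}" by simp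
      then show ?thesis by (rule subsetD[OF closure_subset])
    qed
    then show "C \<inter> \<Inter>F' \<noteq> {}" using t(2) I(2) by blast
  qed
  then show False using C(2) by (simp add: omega_limit_def)
qed

lemma omega_limit_frequently:
  assumes "p \<in> omega_limit \<phi> x" "open O'" "p \<in> O'"
  shows "\<exists>t\<ge>T. \<phi> t x \<in> O'"
proof -
  have "p \<in> closure ((\<lambda>t. \<phi> t x) ` {T..})" using assms(1) by (auto simp: omega_limit_def)
  then have "O' \<inter> (\<lambda>t. \<phi> t x) ` {T..} \<noteq> {}"
    using assms(2,3) by (simp add: closure_iff_nhds_not_empty) blast
  then show ?thesis by auto
qed

context hamiltonian_system
begin

lemma boxed_system_exists:
  obtains h N K B where "boxed_system \<A> X \<phi> \<eta> \<omega> H h N K B"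
proof -
  have "\<exists>k B h0. h0 > 0 \<and> p \<in> cinv k ` B \<and> (\<forall>h\<in>{0..h0}. flow_box k B h)" for p
  proof -
    obtain k where k: "k \<in> \<A>" "p \<in> cdom k" by (rule chart_at)
    obtain B h0 where "h0 > 0" "cmap k p \<in> B" "\<And>h. h \<in> {0..h0} \<Longrightarrow> flow_box k B h"
      by (rule flow_box_exists[OF k]) blast
    moreover have "cinv k (cmap k p) = p" by (rule cinv_cmap[OF k])
    ultimately show ?thesis by (metis imageI)
  qed
  then obtain k B h0 where box: "\<And>p. h0 p > (0::real)" "\<And>p. p \<in> cinv (k p) ` B p"
    "\<And>p h. h \<in> {0..h0 p} \<Longrightarrow> flow_box (k p) (B p) h" by metis
  have "open (cinv (k p) ` B p)" for p
  proof -
    have fb: "flow_box (k p) (B p) 0" using box(1)[of p] by (intro box(3)) auto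
    then have kp: "k p \<in> \<A>" and Bp: "open (B p)" "B p \<subseteq> cimage (k p)"
      using closure_subset[of "B p"] by (auto simp: flow_box_def)
    show ?thesis unfolding cinv_image_eq[OF kp Bp(2)] by (rule open_cmap_preimage[OF kp Bp(1)])
  qed
  moreover have "UNIV \<subseteq> (\<Union>p\<in>UNIV. cinv (k p) ` B p)" using box(2) by (intro subsetI UN_I) auto
  ultimately obtain D where D: "finite D" "UNIV \<subseteq> (\<Union>p\<in>D. cinv (k p) ` B p)"
    by (rule compactE_image[OF compact_space])
  obtain e :: "nat \<Rightarrow> 'm" where e: "bij_betw e {..<card D} D"
    using ex_bij_betw_nat_finite[OF D(1)] by (auto simp: atLeast0LessThan)
  define h where "h = Min (insert 1 (h0 ` D))"
  have h: "0 < h" unfolding h_def using D(1) box(1) by (subst Min_gr_iff) auto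
  have "boxed_system \<A> X \<phi> \<eta> \<omega> H h (card D) (\<lambda>i. k (e i)) (\<lambda>i. B (e i))"
  proof unfold_locales
    show "flow_box (k (e i)) (B (e i)) h" if "i < card D" for i
    proof -
      have "e i \<in> D" using e that by (auto simp: bij_betw_def)
      then have "h \<le> h0 (e i)" unfolding h_def using D(1) by (intro Min_le) auto
      then show ?thesis using h by (intro box(3)) auto
    qed
    have "(\<Union>i<card D. cinv (k (e i)) ` B (e i)) = (\<Union>p\<in>e ` {..<card D}. cinv (k p) ` B p)" by simp
    also have "e ` {..<card D} = D" using e by (simp add: bij_betw_def)
    also have "(\<Union>p\<in>D. cinv (k p) ` B p) = UNIV" using D(2) by (rule top.extremum_uniqueI)
    finally show "(\<Union>i<card D. cinv (k (e i)) ` B (e i)) = UNIV" .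
  qed (rule h)
  then show ?thesis by (rule that)
qed

text \<open>The open set \<open>U - A\<close> is a countable union of compact coordinate sets. Limit points of an orbit
starting in one of them lie in \<open>A\<close>, so the orbit eventually leaves that compact set for good.\<close>

lemma winding_tends_to_minus_infinity:
  assumes A: "compact A" and U: "basin_of_attraction \<phi> A U"
  shows "null_set \<A> {x \<in> U - A. \<not> filterlim (\<lambda>t. wind t x) at_bot at_top}"
proof -
  obtain h N K B where "boxed_system \<A> X \<phi> \<eta> \<omega> H h N K B" by (rule boxed_system_exists)
  then interpret boxed_system \<A> X \<phi> \<eta> \<omega> H h N K B .
  have G: "open (U - A)" using A U compact_imp_closed by (auto simp: basin_of_attraction_def)
  have "\<exists>C :: nat \<Rightarrow> 'e set. (\<forall>n. compact (C n) \<and> C n \<subseteq> cimage (K i) \<inter> cinv (K i) -` (U - A)) \<and>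
    (\<Union>n. C n) = cimage (K i) \<inter> cinv (K i) -` (U - A)" if i: "i < N" for i
  proof -
    obtain C :: "nat \<Rightarrow> 'e set" where C: "\<And>n. compact (C n)" "\<And>n. C n \<subseteq> cimage (K i) \<inter> cinv (K i) -` (U - A)"
      "\<Union>(range C) = cimage (K i) \<inter> cinv (K i) -` (U - A)"
      by (rule open_Union_compact_subsets[OF open_cinv_preimage[OF K_chart[OF i] G]], rule that)
    show ?thesis by (rule exI[of _ C]) (use C in simp)
  qed
  then obtain C :: "nat \<Rightarrow> nat \<Rightarrow> 'e set" where C: "\<And>i n. i < N \<Longrightarrow> compact (C i n)"
    "\<And>i n. i < N \<Longrightarrow> C i n \<subseteq> cimage (K i) \<inter> cinv (K i) -` (U - A)"
    "\<And>i. i < N \<Longrightarrow> (\<Union>n. C i n) = cimage (K i) \<inter> cinv (K i) -` (U - A)" by metis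
  define Q where "Q i n = cinv (K i) ` C i n" for i n
  have null: "null_set \<A> {x \<in> Q i n. \<not> filterlim (\<lambda>t. wind t x) at_bot at_top}" if i: "i < N" for i n
  proof (rule winding_limit_of_leaving)
    have "compact (Q i n)" unfolding Q_def
      using C(2)[OF i, of n] by (intro compact_continuous_image[OF continuous_on_subset[OF cinv_continuous[OF K_chart[OF i]]]] C(1) i) auto
    then have cl: "closed (Q i n)" by (rule compact_imp_closed)
    then show "Q i n \<in> sets borel" by simp
    fix x assume x: "x \<in> Q i n"
    have sub: "Q i n \<subseteq> U - A" unfolding Q_def using C(2)[OF i, of n] by blast
    have "omega_limit \<phi> x \<subseteq> A" using x sub U by (auto simp: basin_of_attraction_def)
    then have "Q i n \<inter> omega_limit \<phi> x = {}" using sub by blast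
    then obtain T where T: "\<And>t. T \<le> t \<Longrightarrow> \<phi> t x \<notin> Q i n"
      using omega_limit_avoids_closed[OF compact_space cl] by metis
    obtain m where m: "T / h \<le> real m" using real_arch_simple by blast
    have "\<phi> (time k) x \<notin> Q i n" if "m \<le> k" for k
    proof (rule T)
      have "T / h \<le> real k" using m that by linarith
      then show "T \<le> time k" using h_pos by (simp add: field_simps)
    qed
    then show "\<exists>m. \<forall>n'\<ge>m. \<phi> (time n') x \<notin> Q i n" by blast
  qed
  have "null_set \<A> (\<Union>q\<in>{..<N} \<times> UNIV. {x \<in> Q (fst q) (snd q). \<not> filterlim (\<lambda>t. wind t x) at_bot at_top})"
    by (rule null_set_UN) (use null in \<open>auto intro: countable_SIGMA\<close>)
  then show ?thesis
  proof (rule null_set_subset, intro subsetI)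
    fix x assume x: "x \<in> {x \<in> U - A. \<not> filterlim (\<lambda>t. wind t x) at_bot at_top}"
    obtain i where i: "i < N" "x \<in> patch i" using patch_cover by blast
    then have xi: "x \<in> cdom (K i)" using patch_eq by blast
    then have "cmap (K i) x \<in> cimage (K i) \<inter> cinv (K i) -` (U - A)"
      using x cinv_cmap[OF K_chart[OF i(1)] xi] cmap_in_cimage[OF K_chart[OF i(1)] xi] by auto
    then obtain n where "cmap (K i) x \<in> C i n" using C(3)[OF i(1)] by blast
    then have "x \<in> Q i n" unfolding Q_def using cinv_cmap[OF K_chart[OF i(1)] xi] by (metis imageI)
    then show "x \<in> (\<Union>q\<in>{..<N} \<times> UNIV. {x \<in> Q (fst q) (snd q). \<not> filterlim (\<lambda>t. wind t x) at_bot at_top})"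
      using x i(1) by force
  qed
qed

lemma smooth_function_continuous:
  assumes V: "open V" and f: "smooth_function_on \<A> V f"
  shows "continuous_on V f"
  unfolding continuous_on_eq_continuous_at[OF V]
proof
  fix p assume p: "p \<in> V"
  obtain k where k: "k \<in> \<A>" "p \<in> cdom k" by (rule chart_at)
  have "continuous_on (cmap k ` (cdom k \<inter> V)) (f \<circ> cinv k)"
    using f k(1) by (intro smooth_on_continuous) (simp add: smooth_function_on_def)
  then have "continuous_on (cdom k \<inter> V) (\<lambda>p. (f \<circ> cinv k) (cmap k p))"
    by (rule continuous_on_compose2) (auto intro: continuous_on_subset[OF cmap_continuous[OF k(1)]])
  then have "continuous_on (cdom k \<inter> V) f"
    by (rule continuous_on_eq) (simp add: cinv_cmap[OF k(1)])
  then show "isCont f p"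
    using continuous_on_eq_continuous_at[of "cdom k \<inter> V" f] open_cdom[OF k(1)] V p k(2) by blast
qed

lemma smooth_function_along_flow:
  assumes V: "open V" and f: "smooth_function_on \<A> V f"
    and k: "k \<in> \<A>" and x: "\<phi> t x \<in> cdom k" "\<phi> t x \<in> V"
  shows "((\<lambda>s. f (\<phi> s x)) has_real_derivative
    frechet_derivative (f \<circ> cinv k) (at (cmap k (\<phi> t x))) (X k (cmap k (\<phi> t x)))) (at t)"
proof -
  let ?y = "cmap k (\<phi> t x)"
  have sm: "smooth_on (cmap k ` (cdom k \<inter> V)) (f \<circ> cinv k)" using f k by (simp add: smooth_function_on_def)
  have y: "?y \<in> cmap k ` (cdom k \<inter> V)" using x by blast
  have "((\<lambda>s. (f \<circ> cinv k) (cmap k (\<phi> s x))) has_derivative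
    (\<lambda>u. frechet_derivative (f \<circ> cinv k) (at ?y) (u *\<^sub>R X k ?y))) (at t)"
    by (rule has_derivative_compose[where f = "\<lambda>s. cmap k (\<phi> s x)", OF _ smooth_on_has_derivative[OF sm y]])
      (use flow_derivative[OF k x(1)] in \<open>simp add: has_vector_derivative_def\<close>)
  then have "((\<lambda>s. (f \<circ> cinv k) (cmap k (\<phi> s x))) has_real_derivative
    frechet_derivative (f \<circ> cinv k) (at ?y) (X k ?y)) (at t)"
    using smooth_on_linear[OF sm y] by (simp add: has_field_derivative_def linear_cmul mult.commute[of _ "frechet_derivative _ _ _"])
  moreover have "open ((\<lambda>s. \<phi> s x) -` cdom k)"
    by (rule open_vimage[OF open_cdom[OF k] flow_continuous_time])
  ultimately show ?thesis
    by (rule has_field_derivative_transform_within_open) (use x(1) cinv_cmap[OF k] in auto)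
qed

lemma H_continuous: "continuous_on UNIV H"
  by (rule smooth_function_continuous[OF open_UNIV H])

text \<open>Evaluating \<open>\<iota>\<^sub>X \<omega> = dH - H \<eta>\<close> at \<open>X\<close> gives \<open>dH(X) = \<eta>(X) H\<close>.\<close>

lemma H_along_flow:
  assumes "0 \<le> t" shows "H (\<phi> t x) = exp (wind t x) * H x"
proof -
  have dH: "((\<lambda>s. H (\<phi> s x)) has_real_derivative lee (\<phi> s x) * H (\<phi> s x)) (at s)" for s
  proof -
    obtain k where k: "k \<in> \<A>" "\<phi> s x \<in> cdom k" by (rule chart_at)
    let ?y = "cmap k (\<phi> s x)"
    have y: "?y \<in> cimage k" by (rule cmap_in_cimage[OF k])
    have "frechet_derivative (H \<circ> cinv k) (at ?y) (X k ?y) = lee (\<phi> s x) * H (\<phi> s x)"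
      using hamiltonian_chart[OF k(1) y, of "X k ?y"] \<omega>_alternating[OF k(1) y, of "X k ?y"] lee_chart[OF k]
      by (simp add: cinv_cmap[OF k] mult.commute)
    then show ?thesis using smooth_function_along_flow[OF open_UNIV H k] by simp
  qed
  have "((\<lambda>s. exp (- wind s x) * H (\<phi> s x)) has_derivative (\<lambda>u. 0)) (at s within {0..t})" if s: "s \<in> {0..t}" for s
  proof -
    have "((\<lambda>s. integral {0..s} (\<lambda>u. lee (\<phi> u x))) has_real_derivative lee (\<phi> s x)) (at s within {0..t})"
      using integral_has_vector_derivative[OF lee_flow_continuous s]
      by (simp add: has_real_derivative_iff_has_vector_derivative)
    then have w: "((\<lambda>s. wind s x) has_real_derivative lee (\<phi> s x)) (at s within {0..t})"
      by (rule has_field_derivative_transform_within[OF _ zero_less_one s]) (simp add: wind_nonneg)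
    have "((\<lambda>s. exp (- wind s x) * H (\<phi> s x)) has_real_derivative 0) (at s within {0..t})"
      by (rule derivative_eq_intros w DERIV_subset[OF dH] refl subset_UNIV | simp)+
    then show ?thesis by (simp add: has_field_derivative_def lambda_zero)
  qed
  then obtain c where "\<And>s. s \<in> {0..t} \<Longrightarrow> exp (- wind s x) * H (\<phi> s x) = c"
    using has_derivative_zero_constant[of "{0..t}" "\<lambda>s. exp (- wind s x) * H (\<phi> s x)"] by auto
  from this[of 0] this[of t] have "exp (- wind t x) * H (\<phi> t x) = H x"
    using assms by (simp add: wind_0 flow_0)
  then show ?thesis by (simp add: exp_minus field_simps)
qed

lemma omega_limit_in_zero_level:
  assumes lim: "filterlim (\<lambda>t. wind t x) at_bot at_top"
  shows "omega_limit \<phi> x \<subseteq> {p. H p = 0}"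
proof
  fix p assume p: "p \<in> omega_limit \<phi> x"
  have "((\<lambda>t. exp (wind t x)) \<longlongrightarrow> 0) at_top"
    by (rule filterlim_compose[OF exp_at_bot lim])
  then have "((\<lambda>t. exp (wind t x) * H x) \<longlongrightarrow> 0) at_top"
    by (rule tendsto_mult_left_zero)
  moreover have "\<forall>\<^sub>F t in at_top. exp (wind t x) * H x = H (\<phi> t x)"
    using eventually_ge_at_top[of 0] by eventually_elim (simp add: H_along_flow)
  ultimately have H0: "((\<lambda>t. H (\<phi> t x)) \<longlongrightarrow> 0) at_top" by (rule Lim_transform_eventually)
  show "p \<in> {p. H p = 0}"
  proof (rule ccontr)
    assume "p \<notin> {p. H p = 0}"
    then have Hp: "0 < \<bar>H p\<bar>" by simp
    have "\<forall>\<^sub>F t in at_top. \<bar>H (\<phi> t x)\<bar> < \<bar>H p\<bar> / 2"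
      using tendstoD[OF H0, of "\<bar>H p\<bar> / 2"] Hp by (simp add: dist_real_def)
    then obtain T where T: "\<And>t. t \<ge> T \<Longrightarrow> \<bar>H (\<phi> t x)\<bar> < \<bar>H p\<bar> / 2" by (auto simp: eventually_at_top_linorder)
    have "open {q. \<bar>H p\<bar> / 2 < \<bar>H q\<bar>}"
      by (intro open_Collect_less continuous_intros H_continuous)
    moreover have "p \<in> {q. \<bar>H p\<bar> / 2 < \<bar>H q\<bar>}" using Hp by simp
    ultimately obtain t where "t \<ge> T" "\<phi> t x \<in> {q. \<bar>H p\<bar> / 2 < \<bar>H q\<bar>}"
      using omega_limit_frequently[OF p] by blast
    then show False using T[of t] by simp
  qed
qed

text \<open>The orbit is eventually in \<open>V\<close>. If \<open>\<eta> = df\<close> there, the winding differs from \<open>f\<close> along the orbit by a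
constant. But \<open>f\<close> is continuous at a limit point of the orbit, so it cannot tend to \<open>-\<infinity>\<close> along it.\<close>

lemma not_exact_near_omega_limit:
  assumes V: "open V" "omega_limit \<phi> x \<subseteq> V" and lim: "filterlim (\<lambda>t. wind t x) at_bot at_top"
  shows "\<not> exact_on \<A> \<eta> V"
proof
  assume "exact_on \<A> \<eta> V"
  then obtain f where f: "smooth_function_on \<A> V f"
    and df: "\<And>k y v. k \<in> \<A> \<Longrightarrow> y \<in> cmap k ` (cdom k \<inter> V) \<Longrightarrow> \<eta> k y v = frechet_derivative (f \<circ> cinv k) (at y) v"
    unfolding exact_on_def ext_deriv0_def by blast
  have "closed (- V)" "- V \<inter> omega_limit \<phi> x = {}" using V by auto
  then obtain T0 where T0: "\<And>t. T0 \<le> t \<Longrightarrow> \<phi> t x \<notin> - V"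
    using omega_limit_avoids_closed[OF compact_space] by metis
  define T where "T = max T0 0"
  have T: "0 \<le> T" "\<And>t. T \<le> t \<Longrightarrow> \<phi> t x \<in> V" using T0 by (auto simp: T_def)
  have der: "((\<lambda>s. f (\<phi> s x)) has_real_derivative lee (\<phi> t x)) (at t)" if t: "T \<le> t" for t
  proof -
    obtain k where k: "k \<in> \<A>" "\<phi> t x \<in> cdom k" by (rule chart_at)
    show ?thesis
      using smooth_function_along_flow[OF V(1) f k T(2)[OF t]] df[OF k(1)] lee_chart[OF k] k(2) T(2)[OF t] by auto
  qed
  have wind_f: "wind t x = wind T x + (f (\<phi> t x) - f (\<phi> T x))" if t: "T \<le> t" for t
  proof -
    have "((\<lambda>s. lee (\<phi> s x)) has_integral f (\<phi> t x) - f (\<phi> T x)) {T..t}"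
      using der t by (intro fundamental_theorem_of_calculus)
        (auto simp: has_real_derivative_iff_has_vector_derivative[symmetric] intro: DERIV_subset)
    then have "integral {T..t} (\<lambda>s. lee (\<phi> s x)) = f (\<phi> t x) - f (\<phi> T x)" by (rule integral_unique)
    moreover have "integral {0..t} (\<lambda>s. lee (\<phi> s x)) = integral {0..T} (\<lambda>s. lee (\<phi> s x)) + integral {T..t} (\<lambda>s. lee (\<phi> s x))"
      using T(1) t by (intro Henstock_Kurzweil_Integration.integral_combine[symmetric] lee_flow_integrable) auto
    ultimately show ?thesis using T(1) t by (simp add: wind_nonneg)
  qed
  obtain p where p: "p \<in> omega_limit \<phi> x"
  proof (cases "omega_limit \<phi> x = {}")
    case True
    then obtain S where "\<And>t. S \<le> t \<Longrightarrow> \<phi> t x \<notin> UNIV"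
      using omega_limit_avoids_closed[OF compact_space closed_UNIV] by (metis Int_empty_right)
    then show ?thesis by blast
  qed blast
  \<comment> \<open>Near a limit point the primitive is bounded below, and the orbit returns there at arbitrarily late times.\<close>
  define G where "G = V \<inter> f -` {f p - 1<..}"
  have "open G" unfolding G_def
    by (rule continuous_open_preimage[OF smooth_function_continuous[OF V(1) f] V(1)]) simp
  moreover have "p \<in> G" using p V by (auto simp: G_def)
  ultimately have return: "\<exists>t\<ge>S. \<phi> t x \<in> G" for S using omega_limit_frequently[OF p] by blast
  have "\<forall>\<^sub>F t in at_top. wind t x \<le> wind T x + (f p - 1 - f (\<phi> T x))"
    using lim by (simp add: filterlim_at_bot)
  then obtain S where S: "\<And>t. S \<le> t \<Longrightarrow> wind t x \<le> wind T x + (f p - 1 - f (\<phi> T x))"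
    by (auto simp: eventually_at_top_linorder)
  obtain t where "t \<ge> max S T" "\<phi> t x \<in> G" using return by blast
  then show False using S[of t] wind_f[of t] by (simp add: G_def)
qed

end

theorem corollary9:
  fixes \<A> :: "('m::{t2_space, second_countable_topology}, 'e::euclidean_space) chart set"
    and \<eta> :: "('m, 'e) form1" and \<omega> :: "('m, 'e) form2"
    and H :: "'m \<Rightarrow> real" and X :: "('m, 'e) vfield"
    and \<phi> :: "real \<Rightarrow> 'm \<Rightarrow> 'm" and A U :: "'m set"
  assumes "compact (UNIV :: 'm set)"
    and "conformal_symplectic \<A> \<eta> \<omega>"
    and "smooth_function_on \<A> UNIV H"
    and "hamiltonian_vector_field \<A> \<eta> \<omega> H X"
    and "flow_of \<A> X \<phi>"
    and "weak_attractor \<phi> A"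
    and "basin_of_attraction \<phi> A U"
  shows "null_set \<A> {x \<in> U - A. \<not> filterlim (\<lambda>t. winding \<A> \<eta> X \<phi> t x) at_bot at_top} \<and>
    (U \<noteq> A \<longrightarrow> (\<forall>V. open V \<and> A \<inter> {x. H x = 0} \<subseteq> V \<longrightarrow> \<not> exact_on \<A> \<eta> V))"
proof -
  interpret hamiltonian_system \<A> X \<phi> \<eta> \<omega> H
    using assms(1-5) by unfold_locales (auto simp: conformal_symplectic_def hamiltonian_vector_field_def)
  have A: "compact A" using assms(6) by (simp add: weak_attractor_def)
  have U: "open U" "A \<subseteq> U" "\<And>x. x \<in> U \<Longrightarrow> omega_limit \<phi> x \<subseteq> A"
    using assms(7) by (auto simp: basin_of_attraction_def)
  let ?bad = "{x \<in> U - A. \<not> filterlim (\<lambda>t. winding \<A> \<eta> X \<phi> t x) at_bot at_top}"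
  have null: "null_set \<A> ?bad" by (rule winding_tends_to_minus_infinity[OF A assms(7)])
  have "\<not> exact_on \<A> \<eta> V" if "U \<noteq> A" and V: "open V" "A \<inter> {x. H x = 0} \<subseteq> V" for V
  proof -
    have "open (U - A)" using U(1) compact_imp_closed[OF A] by (rule open_Diff)
    moreover have "U - A \<noteq> {}" using U(2) that(1) by blast
    ultimately have "\<not> null_set \<A> (U - A)" using open_null_set_empty by blast
    then have "?bad \<noteq> U - A" using null by metis
    then obtain x where x: "x \<in> U - A" "filterlim (\<lambda>t. winding \<A> \<eta> X \<phi> t x) at_bot at_top" by blast
    have "omega_limit \<phi> x \<subseteq> V" using U(3)[of x] omega_limit_in_zero_level[OF x(2)] V(2) x(1) by blast
    then show ?thesis by (rule not_exact_near_omega_limit[OF V(1) _ x(2)])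
  qed
  then show ?thesis using null by blast
qed

end
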